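(* Let $n\geq 2$, let $m\geq 1$ be an integer, and let $0<\alpha<2$. Let $f=f(x,u,Du,\cdots)\geq 0$ be a nonnegative nonlinearity (possibly depending on $x$, $u$ and derivatives of $u$) which is continuous with respect to $x\in\mathbb{R}^n$. Suppose that $u$ is a nonnegative classical solution of $$(-\Delta)^{m+\frac{\alpha}{2}}u(x)=f(x,u,Du,\cdots),\qquad x\in\mathbb{R}^n,$$ that is, $u\in C^{2m+[\alpha],\{\alpha\}+\epsilon}_{loc}(\mathbb{R}^n)\cap\mathcal{L}_\alpha(\mathbb{R}^n)$ for some arbitrarily small $\epsilon>0$, $u\geq 0$ in $\mathbb{R}^n$, and the equation holds pointwise in $\mathbb{R}^n$. Then, for every $i=0,1,\dots,m-1$, $$(-\Delta)^{i+\frac{\alpha}{2}}u(x)\geq 0\qquad\text{for all } x\in\mathbb{R}^n.$$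
   Context: $[\alpha]$ is the integer part of $\alpha$ and $\{\alpha\}=\alpha-[\alpha]$. $\mathcal{L}_\alpha(\mathbb{R}^n)=\{u:\mathbb{R}^n\to\mathbb{R} : \int_{\mathbb{R}^n}\frac{|u(x)|}{1+|x|^{n+\alpha}}dx<\infty\}$. For $0<\alpha<2$ and $u\in C^{[\alpha],\{\alpha\}+\epsilon}_{loc}(\mathbb{R}^n)\cap\mathcal{L}_\alpha(\mathbb{R}^n)$, the fractional Laplacian is $(-\Delta)^{\frac{\alpha}{2}}u(x)=C_{n,\alpha}\lim_{\varepsilon\to0}\int_{|y-x|\geq\varepsilon}\frac{u(x)-u(y)}{|x-y|^{n+\alpha}}dy$, where $C_{n,\alpha}>0$ is the usual normalization constant (Fourier multiplier $|\xi|^\alpha$). For $u\in C^{2m+[\alpha],\{\alpha\}+\epsilon}_{loc}(\mathbb{R}^n)\cap\mathcal{L}_\alpha(\mathbb{R}^n)$ one has $(-\Delta)^{\frac{\alpha}{2}}u\in C^{2m}(\mathbb{R}^n)$, and for integers $0\leq i\leq m$ one defines $(-\Delta)^{i+\frac{\alpha}{2}}u:=(-\Delta)^i\big((-\Delta)^{\frac{\alpha}{2}}u\big)$, with $-\Delta$ the usual Laplacian. In the equation, the right-hand side is the continuous function $x\mapsto f(x,u(x),Du(x),\cdots)$ on $\mathbb{R}^n$. *)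

theory Defs
  imports "HOL-Analysis.Analysis"
begin

definition partial_deriv :: "'n::finite \<Rightarrow> (real^'n \<Rightarrow> real) \<Rightarrow> real^'n \<Rightarrow> real" where
  "partial_deriv i v x = deriv (\<lambda>t::real. v (x + t *\<^sub>R axis i 1)) 0"

definition has_partial_deriv :: "'n::finite \<Rightarrow> (real^'n \<Rightarrow> real) \<Rightarrow> bool" where
  "has_partial_deriv i v \<longleftrightarrow>
     (\<forall>x. (\<lambda>t::real. v (x + t *\<^sub>R axis i 1)) differentiable (at 0))"

text \<open>An iterated partial derivative is indexed by the list of the directions of
  differentiation; the order of the derivative is the length of the list.\<close>

fun partial_derivs :: "'n::finite list \<Rightarrow> (real^'n \<Rightarrow> real) \<Rightarrow> real^'n \<Rightarrow> real" where
  "partial_derivs [] v = v"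
| "partial_derivs (i # is) v = partial_deriv i (partial_derivs is v)"

definition C_class :: "nat \<Rightarrow> (real^'n::finite \<Rightarrow> real) \<Rightarrow> bool" where
  "C_class k v \<longleftrightarrow>
     (\<forall>is. length is < k \<longrightarrow> (\<forall>i. has_partial_deriv i (partial_derivs is v))) \<and>
     (\<forall>is. length is \<le> k \<longrightarrow> continuous_on UNIV (partial_derivs is v))"

definition C_Holder_loc :: "nat \<Rightarrow> real \<Rightarrow> (real^'n::finite \<Rightarrow> real) set" where
  "C_Holder_loc k \<gamma> = {v. C_class k v \<and>
     (\<forall>is K. length is = k \<longrightarrow> compact K \<longrightarrow>
        (\<exists>C. \<forall>x\<in>K. \<forall>y\<in>K.
           \<bar>partial_derivs is v x - partial_derivs is v y\<bar> \<le> C * dist x y powr \<gamma>))}"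

definition L_space :: "real \<Rightarrow> (real^'n::finite \<Rightarrow> real) set" where
  "L_space \<alpha> = {v. v \<in> borel_measurable lebesgue \<and>
     integrable lebesgue (\<lambda>x. \<bar>v x\<bar> / (1 + norm x powr (real CARD('n) + \<alpha>)))}"

text \<open>This is the constant for which \<open>frac_laplace \<alpha>\<close> below has Fourier multiplier
  \<open>norm \<xi> powr \<alpha>\<close>, i.e. the reciprocal of the integral of
  \<open>(1 - cos (z \<bullet> e)) / norm z powr (n + \<alpha>)\<close> over \<open>z\<close> in n-dimensional space,
  for any unit vector \<open>e\<close>.\<close>

definition frac_laplace_const :: "nat \<Rightarrow> real \<Rightarrow> real" where
  "frac_laplace_const n \<alpha> =
     \<alpha> * 2 powr (\<alpha> - 1) * Gamma ((real n + \<alpha>) / 2) / (pi powr (real n / 2) * Gamma (1 - \<alpha> / 2))"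

text \<open>\<open>frac_laplace \<alpha>\<close> has order \<open>\<alpha>\<close>: it is minus the Laplacian to the power \<open>\<alpha> / 2\<close>.\<close>

definition frac_laplace :: "real \<Rightarrow> (real^'n::finite \<Rightarrow> real) \<Rightarrow> real^'n \<Rightarrow> real" where
  "frac_laplace \<alpha> u x = frac_laplace_const CARD('n) \<alpha> *
     Lim (at_right 0) (\<lambda>\<epsilon>::real.
       LINT y:{y. \<epsilon> \<le> dist y x}|lebesgue. (u x - u y) / dist x y powr (real CARD('n) + \<alpha>))"

definition neg_laplace :: "(real^'n::finite \<Rightarrow> real) \<Rightarrow> real^'n \<Rightarrow> real" where
  "neg_laplace v x = - (\<Sum>i\<in>UNIV. partial_deriv i (partial_deriv i v) x)"

text \<open>Minus the Laplacian to the power \<open>i + \<alpha> / 2\<close>.\<close>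

definition higher_frac_laplace ::
    "nat \<Rightarrow> real \<Rightarrow> (real^'n::finite \<Rightarrow> real) \<Rightarrow> real^'n \<Rightarrow> real" where
  "higher_frac_laplace i \<alpha> u = (neg_laplace ^^ i) (frac_laplace \<alpha> u)"

text \<open>The values at \<open>x\<close> of \<open>u\<close> and of its partial derivatives up to order \<open>k\<close>, padded by \<open>0\<close>
  beyond order \<open>k\<close>.\<close>

definition jet :: "nat \<Rightarrow> (real^'n::finite \<Rightarrow> real) \<Rightarrow> real^'n \<Rightarrow> 'n list \<Rightarrow> real" where
  "jet k u x = (\<lambda>is. if length is \<le> k then partial_derivs is u x else 0)"

end

theory Submission
  imports Defs
begin

text \<open>
  Since \<open>u\<close> lies in \<open>L_space \<alpha>\<close>, testing \<open>v = frac_laplace \<alpha> u\<close> against rescaled bumps of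
  radius \<open>R\<close> and moving the operator to the bump shows that the bump averages of \<open>v\<close> tend
  to \<open>0\<close> as \<open>R\<close> grows; integrating by parts, so do those of all \<open>(neg_laplace ^^ j) v\<close>. For a
  superharmonic function the bump averages around a point decrease in \<open>R\<close>, starting from its value
  at that point, so a superharmonic function with vanishing averages is nonnegative. Descending
  from \<open>(neg_laplace ^^ m) v \<ge> 0\<close> gives the theorem. That all these derivatives exist is seen by
  splitting the kernel \<open>norm h powr - (n + \<alpha>)\<close> into a part supported in the unit ball, where the
  derivatives fall on \<open>u\<close>, and a differentiable part without singularity, where they fall on the kernel.
\<close>

section \<open>Partial derivatives\<close>

text \<open>Spherical means would call for surface integrals. The truncated powers (R^2 - |x -
  a|^2)_+^M avoid them: the Laplacian of such a bump is a combination of the bumps with exponents M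
  - 1 and M - 2, so one identity yields both the gain of a factor R^-2 for each Laplacian and the
  monotonicity of the averages in R. The price is that each Laplacian costs two exponents, whence
  the condition 2j + 3 \<le> M for the averages of order j. The averages vanish in the limit because
  the fractional Laplacian of the unit bump decays like |z|^-(n + \<alpha>), which is the decay of
  the weight in \<open>L_space\<close>: after scaling, the tested integral is controlled by the
  integral of |u(x)| / (R^s + |x - a|^s) with s = n + \<alpha>, and dominated convergence applies.
  The principal value obstructs both differentiation and Fubini. Second differences remove it: in
  the given Holder class they are O(|h|^(\<alpha> + \<epsilon>)) whether \<alpha> lies below or
  above 1, so that all integrals converge absolutely.\<close>

definition has_pderiv :: "'n::finite \<Rightarrow> (real^'n \<Rightarrow> real) \<Rightarrow> (real^'n \<Rightarrow> real) \<Rightarrow> bool" where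
  "has_pderiv i v v' \<longleftrightarrow>
     (\<forall>x. ((\<lambda>t. v (x + t *\<^sub>R axis i 1)) has_real_derivative v' x) (at 0))"

lemma has_pderiv_iff: "has_pderiv i v v' \<longleftrightarrow> has_partial_deriv i v \<and> partial_deriv i v = v'"
proof
  assume "has_pderiv i v v'"
  then show "has_partial_deriv i v \<and> partial_deriv i v = v'"
    unfolding has_pderiv_def has_partial_deriv_def partial_deriv_def real_differentiable_def
    by (auto intro!: ext DERIV_imp_deriv)
next
  assume "has_partial_deriv i v \<and> partial_deriv i v = v'"
  then show "has_pderiv i v v'"
    unfolding has_pderiv_def has_partial_deriv_def partial_deriv_def
    by (auto simp: DERIV_deriv_iff_real_differentiable)
qed

lemma has_pderiv_imp_eq: "has_pderiv i v v' \<Longrightarrow> partial_deriv i v = v'"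
  by (simp add: has_pderiv_iff)

lemma has_pderiv_at:
  assumes "has_pderiv i v v'"
  shows "((\<lambda>t. v (x + t *\<^sub>R axis i 1)) has_real_derivative v' (x + t *\<^sub>R axis i 1)) (at t)"
proof -
  have "((\<lambda>s. v ((x + t *\<^sub>R axis i 1) + s *\<^sub>R axis i 1)) has_real_derivative
      v' (x + t *\<^sub>R axis i 1)) (at 0)"
    using assms unfolding has_pderiv_def by blast
  then show ?thesis
    using DERIV_shift[of "\<lambda>t. v (x + t *\<^sub>R axis i 1)" "v' (x + t *\<^sub>R axis i 1)" 0 t]
    by (simp add: algebra_simps scaleR_add_left)
qed

lemma has_pderiv_add:
  assumes "has_pderiv i v v'" "has_pderiv i w w'"
  shows "has_pderiv i (\<lambda>x. v x + w x) (\<lambda>x. v' x + w' x)"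
  using assms unfolding has_pderiv_def by (auto intro!: DERIV_add)

lemma has_pderiv_cmult:
  assumes "has_pderiv i v v'"
  shows "has_pderiv i (\<lambda>x. c * v x) (\<lambda>x. c * v' x)"
  using assms unfolding has_pderiv_def by (auto intro!: DERIV_cmult)

lemma has_pderiv_mult:
  assumes "has_pderiv i v v'" "has_pderiv i w w'"
  shows "has_pderiv i (\<lambda>x. v x * w x) (\<lambda>x. v' x * w x + v x * w' x)"
proof -
  have "((\<lambda>t. v (x + t *\<^sub>R axis i 1) * w (x + t *\<^sub>R axis i 1)) has_real_derivative
      v' x * w x + v x * w' x) (at 0)" for x
    using DERIV_mult[of "\<lambda>t. v (x + t *\<^sub>R axis i 1)" "v' x" 0 UNIV
        "\<lambda>t. w (x + t *\<^sub>R axis i 1)" "w' x"] assms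
    unfolding has_pderiv_def by (simp add: add.commute mult.commute)
  then show ?thesis unfolding has_pderiv_def by blast
qed

lemma has_pderiv_const: "has_pderiv i (\<lambda>x. c) (\<lambda>x. 0)"
  unfolding has_pderiv_def by simp

lemma has_pderiv_component:
  "has_pderiv i (\<lambda>x::real^'n::finite. x $ j) (\<lambda>x. if i = j then 1 else 0)"
proof -
  have "((\<lambda>t. x $ j + t * (if i = j then 1 else 0)) has_real_derivative
      (if i = j then 1 else 0)) (at 0)" for x :: "real^'n"
    by (auto intro!: derivative_eq_intros)
  then show ?thesis
    unfolding has_pderiv_def by (simp add: axis_def if_distrib cong: if_cong)
qed

lemma power2_norm_line:
  "(norm (x + t *\<^sub>R axis i 1 :: real^'n::finite))\<^sup>2 = (norm x)\<^sup>2 + 2 * t * x $ i + t\<^sup>2"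
  unfolding power2_norm_eq_inner by (simp add: inner_add_left inner_add_right inner_axis inner_axis'
      inner_axis_axis power2_eq_square distrib_left)

lemma has_pderiv_radial:
  assumes "\<And>s. (g has_real_derivative g' s) (at s)"
  shows "has_pderiv i (\<lambda>x::real^'n::finite. g ((norm x)\<^sup>2)) (\<lambda>x. 2 * x $ i * g' ((norm x)\<^sup>2))"
proof -
  have "((\<lambda>t. g ((norm x)\<^sup>2 + 2 * t * x $ i + t\<^sup>2)) has_real_derivative
      g' ((norm x)\<^sup>2) * (2 * x $ i)) (at 0)" for x :: "real^'n"
    by (rule DERIV_chain2[where f = g and g = "\<lambda>t. (norm x)\<^sup>2 + 2 * t * x $ i + t\<^sup>2"])
      (auto intro!: derivative_eq_intros assms)
  then show ?thesis
    unfolding has_pderiv_def power2_norm_line by (simp add: mult.commute mult.left_commute)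
qed

lemma has_pderiv_translate:
  assumes "has_pderiv i v v'"
  shows "has_pderiv i (\<lambda>x. v (x + a)) (\<lambda>x. v' (x + a))"
  unfolding has_pderiv_def
proof
  fix x
  have "((\<lambda>t. v ((x + a) + t *\<^sub>R axis i 1)) has_real_derivative v' (x + a)) (at 0)"
    using assms unfolding has_pderiv_def by blast
  then show "((\<lambda>t. v (x + t *\<^sub>R axis i 1 + a)) has_real_derivative v' (x + a)) (at 0)"
    by (simp add: algebra_simps)
qed

section \<open>The classes of continuously differentiable functions\<close>

lemma partial_derivs_append: "partial_derivs (is @ js) v = partial_derivs is (partial_derivs js v)"
  by (induction "is") auto

lemma C_class_0: "C_class 0 v \<longleftrightarrow> continuous_on UNIV v"
  by (auto simp: C_class_def)

text \<open>Peels off the derivative that is applied first, which is the last entry of the list.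
  This turns the definition by lists into a recursion, so that closure properties follow by
  induction on k with one partial derivative at a time.\<close>

lemma C_class_Suc:
  "C_class (Suc k) v \<longleftrightarrow>
     continuous_on UNIV v \<and> (\<forall>i. \<exists>v'. has_pderiv i v v' \<and> C_class k v')"
proof
  assume C: "C_class (Suc k) v"
  have "continuous_on UNIV v"
    using C[unfolded C_class_def, THEN conjunct2, rule_format, of "[]"] by simp
  moreover have "has_pderiv i v (partial_deriv i v) \<and> C_class k (partial_deriv i v)" for i
  proof
    show "has_pderiv i v (partial_deriv i v)"
      using C[unfolded C_class_def, THEN conjunct1, rule_format, of "[]" i]
      by (simp add: has_pderiv_iff)
    have eq: "partial_derivs is (partial_deriv i v) = partial_derivs (is @ [i]) v" for "is"
      by (simp add: partial_derivs_append)
    show "C_class k (partial_deriv i v)"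
      using C unfolding C_class_def eq by auto
  qed
  ultimately show "continuous_on UNIV v \<and> (\<forall>i. \<exists>v'. has_pderiv i v v' \<and> C_class k v')"
    by blast
next
  assume R: "continuous_on UNIV v \<and> (\<forall>i. \<exists>v'. has_pderiv i v v' \<and> C_class k v')"
  then have hp: "has_partial_deriv i v" and C: "C_class k (partial_deriv i v)" for i
    unfolding has_pderiv_iff by auto
  have 1: "has_partial_deriv i (partial_derivs is v)" if "length is < Suc k" for i "is"
  proof (cases "is" rule: rev_cases)
    case (snoc js j)
    then show ?thesis using that C[of j] by (simp add: partial_derivs_append C_class_def)
  qed (use hp in auto)
  have 2: "continuous_on UNIV (partial_derivs is v)" if "length is \<le> Suc k" for "is"
  proof (cases "is" rule: rev_cases)
    case (snoc js j)
    then show ?thesis using that C[of j] by (simp add: partial_derivs_append C_class_def)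
  qed (use R in auto)
  show "C_class (Suc k) v"
    unfolding C_class_def using 1 2 by blast
qed

lemma C_class_pderiv: "C_class (Suc k) v \<Longrightarrow> has_pderiv i v (partial_deriv i v)"
  and C_class_partial_deriv: "C_class (Suc k) v \<Longrightarrow> C_class k (partial_deriv i v)"
  by (auto simp: C_class_Suc has_pderiv_iff)

lemma C_class_continuous: "C_class k v \<Longrightarrow> continuous_on UNIV v"
  by (cases k) (auto simp: C_class_0 C_class_Suc)

lemma C_class_mono: "C_class k v \<Longrightarrow> j \<le> k \<Longrightarrow> C_class j v"
  unfolding C_class_def by auto

lemma C_class_add: "C_class k v \<Longrightarrow> C_class k w \<Longrightarrow> C_class k (\<lambda>x. v x + w x)"
proof (induction k arbitrary: v w)
  case 0
  then show ?case by (auto simp: C_class_0 intro: continuous_on_add)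
next
  case (Suc k)
  have "has_pderiv i (\<lambda>x. v x + w x) (\<lambda>x. partial_deriv i v x + partial_deriv i w x)" for i
    using Suc.prems by (intro has_pderiv_add C_class_pderiv)
  moreover have "C_class k (\<lambda>x. partial_deriv i v x + partial_deriv i w x)" for i
    using Suc by (intro Suc.IH C_class_partial_deriv)
  moreover have "continuous_on UNIV (\<lambda>x. v x + w x)"
    using Suc.prems by (intro continuous_on_add C_class_continuous)
  ultimately show ?case unfolding C_class_Suc by blast
qed

lemma C_class_cmult: "C_class k v \<Longrightarrow> C_class k (\<lambda>x. c * v x)"
proof (induction k arbitrary: v)
  case 0
  then show ?case by (auto simp: C_class_0 intro: continuous_on_mult_left)
next
  case (Suc k)
  have "has_pderiv i (\<lambda>x. c * v x) (\<lambda>x. c * partial_deriv i v x)" for i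
    using Suc.prems by (intro has_pderiv_cmult C_class_pderiv)
  moreover have "C_class k (\<lambda>x. c * partial_deriv i v x)" for i
    using Suc by (intro Suc.IH C_class_partial_deriv)
  moreover have "continuous_on UNIV (\<lambda>x. c * v x)"
    using Suc.prems by (intro continuous_on_mult_left C_class_continuous)
  ultimately show ?case unfolding C_class_Suc by blast
qed

lemma C_class_const: "C_class k (\<lambda>x. c)"
proof (induction k arbitrary: c)
  case (Suc k)
  then show ?case unfolding C_class_Suc using has_pderiv_const continuous_on_const by blast
qed (simp add: C_class_0)

lemma C_class_sum: "(\<And>i. i \<in> A \<Longrightarrow> C_class k (v i)) \<Longrightarrow> C_class k (\<lambda>x. \<Sum>i\<in>A. v i x)"
  by (induction A rule: infinite_finite_induct) (auto simp: C_class_const C_class_add)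

lemma C_class_neg_laplace:
  assumes "C_class (k + 2) v"
  shows "C_class k (neg_laplace v)"
proof -
  have "C_class (Suc (Suc k)) v" using assms by simp
  then have "C_class k (\<lambda>x. \<Sum>i\<in>UNIV. partial_deriv i (partial_deriv i v) x)"
    by (intro C_class_sum C_class_partial_deriv)
  then have "C_class k (\<lambda>x. - 1 * (\<Sum>i\<in>UNIV. partial_deriv i (partial_deriv i v) x))"
    by (rule C_class_cmult)
  then show ?thesis by (simp add: neg_laplace_def [abs_def])
qed

section \<open>Increments and second differences\<close>

text \<open>The mean value theorem is applied to one coordinate after the other.\<close>

lemma increment_bound:
  fixes v :: "real^'n::finite \<Rightarrow> real"
  assumes hp: "\<And>i. has_pderiv i v (v' i)"
    and close: "\<And>i y. dist x y \<le> norm h \<Longrightarrow> \<bar>v' i y - v' i x\<bar> \<le> e"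
  shows "\<bar>v (x + h) - v x - (\<Sum>i\<in>UNIV. h $ i * v' i x)\<bar> \<le> real CARD('n) * norm h * e"
proof -
  define hS where "hS S = (\<chi> i. if i \<in> S then h $ i else 0)" for S
  have main: "\<bar>v (x + hS S) - v x - (\<Sum>i\<in>S. h $ i * v' i x)\<bar> \<le> (\<Sum>i\<in>S. norm h * e)" for S
  proof (induction S rule: finite_induct[OF finite])
    case 1
    have "hS {} = 0" by (simp add: hS_def vec_eq_iff)
    then show ?case by simp
  next
    case (2 j S)
    have ins: "hS (insert j S) = hS S + (h $ j) *\<^sub>R axis j 1"
      using 2 by (auto simp: hS_def vec_eq_iff axis_def)
    define p where "p t = v (x + hS S + t *\<^sub>R axis j 1)" for t
    define p' where "p' t = v' j (x + hS S + t *\<^sub>R axis j 1) - v' j x" for t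
    have d: "((\<lambda>t. p t - t * v' j x) has_real_derivative p' t) (at t)" for t
      unfolding p_def p'_def by (auto intro!: derivative_eq_intros has_pderiv_at[OF hp])
    have p'b: "\<bar>p' t\<bar> \<le> e" if "\<bar>t\<bar> \<le> \<bar>h $ j\<bar>" for t
    proof -
      \<comment> \<open>The intermediate points of the coordinate path are dominated by h in every
        component, so they stay in the ball on which \<open>close\<close> controls the
        derivatives.\<close>
      have "norm (hS S + t *\<^sub>R axis j 1) \<le> norm h"
      proof (rule norm_le_componentwise_cart)
        fix i show "norm ((hS S + t *\<^sub>R axis j 1) $ i) \<le> norm (h $ i)"
          using that 2 by (auto simp: hS_def axis_def)
      qed
      moreover have "dist x (x + k) = norm k" for k :: "real^'n" by (simp add: dist_norm)
      ultimately show ?thesis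
        unfolding p'_def add.assoc by (intro close) simp
    qed
    have "norm ((p (h $ j) - h $ j * v' j x) - (p 0 - 0 * v' j x)) \<le> e * norm (h $ j - 0)"
    proof (rule field_differentiable_bound[where S = "{-\<bar>h $ j\<bar>..\<bar>h $ j\<bar>}"
          and f = "\<lambda>t. p t - t * v' j x" and f' = p'])
      show "((\<lambda>t. p t - t * v' j x) has_real_derivative p' t) (at t within {-\<bar>h $ j\<bar>..\<bar>h $ j\<bar>})" for t
        by (rule has_field_derivative_at_within[OF d])
      show "norm (p' t) \<le> e" if "t \<in> {-\<bar>h $ j\<bar>..\<bar>h $ j\<bar>}" for t
        using p'b[of t] that by (simp add: abs_le_iff)
      show "h $ j \<in> {-\<bar>h $ j\<bar>..\<bar>h $ j\<bar>}" by auto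
    qed auto
    then have "\<bar>(p (h $ j) - h $ j * v' j x) - (p 0 - 0 * v' j x)\<bar> \<le> e * \<bar>h $ j\<bar>" by simp
    also have "\<dots> \<le> e * norm h"
    proof -
      have "0 \<le> e" using close[of x j] by (simp)
      then show ?thesis by (intro mult_left_mono component_le_norm_cart)
    qed
    finally have "\<bar>v (x + hS (insert j S)) - v (x + hS S) - h $ j * v' j x\<bar> \<le> norm h * e"
      unfolding p_def ins by (simp add: add.assoc mult.commute algebra_simps)
    then show ?case using 2 by (simp del: sum_constant)
  qed
  have "hS UNIV = h" by (simp add: hS_def vec_eq_iff)
  then show ?thesis using main[of UNIV] by simp
qed

text \<open>The sign is that of \<open>u x - u y\<close> in the fractional Laplacian, summed over y
  = x + h and y = x - h.\<close>

definition second_diff :: "('a::real_vector \<Rightarrow> real) \<Rightarrow> 'a \<Rightarrow> 'a \<Rightarrow> real" where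
  "second_diff v x h = 2 * v x - v (x + h) - v (x - h)"

text \<open>One modulus for both regimes: it holds for Holder functions of order \<sigma> and also
  for differentiable functions whose gradient is Holder of order \<sigma> - 1. The constant is
  uniform for x in a ball, which is what domination of integrals with parameter x requires.\<close>

definition sd_bounded :: "real \<Rightarrow> ('a::real_normed_vector \<Rightarrow> real) \<Rightarrow> bool" where
  "sd_bounded \<sigma> v \<longleftrightarrow>
     (\<forall>R. \<exists>C. \<forall>x h. norm x \<le> R \<longrightarrow> norm h \<le> 1 \<longrightarrow> \<bar>second_diff v x h\<bar> \<le> C * norm h powr \<sigma>)"

definition loc_Holder :: "real \<Rightarrow> ('a::real_normed_vector \<Rightarrow> real) \<Rightarrow> bool" where
  "loc_Holder \<gamma> v \<longleftrightarrow>
     (\<forall>R. \<exists>C\<ge>0. \<forall>x y. norm x \<le> R \<longrightarrow> norm y \<le> R \<longrightarrow> \<bar>v x - v y\<bar> \<le> C * dist x y powr \<gamma>)"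

lemma loc_HolderE:
  assumes "loc_Holder \<gamma> v"
  obtains C where "C \<ge> 0" "\<And>x y. norm x \<le> R \<Longrightarrow> norm y \<le> R \<Longrightarrow> \<bar>v x - v y\<bar> \<le> C * dist x y powr \<gamma>"
  using assms unfolding loc_Holder_def by meson

lemma continuous_bounded_cball:
  fixes v :: "'a::euclidean_space \<Rightarrow> real"
  assumes "continuous_on UNIV v"
  obtains B where "B \<ge> 0" "\<And>x. norm x \<le> R \<Longrightarrow> \<bar>v x\<bar> \<le> B"
proof -
  have "bounded (v ` cball 0 R)"
    by (intro compact_imp_bounded compact_continuous_image compact_cball
        continuous_on_subset[OF assms subset_UNIV])
  then obtain B where B: "\<And>y. y \<in> v ` cball 0 R \<Longrightarrow> norm y \<le> B"
    unfolding bounded_iff by blast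
  have "\<bar>v x\<bar> \<le> max 0 B" if "norm x \<le> R" for x
    using B[of "v x"] that by simp
  then show ?thesis by (rule that[OF max.cobounded1])
qed

lemma loc_Lipschitz_C1:
  fixes v :: "real^'n::finite \<Rightarrow> real"
  assumes hp: "\<And>i. has_pderiv i v (v' i)" and cont: "\<And>i. continuous_on UNIV (v' i)"
  shows "loc_Holder 1 v"
  unfolding loc_Holder_def
proof
  fix R :: real
  \<comment> \<open>Two points of the ball of radius R differ by at most 2R, so every point compared
    by \<open>increment_bound\<close> has norm at most 3R.\<close>
  have "\<exists>B\<ge>0. \<forall>x. norm x \<le> 3 * \<bar>R\<bar> \<longrightarrow> \<bar>v' i x\<bar> \<le> B" for i
    using continuous_bounded_cball[OF cont[of i], of "3 * \<bar>R\<bar>"] by metis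
  then obtain B where B: "\<And>i. B i \<ge> 0" "\<And>i x. norm x \<le> 3 * \<bar>R\<bar> \<Longrightarrow> \<bar>v' i x\<bar> \<le> B i"
    by metis
  define b where "b = (\<Sum>i\<in>UNIV. B i)"
  have b: "\<bar>v' i x\<bar> \<le> b" if "norm x \<le> 3 * \<bar>R\<bar>" for i x
    using B(2)[OF that, of i] member_le_sum[of i UNIV B] B(1) unfolding b_def by (simp add: order_trans)
  have b0: "b \<ge> 0" unfolding b_def by (intro sum_nonneg B)
  have "\<bar>v x - v y\<bar> \<le> (3 * real CARD('n) * b) * dist x y powr 1"
    if xy: "norm x \<le> R" "norm y \<le> R" for x y
  proof -
    define h where "h = y - x"
    have hR: "norm h \<le> 2 * \<bar>R\<bar>"
      unfolding h_def using xy norm_triangle_ineq4[of y x] by linarith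
    have "\<bar>v (x + h) - v x - (\<Sum>i\<in>UNIV. h $ i * v' i x)\<bar> \<le> real CARD('n) * norm h * (2 * b)"
    proof (rule increment_bound[OF hp])
      fix i y assume "dist x y \<le> norm h"
      then have "norm y \<le> 3 * \<bar>R\<bar>"
        using norm_triangle_sub[of y x] hR xy by (simp add: dist_norm norm_minus_commute)
      moreover have "norm x \<le> 3 * \<bar>R\<bar>" using xy by simp
      ultimately show "\<bar>v' i y - v' i x\<bar> \<le> 2 * b"
        using b[of y i] b[of x i] by linarith
    qed
    moreover have "\<bar>\<Sum>i\<in>UNIV. h $ i * v' i x\<bar> \<le> (\<Sum>i\<in>(UNIV::'n set). norm h * b)"
    proof (rule order_trans[OF sum_abs], rule sum_mono)
      fix i
      show "\<bar>h $ i * v' i x\<bar> \<le> norm h * b"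
        unfolding abs_mult using xy b[of x i] component_le_norm_cart[of h i]
        by (intro mult_mono) auto
    qed
    ultimately have "\<bar>v (x + h) - v x\<bar> \<le> real CARD('n) * norm h * (2 * b) + real CARD('n) * (norm h * b)"
      unfolding sum_constant by linarith
    also have "\<dots> = 3 * real CARD('n) * b * norm h" by (simp add: algebra_simps)
    finally show ?thesis unfolding h_def by (simp add: dist_norm norm_minus_commute abs_minus_commute)
  qed
  moreover have "0 \<le> 3 * real CARD('n) * b" using b0 by simp
  ultimately show "\<exists>C\<ge>0. \<forall>x y. norm x \<le> R \<longrightarrow> norm y \<le> R \<longrightarrow> \<bar>v x - v y\<bar> \<le> C * dist x y powr 1"
    by blast
qed

lemma loc_Holder_mono:
  assumes "loc_Holder 1 v" "0 < \<gamma>" "\<gamma> \<le> 1"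
  shows "loc_Holder \<gamma> v"
  unfolding loc_Holder_def
proof
  fix R :: real
  obtain C where C: "C \<ge> 0" "\<And>x y. norm x \<le> R \<Longrightarrow> norm y \<le> R \<Longrightarrow> \<bar>v x - v y\<bar> \<le> C * dist x y powr 1"
    using loc_HolderE[OF assms(1)] by blast
  have "\<bar>v x - v y\<bar> \<le> (C * (1 + 2 * \<bar>R\<bar>) powr (1 - \<gamma>)) * dist x y powr \<gamma>"
    if xy: "norm x \<le> R" "norm y \<le> R" for x y
  proof -
    have "dist x y powr 1 = dist x y powr (1 - \<gamma>) * dist x y powr \<gamma>"
      by (simp flip: powr_add)
    also have "\<dots> \<le> (1 + 2 * \<bar>R\<bar>) powr (1 - \<gamma>) * dist x y powr \<gamma>"
    proof (intro mult_right_mono powr_mono2)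
      show "dist x y \<le> 1 + 2 * \<bar>R\<bar>" using xy norm_triangle_ineq4[of x y] by (simp add: dist_norm)
    qed (use assms in auto)
    finally have "C * dist x y powr 1 \<le> C * ((1 + 2 * \<bar>R\<bar>) powr (1 - \<gamma>) * dist x y powr \<gamma>)"
      using C(1) by (intro mult_left_mono)
    then show ?thesis using C(2)[OF xy] by (simp only: mult.assoc)
  qed
  moreover have "0 \<le> C * (1 + 2 * \<bar>R\<bar>) powr (1 - \<gamma>)" using C(1) by simp
  ultimately show "\<exists>C\<ge>0. \<forall>x y. norm x \<le> R \<longrightarrow> norm y \<le> R \<longrightarrow> \<bar>v x - v y\<bar> \<le> C * dist x y powr \<gamma>"
    by blast
qed

lemma loc_Holder_imp_sd_bounded:
  assumes "loc_Holder \<gamma> v"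
  shows "sd_bounded \<gamma> v"
  unfolding sd_bounded_def
proof
  fix R :: real
  obtain C where C: "C \<ge> 0"
    "\<And>x y. norm x \<le> \<bar>R\<bar> + 1 \<Longrightarrow> norm y \<le> \<bar>R\<bar> + 1 \<Longrightarrow> \<bar>v x - v y\<bar> \<le> C * dist x y powr \<gamma>"
    using loc_HolderE[OF assms] by blast
  have "\<bar>second_diff v x h\<bar> \<le> (2 * C) * norm h powr \<gamma>" if "norm x \<le> R" "norm h \<le> 1" for x h
  proof -
    have "norm x \<le> \<bar>R\<bar> + 1" "norm (x + h) \<le> \<bar>R\<bar> + 1" "norm (x - h) \<le> \<bar>R\<bar> + 1"
      using that norm_triangle_ineq[of x h] norm_triangle_ineq4[of x h] by linarith+
    then have "\<bar>v x - v (x + h)\<bar> \<le> C * norm h powr \<gamma>" "\<bar>v x - v (x - h)\<bar> \<le> C * norm h powr \<gamma>"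
      using C(2)[of x "x + h"] C(2)[of x "x - h"] by (simp_all add: dist_norm)
    then show ?thesis unfolding second_diff_def by (simp add: algebra_simps abs_le_iff)
  qed
  then show "\<exists>C. \<forall>x h. norm x \<le> R \<longrightarrow> norm h \<le> 1 \<longrightarrow> \<bar>second_diff v x h\<bar> \<le> C * norm h powr \<gamma>"
    by blast
qed

text \<open>The linear terms of the increments along h and -h cancel. What remains is the
  oscillation of the gradient, of order |h|^\<gamma>, times |h|.\<close>

lemma sd_bounded_C1:
  fixes v :: "real^'n::finite \<Rightarrow> real"
  assumes hp: "\<And>i. has_pderiv i v (v' i)" and H: "\<And>i. loc_Holder \<gamma> (v' i)" and "0 < \<gamma>"
  shows "sd_bounded (1 + \<gamma>) v"
  unfolding sd_bounded_def
proof
  fix R :: real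
  have "\<exists>C\<ge>0. \<forall>x y. norm x \<le> \<bar>R\<bar> + 1 \<longrightarrow> norm y \<le> \<bar>R\<bar> + 1 \<longrightarrow> \<bar>v' i x - v' i y\<bar> \<le> C * dist x y powr \<gamma>" for i
    using H[of i] unfolding loc_Holder_def by blast
  then obtain B where B: "\<And>i. B i \<ge> 0"
    "\<And>i x y. norm x \<le> \<bar>R\<bar> + 1 \<Longrightarrow> norm y \<le> \<bar>R\<bar> + 1 \<Longrightarrow> \<bar>v' i x - v' i y\<bar> \<le> B i * dist x y powr \<gamma>"
    by metis
  define b where "b = (\<Sum>i\<in>UNIV. B i)"
  have Bb: "B i \<le> b" for i
    using member_le_sum[of i UNIV B] B(1) unfolding b_def by simp
  have b0: "b \<ge> 0" unfolding b_def by (intro sum_nonneg B)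
  have "\<bar>second_diff v x h\<bar> \<le> (2 * real CARD('n) * b) * norm h powr (1 + \<gamma>)"
    if xh: "norm x \<le> R" "norm h \<le> 1" for x h
  proof -
    have inc: "\<bar>v (x + k) - v x - (\<Sum>i\<in>UNIV. k $ i * v' i x)\<bar> \<le> real CARD('n) * norm k * (b * norm h powr \<gamma>)"
      if k: "norm k = norm h" for k
    proof (rule increment_bound[OF hp])
      fix i y assume d: "dist x y \<le> norm k"
      then have n: "norm y \<le> \<bar>R\<bar> + 1" "norm x \<le> \<bar>R\<bar> + 1"
        using norm_triangle_sub[of y x] xh k by (simp_all add: dist_norm norm_minus_commute)
      have "\<bar>v' i y - v' i x\<bar> \<le> B i * dist y x powr \<gamma>" using B(2)[OF n] .
      also have "\<dots> \<le> b * norm h powr \<gamma>"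
        using d k Bb B(1)[of i] b0 \<open>0 < \<gamma>\<close>
        by (intro mult_mono powr_mono2) (auto simp: dist_commute)
      finally show "\<bar>v' i y - v' i x\<bar> \<le> b * norm h powr \<gamma>" .
    qed
    have "(\<Sum>i\<in>UNIV. (- h) $ i * v' i x) = - (\<Sum>i\<in>UNIV. h $ i * v' i x)"
      by (simp add: sum_negf)
    then have "\<bar>second_diff v x h\<bar> \<le> 2 * (real CARD('n) * norm h * (b * norm h powr \<gamma>))"
      using inc[of h] inc[of "- h"] unfolding second_diff_def by simp
    also have "\<dots> = (2 * real CARD('n) * b) * (norm h * norm h powr \<gamma>)" by (simp only: mult_ac)
    also have "norm h * norm h powr \<gamma> = norm h powr (1 + \<gamma>)"
      by (cases "h = 0") (simp_all add: powr_add)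
    finally show ?thesis .
  qed
  then show "\<exists>C. \<forall>x h. norm x \<le> R \<longrightarrow> norm h \<le> 1 \<longrightarrow> \<bar>second_diff v x h\<bar> \<le> C * norm h powr (1 + \<gamma>)"
    by blast
qed

text \<open>If \<alpha> < 1, the derivative itself is Holder of order \<alpha> + \<epsilon>; if
  \<alpha> \<ge> 1, one more derivative exists and is Holder of order \<alpha> - 1 + \<epsilon>.
  Derivatives below the top order are locally Lipschitz, hence Holder of the same exponent because
  that exponent is below 1.\<close>

lemma C_Holder_loc_imp_sd_bounded:
  fixes u :: "real^'n::finite \<Rightarrow> real"
  assumes u: "u \<in> C_Holder_loc (j + nat \<lfloor>\<alpha>\<rfloor>) (frac \<alpha> + \<epsilon>)"
    and \<alpha>: "0 < \<alpha>" "\<alpha> < 2" and \<epsilon>: "0 < \<epsilon>" "frac \<alpha> + \<epsilon> < 1" and len: "length is \<le> j"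
  shows "sd_bounded (\<alpha> + \<epsilon>) (partial_derivs is u)"
proof -
  define k where "k = j + nat \<lfloor>\<alpha>\<rfloor>"
  have C: "C_class k u"
    and K: "\<And>is K. length is = k \<Longrightarrow> compact K \<Longrightarrow>
        \<exists>C. \<forall>x\<in>K. \<forall>y\<in>K. \<bar>partial_derivs is u x - partial_derivs is u y\<bar> \<le> C * dist x y powr (frac \<alpha> + \<epsilon>)"
    using u unfolding C_Holder_loc_def k_def by auto
  have fr: "0 < frac \<alpha> + \<epsilon>" using \<epsilon> frac_ge_0[of \<alpha>] by linarith
  have pd: "has_pderiv i (partial_derivs is u) (partial_derivs (i # is) u)" if "length is < k" for i "is"
    using C that unfolding C_class_def has_pderiv_iff by simp
  have H: "loc_Holder (frac \<alpha> + \<epsilon>) (partial_derivs is u)" if l: "length is \<le> k" for "is"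
  proof (cases "length is = k")
    case True
    show ?thesis unfolding loc_Holder_def
    proof
      fix R :: real
      obtain C where "\<forall>x\<in>cball 0 R. \<forall>y\<in>cball 0 R.
          \<bar>partial_derivs is u x - partial_derivs is u y\<bar> \<le> C * dist x y powr (frac \<alpha> + \<epsilon>)"
        using K[OF True compact_cball] by blast
      then have "\<bar>partial_derivs is u x - partial_derivs is u y\<bar> \<le> max 0 C * dist x y powr (frac \<alpha> + \<epsilon>)"
        if "norm x \<le> R" "norm y \<le> R" for x y
        using that by (intro order_trans[OF _ mult_right_mono[of C "max 0 C"]]) auto
      then show "\<exists>C\<ge>0. \<forall>x y. norm x \<le> R \<longrightarrow> norm y \<le> R \<longrightarrow>
          \<bar>partial_derivs is u x - partial_derivs is u y\<bar> \<le> C * dist x y powr (frac \<alpha> + \<epsilon>)"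
        by (intro exI[of _ "max 0 C"] conjI allI impI max.cobounded1)
    qed
  next
    case False
    then have "length is < k" using l by simp
    then have "continuous_on UNIV (partial_derivs (i # is) u)" for i
      using C unfolding C_class_def by (simp del: partial_derivs.simps)
    with pd[OF \<open>length is < k\<close>] have "loc_Holder 1 (partial_derivs is u)"
      by (rule loc_Lipschitz_C1[where v' = "\<lambda>i. partial_derivs (i # is) u"])
    then show ?thesis using \<epsilon> fr by (simp add: loc_Holder_mono)
  qed
  consider "\<lfloor>\<alpha>\<rfloor> = 0" | "\<lfloor>\<alpha>\<rfloor> = 1" using \<alpha> by linarith
  then show ?thesis
  proof cases
    case 1
    then have "frac \<alpha> = \<alpha>" by (simp add: frac_def)
    then show ?thesis using loc_Holder_imp_sd_bounded[OF H[of "is"]] len by (simp add: k_def)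
  next
    case 2
    then have f: "frac \<alpha> = \<alpha> - 1" and k: "k = j + 1" by (simp_all add: frac_def k_def)
    have "sd_bounded (1 + (frac \<alpha> + \<epsilon>)) (partial_derivs is u)"
    proof (rule sd_bounded_C1[where v' = "\<lambda>i. partial_derivs (i # is) u"])
      show "has_pderiv i (partial_derivs is u) (partial_derivs (i # is) u)" for i
        using len k by (intro pd) simp
      show "loc_Holder (frac \<alpha> + \<epsilon>) (partial_derivs (i # is) u)" for i
        using len k by (intro H) simp
    qed (rule fr)
    then show ?thesis by (simp add: f)
  qed
qed

section \<open>Integrals of powers of the norm\<close>

lemma lborel_distr_isometry:
  fixes a :: "'a::euclidean_space"
  assumes "\<bar>c\<bar> = 1"
  shows "distr lborel borel (\<lambda>x. a + c *\<^sub>R x) = lborel"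
  using lborel_affine[of c a] assms by (auto simp: density_1)

lemma integral_isometry:
  fixes a :: "'a::euclidean_space" and f :: "'a \<Rightarrow> real"
  assumes "\<bar>c\<bar> = 1" and [measurable]: "f \<in> borel_measurable borel"
  shows "(LINT x|lborel. f (a + c *\<^sub>R x)) = (LINT x|lborel. f x)"
proof -
  have "(LINT x|lborel. f x) = (LINT x|distr lborel borel (\<lambda>x. a + c *\<^sub>R x). f x)"
    using lborel_distr_isometry[OF assms(1), of a] by simp
  also have "\<dots> = (LINT x|lborel. f (a + c *\<^sub>R x))"
    by (rule integral_distr) simp_all
  finally show ?thesis ..
qed

lemma integrable_isometry:
  fixes a :: "'a::euclidean_space" and f :: "'a \<Rightarrow> real"
  assumes "\<bar>c\<bar> = 1" and f: "integrable lborel f"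
  shows "integrable lborel (\<lambda>x. f (a + c *\<^sub>R x))"
proof -
  have "integrable (distr lborel borel (\<lambda>x. a + c *\<^sub>R x)) f"
    using lborel_distr_isometry[OF assms(1), of a] f by simp
  then show ?thesis
    by (rule integrable_distr[rotated]) simp
qed

lemma nn_integral_scaleR:
  fixes f :: "'a::euclidean_space \<Rightarrow> ennreal"
  assumes "c > 0" and [measurable]: "f \<in> borel_measurable borel"
  shows "(\<integral>\<^sup>+x. f x \<partial>lborel) = ennreal (c ^ DIM('a)) * (\<integral>\<^sup>+x. f (c *\<^sub>R x) \<partial>lborel)"
proof -
  have "(\<integral>\<^sup>+x. f x \<partial>lborel) =
      (\<integral>\<^sup>+x. f x \<partial>(density (distr lborel borel (\<lambda>x::'a. 0 + c *\<^sub>R x)) (\<lambda>_. \<bar>c\<bar> ^ DIM('a))))"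
    using lborel_affine[of c "0::'a"] assms(1) by simp
  also have "\<dots> = ennreal (c ^ DIM('a)) * (\<integral>\<^sup>+x. f (c *\<^sub>R x) \<partial>lborel)"
    using assms(1) by (simp add: nn_integral_density nn_integral_distr nn_integral_cmult)
  finally show ?thesis .
qed

text \<open>The shells around radius q^j cover A, and the j-th one contributes at most a constant
  times q^(j(e + n)), where n is the dimension: a convergent geometric series. The choice q = 1/2
  treats the singularity at the origin, q = 2 the tail at infinity.\<close>

lemma nn_integral_norm_powr_dyadic:
  fixes A :: "'a::euclidean_space set" and q e :: real
  assumes q: "0 < q" "q powr (e + DIM('a)) < 1"
    and A: "A \<in> sets borel" "\<And>h. h \<in> A \<Longrightarrow> \<exists>j::nat. q ^ j / 2 \<le> norm h \<and> norm h \<le> 2 * q ^ j"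
  shows "(\<integral>\<^sup>+h. ennreal (indicator A h * norm h powr e) \<partial>lborel) < \<infinity>"
proof -
  define N where "N = DIM('a)"
  define V where "V = unit_ball_vol (real N)"
  have V: "V \<ge> 0" unfolding V_def by (intro unit_ball_vol_nonneg) simp
  \<comment> \<open>Upper bound for \<open>norm h powr e\<close> on the j-th shell: there |h| / q^j
    lies between 1/2 and 2, and the factor \<open>2 powr \<bar>e\<bar>\<close> serves both signs of
    e.\<close>
  define c where "c j = 2 powr \<bar>e\<bar> * (q ^ j) powr e" for j :: nat
  have c0: "c j \<ge> 0" for j by (simp add: c_def)
  have pt: "ennreal (indicator A h * norm h powr e) \<le>
      (\<Sum>j. ennreal (c j) * indicator (cball 0 (2 * q ^ j)) h)" for h
  proof (cases "h \<in> A")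
    case True
    then obtain j where j: "q ^ j / 2 \<le> norm h" "norm h \<le> 2 * q ^ j" using A by blast
    have qj: "q ^ j > 0" using q by simp
    define \<tau> where "\<tau> = norm h / q ^ j"
    have \<tau>: "1 / 2 \<le> \<tau>" "\<tau> \<le> 2" using j qj by (auto simp: \<tau>_def field_simps)
    have "\<tau> powr e \<le> 2 powr \<bar>e\<bar>"
    proof (cases "e \<ge> 0")
      case True
      then show ?thesis using \<tau> by (simp add: powr_mono2)
    next
      case False
      have "\<tau> powr e \<le> (1 / 2) powr e" using \<tau> False by (intro powr_mono2') auto
      also have "\<dots> = 2 powr \<bar>e\<bar>" using False by (simp add: powr_divide powr_minus_divide)
      finally show ?thesis .
    qed
    moreover have "norm h = \<tau> * q ^ j" using q by (simp add: \<tau>_def)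
    ultimately have "norm h powr e \<le> c j"
      using \<tau> qj unfolding c_def by (simp add: powr_mult mult_right_mono)
    then have "ennreal (indicator A h * norm h powr e) \<le> ennreal (c j) * indicator (cball 0 (2 * q ^ j)) h"
      using True j by (simp add: ennreal_leI)
    also have "\<dots> = (\<Sum>i\<in>{j}. ennreal (c i) * indicator (cball 0 (2 * q ^ i)) h)"
      by (subst sum.insert) auto
    also have "\<dots> \<le> (\<Sum>j. ennreal (c j) * indicator (cball 0 (2 * q ^ j)) h)"
      by (rule sum_le_suminf) auto
    finally show ?thesis .
  qed simp
  define \<rho> where "\<rho> = q powr (e + N)"
  have \<rho>: "0 \<le> \<rho>" "\<rho> < 1" using q by (simp_all add: \<rho>_def N_def)
  have cj: "c j * (V * (2 ^ N * (q ^ j) ^ N)) = (2 powr \<bar>e\<bar> * V * 2 ^ N) * \<rho> ^ j" for j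
  proof -
    have "(q ^ j) powr e * (q ^ j) ^ N = (q ^ j) powr (e + N)"
      using q by (simp add: powr_add powr_realpow)
    also have "\<dots> = \<rho> ^ j"
      using q unfolding \<rho>_def by (simp add: powr_powr mult.commute flip: powr_realpow)
    finally show ?thesis by (simp add: c_def power_mult_distrib)
  qed
  have "(\<integral>\<^sup>+h. ennreal (indicator A h * norm h powr e) \<partial>lborel) \<le>
      (\<integral>\<^sup>+h. (\<Sum>j. ennreal (c j) * indicator (cball 0 (2 * q ^ j)) h) \<partial>(lborel::'a measure))"
    by (intro nn_integral_mono pt)
  also have "\<dots> = (\<Sum>j. \<integral>\<^sup>+h. ennreal (c j) * indicator (cball 0 (2 * q ^ j)) h \<partial>(lborel::'a measure))"
    by (rule nn_integral_suminf)
      (auto intro!: borel_measurable_times_ennreal borel_measurable_indicator)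
  also have "\<dots> = (\<Sum>j. ennreal ((2 powr \<bar>e\<bar> * V * 2 ^ N) * \<rho> ^ j))"
    using q V c0 by (simp add: nn_integral_cmult_indicator emeasure_cball ennreal_mult'[symmetric]
        power_mult_distrib cj flip: V_def N_def)
  also have "\<dots> < \<infinity>"
  proof -
    have "summable (\<lambda>j. (2 powr \<bar>e\<bar> * V * 2 ^ N) * \<rho> ^ j)"
      using \<rho> by (intro summable_mult summable_geometric) simp
    then have "(\<Sum>j. ennreal ((2 powr \<bar>e\<bar> * V * 2 ^ N) * \<rho> ^ j)) \<noteq> top"
      using V \<rho> by (intro ennreal_suminf_neq_top) auto
    then show ?thesis by (simp add: top.not_eq_extremum)
  qed
  finally show ?thesis .
qed

lemma dyadic_ge_1:
  fixes r :: real
  assumes "r \<ge> 1"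
  obtains j :: nat where "2 ^ j \<le> r" "r < 2 ^ Suc j"
proof
  define j where "j = nat \<lfloor>log 2 r\<rfloor>"
  have "log 2 r \<ge> 0" using assms by simp
  then have "real j \<le> log 2 r" "log 2 r < real (Suc j)" unfolding j_def by linarith+
  then have "2 powr real j \<le> r" "r < 2 powr real (Suc j)"
    using assms by (auto simp: le_log_iff log_less_iff)
  then show "2 ^ j \<le> r" "r < 2 ^ Suc j" by (simp_all only: powr_realpow)
qed

lemma nn_integral_norm_powr_unit_ball:
  fixes \<sigma> :: real
  assumes "\<sigma> > 0"
  shows "(\<integral>\<^sup>+h. ennreal (indicator (cball 0 1) h * norm h powr (\<sigma> - DIM('a))) \<partial>(lborel::'a::euclidean_space measure)) < \<infinity>"
proof -
  have "(\<integral>\<^sup>+h. ennreal (indicator (cball 0 1 - {0}) h * norm h powr (\<sigma> - DIM('a))) \<partial>(lborel::'a measure)) < \<infinity>"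
  proof (rule nn_integral_norm_powr_dyadic[where q = "1/2"])
    have "(1/2::real) powr \<sigma> < (1/2) powr 0" using assms by (intro powr_less_mono') auto
    then show "(1/2::real) powr (\<sigma> - DIM('a) + DIM('a)) < 1" by simp
    fix h :: 'a assume "h \<in> cball 0 1 - {0}"
    then have h: "0 < norm h" "norm h \<le> 1" by auto
    then obtain j where "2 ^ j \<le> 1 / norm h" "1 / norm h < 2 ^ Suc j"
      using dyadic_ge_1[of "1 / norm h"] by auto
    then show "\<exists>j. (1/2) ^ j / 2 \<le> norm h \<and> norm h \<le> 2 * (1/2) ^ j"
      using h by (intro exI[of _ j]) (auto simp: field_simps)
  qed auto
  \<comment> \<open>The origin lies in no shell, but putting it back changes nothing since
    \<open>0 powr e\<close> is 0 for every e.\<close>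
  also have "(\<lambda>h. ennreal (indicator (cball 0 1 - {0}) h * norm h powr (\<sigma> - DIM('a)))) =
      (\<lambda>h::'a. ennreal (indicator (cball 0 1) h * norm h powr (\<sigma> - DIM('a))))"
    by (auto simp: indicator_def)
  finally show ?thesis .
qed

text \<open>For s = n + \<alpha> this is the weight of \<open>L_space\<close>. It is comparable to
  \<open>norm y powr (- s)\<close> away from the origin and bounded near it.\<close>

definition weight :: "real \<Rightarrow> 'a::real_normed_vector \<Rightarrow> real" where
  "weight s y = 1 / (1 + norm y powr s)"

lemma weight_pos: "weight s y > 0"
  unfolding weight_def by (simp add: add_pos_nonneg)

lemma weight_le_1: "weight s y \<le> 1"
  unfolding weight_def by (simp add: add_pos_nonneg divide_le_eq_1)

lemma weight_minus [simp]: "weight s (- y) = weight s y"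
  by (simp add: weight_def)

lemma weight_measurable [measurable]: "weight s \<in> borel_measurable borel"
  unfolding weight_def [abs_def] by measurable

lemma powr_le_weight:
  assumes "norm h \<ge> 1" "s > 0"
  shows "norm h powr (- s) \<le> 2 * weight s h"
proof -
  have "1 \<le> norm h powr s" using assms by (simp add: ge_one_powr_ge_zero)
  then have "1 / norm h powr s \<le> 2 * (1 / (1 + norm h powr s))"
    by (auto simp: divide_simps)
  then show ?thesis by (simp add: weight_def powr_minus_divide)
qed

lemma weight_ge:
  assumes "norm h \<le> 1" "s > 0"
  shows "1 \<le> 2 * weight s h"
proof -
  have "norm h powr s \<le> 1" using assms powr_mono2[of s "norm h" 1] by simp
  then show ?thesis by (simp add: weight_def field_simps add_pos_nonneg)
qed

text \<open>Allows kernels centred at any x of a bounded set to be dominated by the weight centred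
  at 0. The constant comes from |y| \<le> (1 + R) max(1, |y - x|); the factor 2 absorbs the summand
  1 of the denominator.\<close>

lemma weight_translate:
  assumes "s > 0" "R \<ge> 0"
  shows "\<exists>C>0. \<forall>x y::'a::real_normed_vector. norm x \<le> R \<longrightarrow> weight s (y - x) \<le> C * weight s y"
proof (intro exI conjI allI impI)
  show "2 * (1 + R) powr s > 0" using assms by simp
  fix x y :: 'a assume x: "norm x \<le> R"
  have one: "1 \<le> (1 + R) powr s" using assms by (simp add: ge_one_powr_ge_zero)
  have "norm y \<le> norm (y - x) + norm x" using norm_triangle_sub[of y x] by (simp add: add.commute)
  also have "\<dots> \<le> max 1 (norm (y - x)) + R * max 1 (norm (y - x))"
    using x assms mult_left_mono[of 1 "max 1 (norm (y - x))" R] by (intro add_mono) auto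
  finally have "norm y \<le> (1 + R) * max 1 (norm (y - x))" by (simp add: distrib_right)
  then have "norm y powr s \<le> (1 + R) powr s * max 1 (norm (y - x)) powr s"
    using assms powr_mono2[of s "norm y" "(1 + R) * max 1 (norm (y - x))"] by (simp add: powr_mult)
  also have "\<dots> \<le> (1 + R) powr s * (1 + norm (y - x) powr s)"
    by (intro mult_left_mono) (auto simp: max_def)
  finally have "1 + norm y powr s \<le> 1 * 1 + (1 + R) powr s * (1 + norm (y - x) powr s)" by simp
  also have "\<dots> \<le> (1 + R) powr s * (1 + norm (y - x) powr s) + (1 + R) powr s * (1 + norm (y - x) powr s)"
    using one by (intro add_mono mult_mono) auto
  finally show "weight s (y - x) \<le> 2 * (1 + R) powr s * weight s y"
    by (simp add: weight_def field_simps add_pos_nonneg)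
qed

lemma weight_integrable:
  fixes s :: real
  assumes "s > DIM('a)"
  shows "integrable lborel (weight s :: 'a::euclidean_space \<Rightarrow> real)"
proof (rule integrableI_bounded)
  have tail: "(\<integral>\<^sup>+h. ennreal (indicator {h. 1 \<le> norm h} h * norm h powr (- s)) \<partial>(lborel::'a measure)) < \<infinity>"
  proof (rule nn_integral_norm_powr_dyadic[where q = 2])
    have "(2::real) powr (- s + DIM('a)) < 2 powr 0" using assms by (intro powr_less_mono) auto
    then show "(2::real) powr (- s + DIM('a)) < 1" by simp
    fix h :: 'a assume "h \<in> {h. 1 \<le> norm h}"
    then have h: "1 \<le> norm h" by simp
    then obtain j where "2 ^ j \<le> norm h" "norm h < 2 ^ Suc j"
      using dyadic_ge_1 by blast
    then show "\<exists>j. 2 ^ j / 2 \<le> norm h \<and> norm h \<le> 2 * 2 ^ j"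
      by (intro exI[of _ j]) auto
  qed auto
  have "(\<integral>\<^sup>+h. ennreal (norm (weight s h)) \<partial>(lborel::'a measure)) \<le>
      (\<integral>\<^sup>+h. indicator (cball 0 1) h + ennreal (indicator {h. 1 \<le> norm h} h * norm h powr (- s)) \<partial>(lborel::'a measure))"
  proof (rule nn_integral_mono)
    fix h :: 'a
    have "weight s h \<le> indicator (cball 0 1) h + indicator {h. 1 \<le> norm h} h * norm h powr (- s)"
    proof (cases "norm h \<le> 1")
      case True
      then show ?thesis using weight_le_1[of s h] by (auto simp: indicator_def)
    next
      case False
      then have "0 < norm h powr s" by auto
      then have "weight s h \<le> norm h powr (- s)"
        unfolding weight_def powr_minus_divide by (intro divide_left_mono mult_pos_pos add_pos_pos) auto
      then show ?thesis using False by simp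
    qed
    then show "ennreal (norm (weight s h)) \<le> indicator (cball 0 1) h + ennreal (indicator {h. 1 \<le> norm h} h * norm h powr (- s))"
      using weight_pos[of s h] ennreal_leI
      by (fastforce simp: ennreal_plus[symmetric] ennreal_indicator[symmetric] simp del: ennreal_plus)
  qed
  also have "\<dots> = emeasure lborel (cball 0 1 :: 'a set) +
      (\<integral>\<^sup>+h. ennreal (indicator {h. 1 \<le> norm h} h * norm h powr (- s)) \<partial>(lborel::'a measure))"
    by (subst nn_integral_add) (auto intro!: borel_measurable_indicator)
  also have "\<dots> < \<infinity>" using tail emeasure_lborel_cball_finite by (simp add: ennreal_add_eq_top less_top)
  finally show "(\<integral>\<^sup>+h. ennreal (norm (weight s h)) \<partial>(lborel::'a measure)) < \<infinity>" .
qed simp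

section \<open>Parameter-dependent integrals\<close>

text \<open>By the mean value theorem the difference quotients inherit the bound B from the
  derivative, so dominated convergence applies along every sequence tending to
  \<open>t0\<close>.\<close>

lemma has_real_derivative_integral:
  fixes F F' :: "real \<Rightarrow> 'a \<Rightarrow> real"
  assumes d: "d > 0"
    and int: "\<And>t. \<bar>t - t0\<bar> < d \<Longrightarrow> integrable M (F t)"
    and der: "\<And>t h. \<bar>t - t0\<bar> < d \<Longrightarrow> ((\<lambda>t. F t h) has_real_derivative F' t h) (at t)"
    and bd: "\<And>t h. \<bar>t - t0\<bar> < d \<Longrightarrow> \<bar>F' t h\<bar> \<le> B h"
    and B: "integrable M B" and meas: "F' t0 \<in> borel_measurable M"
  shows "((\<lambda>t. LINT h|M. F t h) has_real_derivative (LINT h|M. F' t0 h)) (at t0)"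
  unfolding has_field_derivative_iff
proof (rule tendsto_at_iff_sequentially[THEN iffD2], intro allI impI)
  fix X :: "nat \<Rightarrow> real"
  assume "\<forall>i. X i \<in> UNIV - {t0}" and X: "X \<longlonglongrightarrow> t0"
  then have ne: "X i \<noteq> t0" for i by blast
  obtain K where K: "\<And>i. i \<ge> K \<Longrightarrow> \<bar>X i - t0\<bar> < d"
    using X d unfolding lim_sequentially dist_real_def by blast
  \<comment> \<open>The shift by K discards the finitely many terms that may lie outside the
    neighbourhood where B dominates.\<close>
  define q where "q i h = (F (X (i + K)) h - F t0 h) / (X (i + K) - t0)" for i h
  have eq: "((\<lambda>t. ((LINT h|M. F t h) - (LINT h|M. F t0 h)) / (t - t0)) \<circ> X) (i + K) = (LINT h|M. q i h)" for i
    using int[of "X (i + K)"] int[of t0] K[of "i + K"] d unfolding q_def by simp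
  have "(\<lambda>i. LINT h|M. q i h) \<longlonglongrightarrow> (LINT h|M. F' t0 h)"
  proof (rule integral_dominated_convergence[where w = B])
    show "q i \<in> borel_measurable M" for i
      using borel_measurable_integrable[OF int[of "X (i + K)"]] borel_measurable_integrable[OF int[of t0]]
        K[of "i + K"] d unfolding q_def by simp
    have "(\<lambda>i. q i h) \<longlonglongrightarrow> F' t0 h" for h
    proof -
      have "((\<lambda>t. (F t h - F t0 h) / (t - t0)) \<longlongrightarrow> F' t0 h) (at t0)"
        using der[of t0 h] d by (simp add: has_field_derivative_iff)
      then have "(\<lambda>i. (F (X i) h - F t0 h) / (X i - t0)) \<longlonglongrightarrow> F' t0 h"
        using X ne by (auto simp: tendsto_at_iff_sequentially o_def)
      then show ?thesis unfolding q_def by (rule LIMSEQ_ignore_initial_segment)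
    qed
    then show "AE h in M. (\<lambda>i. q i h) \<longlonglongrightarrow> F' t0 h" by simp
    have "norm (q i h) \<le> B h" for i h
    proof -
      have *: "\<bar>X (i + K) - t0\<bar> < d" using K by simp
      have "norm (F (X (i + K)) h - F t0 h) \<le> B h * norm (X (i + K) - t0)"
      proof (rule field_differentiable_bound[where S = "ball t0 d" and f' = "\<lambda>t. F' t h"])
        show "((\<lambda>t. F t h) has_real_derivative F' t h) (at t within ball t0 d)" if "t \<in> ball t0 d" for t
          using that by (intro has_field_derivative_at_within[OF der]) (simp add: dist_real_def abs_minus_commute)
        show "norm (F' t h) \<le> B h" if "t \<in> ball t0 d" for t
          using that bd[of t h] by (simp add: dist_real_def abs_minus_commute)
      qed (use * d in \<open>auto simp: dist_real_def abs_minus_commute\<close>)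
      then show ?thesis using ne[of "i + K"] by (simp add: q_def field_simps)
    qed
    then show "AE h in M. norm (q i h) \<le> B h" for i by simp
  qed (use B meas in auto)
  then show "((\<lambda>t. ((LINT h|M. F t h) - (LINT h|M. F t0 h)) / (t - t0)) \<circ> X) \<longlonglongrightarrow> (LINT h|M. F' t0 h)"
    unfolding eq[symmetric] by (rule LIMSEQ_offset)
qed

lemma continuous_on_integral_dominated:
  fixes F :: "'b::real_normed_vector \<Rightarrow> 'a \<Rightarrow> real"
  assumes cont: "\<And>h. continuous_on UNIV (\<lambda>x. F x h)"
    and meas: "\<And>x. F x \<in> borel_measurable M"
    and bd: "\<And>R. \<exists>B. integrable M B \<and> (\<forall>x h. norm x \<le> R \<longrightarrow> \<bar>F x h\<bar> \<le> B h)"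
  shows "continuous_on UNIV (\<lambda>x. LINT h|M. F x h)"
  unfolding continuous_on_sequentially
proof (intro allI ballI impI)
  fix X :: "nat \<Rightarrow> 'b" and a assume "(\<forall>n. X n \<in> UNIV) \<and> X \<longlonglongrightarrow> a"
  then have X: "X \<longlonglongrightarrow> a" by simp
  then obtain R where R: "\<And>n. norm (X n) \<le> R"
    using Bseq_def convergent_def convergent_imp_Bseq by blast
  obtain B where B: "integrable M B" "\<And>x h. norm x \<le> R \<Longrightarrow> \<bar>F x h\<bar> \<le> B h"
    using bd by blast
  have "(\<lambda>n. F (X n) h) \<longlonglongrightarrow> F a h" for h
    by (rule continuous_on_tendsto_compose[OF cont X]) simp_all
  then show "((\<lambda>x. LINT h|M. F x h) \<circ> X) \<longlonglongrightarrow> (LINT h|M. F a h)"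
    unfolding o_def using B R meas by (intro integral_dominated_convergence[where w = B]) auto
qed

lemma has_pderiv_integral:
  fixes F F' :: "real^'n::finite \<Rightarrow> 'a \<Rightarrow> real"
  assumes int: "\<And>x. integrable M (F x)"
    and der: "\<And>h. has_pderiv i (\<lambda>x. F x h) (\<lambda>x. F' x h)"
    and bd: "\<And>R. \<exists>B. integrable M B \<and> (\<forall>x h. norm x \<le> R \<longrightarrow> \<bar>F' x h\<bar> \<le> B h)"
    and meas: "\<And>x. F' x \<in> borel_measurable M"
  shows "has_pderiv i (\<lambda>x. LINT h|M. F x h) (\<lambda>x. LINT h|M. F' x h)"
  unfolding has_pderiv_def
proof
  fix x :: "real^'n"
  obtain B where B: "integrable M B" "\<And>y h. norm y \<le> norm x + 1 \<Longrightarrow> \<bar>F' y h\<bar> \<le> B h"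
    using bd by blast
  have "((\<lambda>t. LINT h|M. F (x + t *\<^sub>R axis i 1) h) has_real_derivative
      (LINT h|M. F' (x + 0 *\<^sub>R axis i 1) h)) (at 0)"
  proof (rule has_real_derivative_integral[where d = 1 and B = B
        and F = "\<lambda>t. F (x + t *\<^sub>R axis i 1)" and F' = "\<lambda>t. F' (x + t *\<^sub>R axis i 1)"])
    fix t h assume "\<bar>t - 0\<bar> < (1::real)"
    then have "norm (x + t *\<^sub>R axis i 1) \<le> norm x + 1"
      by (intro order_trans[OF norm_triangle_ineq]) simp
    then show "\<bar>F' (x + t *\<^sub>R axis i 1) h\<bar> \<le> B h" by (rule B)
  qed (use int B meas has_pderiv_at[OF der] in auto)
  then show "((\<lambda>t. LINT h|M. F (x + t *\<^sub>R axis i 1) h) has_real_derivative (LINT h|M. F' x h)) (at 0)"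
    by simp
qed

section \<open>Regularity of singular integrals\<close>

lemma has_pderiv_diff:
  assumes "has_pderiv i v v'" "has_pderiv i w w'"
  shows "has_pderiv i (\<lambda>x. v x - w x) (\<lambda>x. v' x - w' x)"
  using assms unfolding has_pderiv_def by (auto intro!: DERIV_diff)

lemma has_pderiv_second_diff:
  assumes "has_pderiv i v v'"
  shows "has_pderiv i (\<lambda>x. second_diff v x h) (\<lambda>x. second_diff v' x h)"
  unfolding second_diff_def diff_conv_add_uminus[of _ h]
  by (intro has_pderiv_diff has_pderiv_cmult has_pderiv_translate assms)

lemma continuous_on_compose_UNIV:
  "continuous_on UNIV v \<Longrightarrow> continuous_on UNIV f \<Longrightarrow> continuous_on UNIV (\<lambda>x. v (f x))"
  by (rule continuous_on_compose2[of UNIV v UNIV f]) auto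

lemma second_diff_continuous:
  fixes v :: "'a::real_normed_vector \<Rightarrow> real"
  assumes "continuous_on UNIV v"
  shows "continuous_on UNIV (\<lambda>x. second_diff v x h)"
  unfolding second_diff_def
  by (intro continuous_intros continuous_on_compose_UNIV[OF assms])

lemma second_diff_measurable:
  fixes v :: "'a::euclidean_space \<Rightarrow> real"
  assumes "continuous_on UNIV v"
  shows "second_diff v x \<in> borel_measurable borel"
  unfolding second_diff_def [abs_def]
  by (intro borel_measurable_continuous_onI continuous_intros continuous_on_compose_UNIV[OF assms])

lemma integrable_abs_bound:
  fixes f B :: "'a \<Rightarrow> real"
  assumes "integrable M B" "f \<in> borel_measurable M" "\<And>h. \<bar>f h\<bar> \<le> B h"
  shows "integrable M f"
proof (rule Bochner_Integration.integrable_bound[OF assms(1,2)], rule AE_I2)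
  show "norm (f h) \<le> norm (B h)" for h
    using assms(3)[of h] by simp
qed

lemma integrable_norm_powr_unit_ball:
  fixes e :: real
  assumes "e + DIM('a) > 0"
  shows "integrable lborel (\<lambda>h::'a::euclidean_space. indicator (cball 0 1) h * norm h powr e)"
proof (rule integrableI_bounded)
  show "(\<integral>\<^sup>+h. ennreal (norm (indicator (cball 0 1) h * norm h powr e)) \<partial>(lborel::'a measure)) < \<infinity>"
    using nn_integral_norm_powr_unit_ball[OF assms, where ?'a = 'a] by (simp add: abs_mult)
  have [measurable]: "cball 0 1 \<in> sets (borel :: 'a measure)" by simp
  show "(\<lambda>h::'a. indicator (cball 0 1) h * norm h powr e) \<in> borel_measurable lborel" by measurable
qed

text \<open>The factor |h|^\<sigma> of the second difference weakens the singularity |h|^-s to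
  |h|^(\<sigma> - s), which is integrable near 0 as \<sigma> - s exceeds minus the dimension. The
  value of K at 0 is free because the second difference vanishes there.\<close>

lemma singular_bound:
  fixes v :: "'a::euclidean_space \<Rightarrow> real" and s \<sigma> :: real
  assumes sd: "sd_bounded \<sigma> v" and K: "\<And>h. h \<noteq> 0 \<Longrightarrow> \<bar>K h\<bar> \<le> C * norm h powr (- s)"
    and supp: "\<And>h. norm h > 1 \<Longrightarrow> K h = 0" and \<sigma>: "s < \<sigma> + DIM('a)"
  shows "\<exists>B. integrable lborel B \<and> (\<forall>x h. norm x \<le> R \<longrightarrow> \<bar>second_diff v x h * K h\<bar> \<le> B h)"
proof -
  obtain D where D: "\<And>x h. norm x \<le> R \<Longrightarrow> norm h \<le> 1 \<Longrightarrow> \<bar>second_diff v x h\<bar> \<le> D * norm h powr \<sigma>"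
    using sd unfolding sd_bounded_def by blast
  define B where "B h = (D * C) * (indicator (cball 0 1) h * norm h powr (\<sigma> - s))" for h :: 'a
  have "integrable lborel B"
    unfolding B_def using \<sigma> by (intro integrable_mult_right integrable_norm_powr_unit_ball) simp
  moreover have "\<bar>second_diff v x h * K h\<bar> \<le> B h" if x: "norm x \<le> R" for x h
  proof -
    consider "h = 0" | "norm h > 1" | "h \<noteq> 0" "norm h \<le> 1" by linarith
    then show ?thesis
    proof cases
      case 1
      then show ?thesis by (simp add: second_diff_def B_def)
    next
      case 2
      then show ?thesis by (simp add: supp B_def)
    next
      case 3
      have "\<bar>second_diff v x h\<bar> * \<bar>K h\<bar> \<le> (D * norm h powr \<sigma>) * (C * norm h powr (- s))"
        using D[OF x 3(2)] K[OF 3(1)] by (intro mult_mono) (auto intro: order_trans[OF abs_ge_zero])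
      also have "\<dots> = B h"
        using 3 powr_add[of "norm h" \<sigma> "- s"] by (simp add: B_def)
      finally show ?thesis by (simp add: abs_mult)
    qed
  qed
  ultimately show ?thesis by blast
qed

text \<open>Differentiation leaves K alone and replaces v by a partial derivative, so the induction
  varies v. The hypothesis on all derivatives up to order j supplies a dominating function at every
  level.\<close>

lemma C_class_singular:
  fixes v :: "real^'n::finite \<Rightarrow> real" and s \<sigma> :: real
  assumes C: "C_class j v" and sd: "\<And>is. length is \<le> j \<Longrightarrow> sd_bounded \<sigma> (partial_derivs is v)"
    and K: "\<And>h. h \<noteq> 0 \<Longrightarrow> \<bar>K h\<bar> \<le> C * norm h powr (- s)"
    and supp: "\<And>h. norm h > 1 \<Longrightarrow> K h = 0" and \<sigma>: "s < \<sigma> + CARD('n)"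
    and Km: "K \<in> borel_measurable borel"
  shows "C_class j (\<lambda>x. LINT h|lborel. second_diff v x h * K h)"
  using C sd
proof (induction j arbitrary: v)
  have \<sigma>': "s < \<sigma> + DIM(real^'n)" using \<sigma> by simp
  have meas: "(\<lambda>h. second_diff v x h * K h) \<in> borel_measurable lborel"
    if "continuous_on UNIV v" for v :: "real^'n \<Rightarrow> real" and x
    using second_diff_measurable[OF that] Km by simp
  have cont: "continuous_on UNIV (\<lambda>x. LINT h|lborel. second_diff v x h * K h)"
    if c: "continuous_on UNIV v" and "sd_bounded \<sigma> v" for v :: "real^'n \<Rightarrow> real"
  proof (rule continuous_on_integral_dominated)
    show "continuous_on UNIV (\<lambda>x. second_diff v x h * K h)" for h
      by (intro continuous_on_mult_right second_diff_continuous c)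
  qed (rule meas[OF c], rule singular_bound[OF that(2) K supp \<sigma>'])
  {
    case 0
    then show ?case using 0(2)[of "[]"] by (simp add: C_class_0 cont)
  next
    case (Suc j)
    have c: "continuous_on UNIV v" using Suc.prems(1) by (rule C_class_continuous)
    have sd0: "sd_bounded \<sigma> v" using Suc.prems(2)[of "[]"] by simp
    have "has_pderiv i (\<lambda>x. LINT h|lborel. second_diff v x h * K h)
        (\<lambda>x. LINT h|lborel. second_diff (partial_deriv i v) x h * K h)" for i
    proof (rule has_pderiv_integral)
      have c': "continuous_on UNIV (partial_deriv i v)"
        using Suc.prems(1) by (intro C_class_continuous C_class_partial_deriv)
      show "integrable lborel (\<lambda>h. second_diff v x h * K h)" for x
      proof -
        obtain B where "integrable lborel B" "\<And>h. \<bar>second_diff v x h * K h\<bar> \<le> B h"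
          using singular_bound[OF sd0 K supp \<sigma>', of "norm x"] by blast
        then show ?thesis
          by (rule integrable_abs_bound[OF _ meas[OF c]])
      qed
      show "has_pderiv i (\<lambda>x. second_diff v x h * K h) (\<lambda>x. second_diff (partial_deriv i v) x h * K h)" for h
        unfolding mult.commute[of _ "K h"]
        by (intro has_pderiv_cmult has_pderiv_second_diff C_class_pderiv[OF Suc.prems(1)])
      show "\<exists>B. integrable lborel B \<and>
          (\<forall>x h. norm x \<le> R \<longrightarrow> \<bar>second_diff (partial_deriv i v) x h * K h\<bar> \<le> B h)" for R
        using Suc.prems(2)[of "[i]"] by (intro singular_bound[OF _ K supp \<sigma>']) auto
      show "(\<lambda>h. second_diff (partial_deriv i v) x h * K h) \<in> borel_measurable lborel" for x
        by (rule meas[OF c'])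
    qed
    moreover have "C_class j (\<lambda>x. LINT h|lborel. second_diff (partial_deriv i v) x h * K h)" for i
    proof (rule Suc.IH)
      show "C_class j (partial_deriv i v)" by (rule C_class_partial_deriv[OF Suc.prems(1)])
      show "sd_bounded \<sigma> (partial_derivs is (partial_deriv i v))" if "length is \<le> j" for "is"
        using Suc.prems(2)[of "is @ [i]"] that by (simp add: partial_derivs_append)
    qed
    ultimately show ?case
      unfolding C_class_Suc using cont[OF c sd0] by blast
  }
qed

section \<open>Convolution with the far part of the kernel\<close>

lemma DERIV_glue:
  fixes p q :: "real \<Rightarrow> real"
  assumes p: "\<And>t. t \<ge> a \<Longrightarrow> (p has_real_derivative p' t) (at t)"
    and q: "\<And>t. t \<le> a \<Longrightarrow> (q has_real_derivative q' t) (at t)"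
    and eq: "p a = q a" "p' a = q' a"
  shows "((\<lambda>t. if a \<le> t then p t else q t) has_real_derivative (if a \<le> t then p' t else q' t)) (at t)"
proof -
  consider "t > a" | "t < a" | "t = a" by linarith
  then show ?thesis
  proof cases
    case 1
    then have "(p has_real_derivative (if a \<le> t then p' t else q' t)) (at t)" using p[of t] by simp
    then show ?thesis
      by (rule has_field_derivative_transform_within_open[where S = "{a<..}"]) (use 1 in auto)
  next
    case 2
    then have "(q has_real_derivative (if a \<le> t then p' t else q' t)) (at t)" using q[of t] by simp
    then show ?thesis
      by (rule has_field_derivative_transform_within_open[where S = "{..<a}"]) (use 2 in auto)
  next
    case 3
    define f where "f t = (if a \<le> t then p t else q t)" for t
    have "((\<lambda>y. (p y - p a) / (y - a)) \<longlongrightarrow> p' a) (at_right a)"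
      using p[of a] by (auto simp: has_field_derivative_iff intro: filterlim_mono[OF _ order_refl at_le])
    moreover have "\<forall>\<^sub>F y in at_right a. (p y - p a) / (y - a) = (f y - f a) / (y - a)"
      by (auto simp: eventually_at_filter f_def intro!: always_eventually)
    ultimately have R: "((\<lambda>y. (f y - f a) / (y - a)) \<longlongrightarrow> p' a) (at_right a)"
      by (rule Lim_transform_eventually)
    have "((\<lambda>y. (q y - q a) / (y - a)) \<longlongrightarrow> p' a) (at_left a)"
      using q[of a] eq by (auto simp: has_field_derivative_iff intro: filterlim_mono[OF _ order_refl at_le])
    moreover have "\<forall>\<^sub>F y in at_left a. (q y - q a) / (y - a) = (f y - f a) / (y - a)"
      using eq by (auto simp: eventually_at_filter f_def intro!: always_eventually)
    ultimately have "((\<lambda>y. (f y - f a) / (y - a)) \<longlongrightarrow> p' a) (at_left a)"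
      by (rule Lim_transform_eventually)
    then have "((\<lambda>y. (f y - f a) / (y - a)) \<longlongrightarrow> p' a) (at a)" using R by (rule filterlim_split_at)
    then have "(f has_real_derivative p' a) (at a)" by (simp add: has_field_derivative_iff)
    then show ?thesis using 3 unfolding f_def by simp
  qed
qed

text \<open>The falling factorial (-\<beta>)(-\<beta> - 1) ... (-\<beta> - j + 1), that is, the
  coefficient in the j-th derivative of \<open>t powr (- \<beta>)\<close>.\<close>

fun powr_coeff :: "real \<Rightarrow> nat \<Rightarrow> real" where
  "powr_coeff \<beta> 0 = 1"
| "powr_coeff \<beta> (Suc j) = (- \<beta> - real j) * powr_coeff \<beta> j"

text \<open>The \<open>j\<close>-th derivative of the function that equals \<open>t powr - \<beta>\<close> for \<open>t \<ge> 1\<close> and is continued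
  to \<open>t < 1\<close> by its Taylor polynomial of degree \<open>N\<close> at \<open>1\<close>.\<close>

definition cut_powr :: "real \<Rightarrow> nat \<Rightarrow> nat \<Rightarrow> real \<Rightarrow> real" where
  "cut_powr \<beta> N j t = (if 1 \<le> t then powr_coeff \<beta> j * t powr (- \<beta> - real j)
     else (\<Sum>l\<le>N - j. powr_coeff \<beta> (j + l) * (t - 1) ^ l / fact l))"

text \<open>Differentiating the Taylor polynomial drops its constant term and shifts the
  coefficients, which gives the polynomial for j + 1 of degree one less. The strict bound on j makes
  \<open>N - j\<close> the successor of \<open>N - Suc j\<close>, so that truncated subtraction does
  no harm.\<close>

lemma DERIV_cut_powr:
  assumes "j < N"
  shows "(cut_powr \<beta> N j has_real_derivative cut_powr \<beta> N (Suc j) t) (at t)"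
  unfolding cut_powr_def [abs_def]
proof (rule DERIV_glue)
  define M where "M = N - Suc j"
  have NM: "N - j = Suc M" "N - Suc j = M" using assms by (auto simp: M_def)
  show "((\<lambda>t. powr_coeff \<beta> j * t powr (- \<beta> - real j)) has_real_derivative
      powr_coeff \<beta> (Suc j) * t powr (- \<beta> - real (Suc j))) (at t)" if "1 \<le> t" for t
    using that by (auto intro!: derivative_eq_intros simp: algebra_simps)
  have s: "((\<lambda>t. \<Sum>l\<le>N - j. powr_coeff \<beta> (j + l) * (t - 1) ^ l / fact l) has_real_derivative
      (\<Sum>l\<le>N - j. powr_coeff \<beta> (j + l) * (real l * (t - 1) ^ (l - 1)) / fact l)) (at t)" for t
    by (auto intro!: derivative_eq_intros DERIV_sum)
  have "(\<Sum>l\<le>N - j. powr_coeff \<beta> (j + l) * (real l * (t - 1) ^ (l - 1)) / fact l) =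
      (\<Sum>l\<le>N - Suc j. powr_coeff \<beta> (Suc j + l) * (t - 1) ^ l / fact l)" for t
    unfolding NM sum.atMost_Suc_shift
    by (auto intro!: sum.cong simp: field_simps simp del: powr_coeff.simps of_nat_Suc)
  with s show "((\<lambda>t. \<Sum>l\<le>N - j. powr_coeff \<beta> (j + l) * (t - 1) ^ l / fact l) has_real_derivative
      (\<Sum>l\<le>N - Suc j. powr_coeff \<beta> (Suc j + l) * (t - 1) ^ l / fact l)) (at t)" for t
    by simp
  \<comment> \<open>At the gluing point only the term l = 0 survives, by the convention
    \<open>0 ^ 0 = 1\<close>.\<close>
  have at1: "(\<Sum>l\<le>k. powr_coeff \<beta> (i + l) * (1 - 1) ^ l / fact l) = powr_coeff \<beta> i" for k i
    by (subst sum.atMost_shift) simp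
  show "powr_coeff \<beta> j * 1 powr (- \<beta> - real j) = (\<Sum>l\<le>N - j. powr_coeff \<beta> (j + l) * (1 - 1) ^ l / fact l)"
    unfolding at1 by simp
  show "powr_coeff \<beta> (Suc j) * 1 powr (- \<beta> - real (Suc j)) =
      (\<Sum>l\<le>N - Suc j. powr_coeff \<beta> (Suc j + l) * (1 - 1) ^ l / fact l)"
    unfolding at1 by simp
qed

lemma cut_powr_continuous: "j < N \<Longrightarrow> continuous_on S (cut_powr \<beta> N j)"
  by (rule DERIV_continuous_on[OF has_field_derivative_at_within[OF DERIV_cut_powr]])

text \<open>Here d bounds the degree from above. Sums and multiplication by a coordinate suffice as
  generators: the factor 2 from differentiating the squared norm is written as p + p.\<close>

inductive poly_deg :: "nat \<Rightarrow> (real^'n::finite \<Rightarrow> real) \<Rightarrow> bool" where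
  const: "poly_deg d (\<lambda>h. c)"
| var: "poly_deg d p \<Longrightarrow> poly_deg (Suc d) (\<lambda>h. h $ i * p h)"
| add: "poly_deg d p \<Longrightarrow> poly_deg d q \<Longrightarrow> poly_deg d (\<lambda>h. p h + q h)"

lemma poly_deg_Suc: "poly_deg d p \<Longrightarrow> poly_deg (Suc d) p"
  by (induction rule: poly_deg.induct) (auto intro: poly_deg.intros)

lemma poly_deg_pderiv: "poly_deg d p \<Longrightarrow> \<exists>p'. poly_deg d p' \<and> has_pderiv i p p'"
proof (induction rule: poly_deg.induct)
  case (const d c)
  show ?case by (intro exI[of _ "\<lambda>_. 0"] conjI has_pderiv_const poly_deg.const)
next
  case (var d p j)
  then obtain p' where p': "poly_deg d p'" "has_pderiv i p p'" by blast
  have "has_pderiv i (\<lambda>h. h $ j * p h) (\<lambda>h. (if i = j then 1 else 0) * p h + h $ j * p' h)"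
    by (intro has_pderiv_mult has_pderiv_component p')
  moreover have "poly_deg (Suc d) (\<lambda>h. (if i = j then 1 else 0) * p h + h $ j * p' h)" (is "poly_deg _ ?q")
  proof (rule poly_deg.add)
    show "poly_deg (Suc d) (\<lambda>h. (if i = j then 1 else 0) * p h)"
      using var by (cases "i = j") (auto intro: poly_deg_Suc poly_deg.const)
  qed (rule poly_deg.var[OF p'(1)])
  ultimately show ?case by (intro exI[of _ ?q] conjI)
next
  case (add d p q)
  then obtain p' q' where "poly_deg d p'" "has_pderiv i p p'" "poly_deg d q'" "has_pderiv i q q'" by blast
  then show ?case by (intro exI[of _ "\<lambda>h. p' h + q' h"] conjI has_pderiv_add poly_deg.add)
qed

lemma poly_deg_continuous: "poly_deg d p \<Longrightarrow> continuous_on UNIV p"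
  by (induction rule: poly_deg.induct) (auto intro!: continuous_intros)

lemma poly_deg_bound: "poly_deg d p \<Longrightarrow> \<exists>C\<ge>0. \<forall>h. \<bar>p h\<bar> \<le> C * max 1 (norm h) ^ d"
proof (induction rule: poly_deg.induct)
  case (const d c)
  have "\<bar>c\<bar> * 1 \<le> \<bar>c\<bar> * max 1 (norm h) ^ d" for h :: "real^'a"
    by (intro mult_left_mono) auto
  then show ?case by (intro exI[of _ "\<bar>c\<bar>"]) auto
next
  case (var d p i)
  then obtain C where C: "C \<ge> 0" "\<And>h. \<bar>p h\<bar> \<le> C * max 1 (norm h) ^ d" by blast
  have "\<bar>h $ i * p h\<bar> \<le> C * max 1 (norm h) ^ Suc d" for h
  proof -
    have "\<bar>h $ i\<bar> * \<bar>p h\<bar> \<le> max 1 (norm h) * (C * max 1 (norm h) ^ d)"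
      using component_le_norm_cart[of h i] by (intro mult_mono C) auto
    then show ?thesis by (simp add: abs_mult mult_ac)
  qed
  then show ?case using C(1) by blast
next
  case (add d p q)
  then obtain C where C: "C \<ge> 0" "\<And>h. \<bar>p h\<bar> \<le> C * max 1 (norm h) ^ d" by blast
  from add obtain D where D: "D \<ge> 0" "\<And>h. \<bar>q h\<bar> \<le> D * max 1 (norm h) ^ d" by blast
  have "\<bar>p h + q h\<bar> \<le> (C + D) * max 1 (norm h) ^ d" for h
    unfolding distrib_right by (rule order_trans[OF abs_triangle_ineq add_mono[OF C(2) D(2)]])
  moreover have "0 \<le> C + D" using C D by simp
  ultimately show ?case by blast
qed

text \<open>The shape of the derivatives, up to order j, of the function that sends h to
  \<open>cut_powr \<beta> N 0 ((norm h)\<^sup>2)\<close>: each derivative that hits the radial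
  factor raises its order by one and multiplies by a coordinate. Using the squared norm keeps
  everything differentiable at the origin.\<close>

inductive far_kernel :: "real \<Rightarrow> nat \<Rightarrow> nat \<Rightarrow> (real^'n::finite \<Rightarrow> real) \<Rightarrow> bool" for \<beta> N where
  single: "poly_deg l p \<Longrightarrow> l \<le> j \<Longrightarrow> far_kernel \<beta> N j (\<lambda>h. p h * cut_powr \<beta> N l ((norm h)\<^sup>2))"
| add: "far_kernel \<beta> N j F \<Longrightarrow> far_kernel \<beta> N j G \<Longrightarrow> far_kernel \<beta> N j (\<lambda>h. F h + G h)"

lemma far_kernel_pderiv:
  "far_kernel \<beta> N j F \<Longrightarrow> j < N \<Longrightarrow> \<exists>F'. far_kernel \<beta> N (Suc j) F' \<and> has_pderiv i F F'"
proof (induction rule: far_kernel.induct)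
  case (single l p j)
  obtain p' where p': "poly_deg l p'" "has_pderiv i p p'"
    using poly_deg_pderiv[OF single(1)] by blast
  have "l < N" using single by simp
  then have "has_pderiv i (\<lambda>h. p h * cut_powr \<beta> N l ((norm h)\<^sup>2)) (\<lambda>h. p' h * cut_powr \<beta> N l ((norm h)\<^sup>2) +
      p h * (2 * h $ i * cut_powr \<beta> N (Suc l) ((norm h)\<^sup>2)))"
    by (intro has_pderiv_mult p' has_pderiv_radial DERIV_cut_powr)
  moreover have "far_kernel \<beta> N (Suc j) (\<lambda>h. p' h * cut_powr \<beta> N l ((norm h)\<^sup>2) +
      (h $ i * (p h + p h)) * cut_powr \<beta> N (Suc l) ((norm h)\<^sup>2))"
    using single p' by (intro far_kernel.intros poly_deg.intros) auto
  moreover have "p' h * cut_powr \<beta> N l ((norm h)\<^sup>2) + p h * (2 * h $ i * cut_powr \<beta> N (Suc l) ((norm h)\<^sup>2)) =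
      p' h * cut_powr \<beta> N l ((norm h)\<^sup>2) + (h $ i * (p h + p h)) * cut_powr \<beta> N (Suc l) ((norm h)\<^sup>2)" for h
    by simp
  ultimately show ?case by (intro exI conjI) simp_all
next
  case (add j F G)
  then obtain F' G' where "far_kernel \<beta> N (Suc j) F'" "has_pderiv i F F'"
    "far_kernel \<beta> N (Suc j) G'" "has_pderiv i G G'" by blast
  then show ?case by (intro exI[of _ "\<lambda>h. F' h + G' h"] conjI has_pderiv_add far_kernel.add)
qed

lemma far_kernel_continuous: "far_kernel \<beta> N j F \<Longrightarrow> j < N \<Longrightarrow> continuous_on UNIV F"
proof (induction rule: far_kernel.induct)
  case (single l p j)
  then show ?case
    by (intro continuous_on_mult poly_deg_continuous continuous_on_compose_UNIV[OF cut_powr_continuous]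
        continuous_intros) auto
qed (intro continuous_intros, auto)

text \<open>Outside the unit ball a polynomial of degree l meets a radial factor of size
  |h|^(-2\<beta> - 2l), so the product is O(|h|^(-2\<beta> - l)): differentiation never spoils the
  decay of the kernel. Inside the ball both factors are bounded and the weight is at least
  1/2.\<close>

lemma far_kernel_bound:
  "far_kernel \<beta> N j F \<Longrightarrow> j < N \<Longrightarrow> \<beta> > 0 \<Longrightarrow> \<exists>C. \<forall>h. \<bar>F h\<bar> \<le> C * weight (2 * \<beta>) h"
proof (induction rule: far_kernel.induct)
  case (single l p j)
  obtain c where c: "c \<ge> 0" "\<And>h. \<bar>p h\<bar> \<le> c * max 1 (norm h) ^ l"
    using poly_deg_bound[OF single(1)] by blast
  have "l < N" using single(2,3) by simp
  obtain B where B: "B \<ge> 0" "\<And>t. norm t \<le> 1 \<Longrightarrow> \<bar>cut_powr \<beta> N l t\<bar> \<le> B"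
    using continuous_bounded_cball[OF cut_powr_continuous[OF \<open>l < N\<close>, where \<beta> = \<beta>], where R = 1]
    by metis
  define A where "A = \<bar>powr_coeff \<beta> l\<bar>"
  have "\<bar>p h * cut_powr \<beta> N l ((norm h)\<^sup>2)\<bar> \<le> (2 * c * (A + B)) * weight (2 * \<beta>) h" for h
  proof (cases "norm h \<ge> 1")
    case True
    have "\<bar>p h * cut_powr \<beta> N l ((norm h)\<^sup>2)\<bar> \<le> (c * norm h ^ l) * (A * ((norm h)\<^sup>2) powr (- \<beta> - real l))"
      using c(2)[of h] True one_le_power[OF True, of 2] unfolding abs_mult
      by (intro mult_mono) (auto simp: cut_powr_def A_def abs_mult max_def split: if_splits)
    also have "((norm h)\<^sup>2) powr (- \<beta> - real l) = norm h powr (- 2 * \<beta> - 2 * real l)"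
    proof -
      have "(norm h)\<^sup>2 = norm h powr 2" using True by simp
      then show ?thesis by (simp add: powr_powr algebra_simps del: powr_numeral)
    qed
    also have "(c * norm h ^ l) * (A * norm h powr (- 2 * \<beta> - 2 * real l)) =
        (c * A) * (norm h powr real l * norm h powr (- 2 * \<beta> - 2 * real l))"
    proof -
      have "norm h powr real l = norm h ^ l" using True by (intro powr_realpow) linarith
      then show ?thesis by (simp add: mult_ac)
    qed
    also have "norm h powr real l * norm h powr (- 2 * \<beta> - 2 * real l) = norm h powr (- 2 * \<beta> - real l)"
    proof -
      have "real l + (- 2 * \<beta> - 2 * real l) = - 2 * \<beta> - real l" by simp
      then show ?thesis by (metis powr_add)
    qed
    also have "(c * A) * norm h powr (- 2 * \<beta> - real l) \<le> (c * (A + B)) * (2 * weight (2 * \<beta>) h)"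
    proof (rule mult_mono)
      have "norm h powr (- 2 * \<beta> - real l) \<le> norm h powr (- (2 * \<beta>))"
        using True by (intro powr_mono) auto
      then show "norm h powr (- 2 * \<beta> - real l) \<le> 2 * weight (2 * \<beta>) h"
        using powr_le_weight[OF True, of "2 * \<beta>"] single by simp
      show "c * A \<le> c * (A + B)" "0 \<le> c * (A + B)"
        using c B by (auto intro!: mult_left_mono simp: A_def)
    qed auto
    finally show ?thesis by (simp only: mult_ac)
  next
    case False
    then have "(norm h)\<^sup>2 \<le> 1" by (simp add: power_le_one)
    then have "\<bar>p h * cut_powr \<beta> N l ((norm h)\<^sup>2)\<bar> \<le> c * B"
      using c(2)[of h] False B c(1) unfolding abs_mult by (intro mult_mono) (auto simp: max_def split: if_splits)
    also have "\<dots> \<le> (c * (A + B)) * (2 * weight (2 * \<beta>) h)"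
      using mult_mono[of "c * B" "c * (A + B)" 1 "2 * weight (2 * \<beta>) h"] weight_ge[of h "2 * \<beta>"]
        False single c B by (simp add: A_def mult_left_mono)
    finally show ?thesis by (simp only: mult_ac)
  qed
  then show ?case by blast
next
  case (add j F G)
  then obtain C where C: "\<And>h. \<bar>F h\<bar> \<le> C * weight (2 * \<beta>) h" by blast
  from add obtain D where D: "\<And>h. \<bar>G h\<bar> \<le> D * weight (2 * \<beta>) h" by blast
  have "\<bar>F h + G h\<bar> \<le> (C + D) * weight (2 * \<beta>) h" for h
    unfolding distrib_right by (rule order_trans[OF abs_triangle_ineq add_mono[OF C D]])
  then show ?case by blast
qed

lemma far_convolution_bound:
  fixes u :: "'a::euclidean_space \<Rightarrow> real"
  assumes u: "integrable lborel (\<lambda>y. \<bar>u y\<bar> * weight s y)" and s: "s > 0"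
    and F: "\<And>h. \<bar>F h\<bar> \<le> C * weight s h"
  shows "\<exists>B. integrable lborel B \<and> (\<forall>x y. norm x \<le> R \<longrightarrow> \<bar>u y * F (x - y)\<bar> \<le> B y)"
proof -
  obtain D where D: "\<And>x y::'a. norm x \<le> \<bar>R\<bar> \<Longrightarrow> weight s (y - x) \<le> D * weight s y"
    using weight_translate[OF s, of "\<bar>R\<bar>"] by auto
  have C: "C \<ge> 0" using order_trans[OF abs_ge_zero F[of 0]] weight_pos[of s "0::'a"]
    by (simp add: zero_le_mult_iff)
  have "\<bar>u y * F (x - y)\<bar> \<le> (C * D) * (\<bar>u y\<bar> * weight s y)" if "norm x \<le> R" for x y
  proof -
    have "weight s (x - y) = weight s (y - x)" using weight_minus[of s "x - y"] by simp
    then have "\<bar>F (x - y)\<bar> \<le> C * weight s (y - x)" using F[of "x - y"] by simp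
    also have "\<dots> \<le> C * (D * weight s y)" using that C by (intro mult_left_mono D) auto
    finally have "\<bar>F (x - y)\<bar> \<le> C * (D * weight s y)" .
    then have "\<bar>u y\<bar> * \<bar>F (x - y)\<bar> \<le> \<bar>u y\<bar> * (C * (D * weight s y))" by (intro mult_left_mono) auto
    then show ?thesis by (simp add: abs_mult mult_ac)
  qed
  then show ?thesis
    using integrable_mult_right[OF u, of "C * D"] by blast
qed

text \<open>All derivatives fall on the kernel. In the induction j counts the derivatives already
  taken and k those still to come, so \<open>j + k\<close> is preserved and N bounds it once and for
  all.\<close>

lemma C_class_far_convolution:
  fixes u :: "real^'n::finite \<Rightarrow> real"
  assumes u: "integrable lborel (\<lambda>y. \<bar>u y\<bar> * weight (2 * \<beta>) y)" and \<beta>: "\<beta> > 0"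
    and um: "u \<in> borel_measurable borel"
  shows "far_kernel \<beta> N j F \<Longrightarrow> j + k < N \<Longrightarrow> C_class k (\<lambda>x. LINT y|lborel. u y * F (x - y))"
proof (induction k arbitrary: j F)
  have meas: "(\<lambda>y. u y * F (x - y)) \<in> borel_measurable lborel"
    if "far_kernel \<beta> N j F" "j < N" for j F and x :: "real^'n"
  proof -
    have [measurable]: "F \<in> borel_measurable borel"
      using far_kernel_continuous[OF that] by (rule borel_measurable_continuous_onI)
    show ?thesis using um by measurable
  qed
  have bd: "\<exists>B. integrable lborel B \<and> (\<forall>x y. norm x \<le> R \<longrightarrow> \<bar>u y * F (x - y)\<bar> \<le> B y)"
    if F: "far_kernel \<beta> N j F" "j < N" for j F R
  proof -
    obtain C where "\<And>h. \<bar>F h\<bar> \<le> C * weight (2 * \<beta>) h" using far_kernel_bound[OF F \<beta>] by blast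
    then show ?thesis using \<beta> by (intro far_convolution_bound[OF u]) auto
  qed
  have cont: "continuous_on UNIV (\<lambda>x. LINT y|lborel. u y * F (x - y))"
    if F: "far_kernel \<beta> N j F" "j < N" for j F
  proof (rule continuous_on_integral_dominated)
    show "continuous_on UNIV (\<lambda>x. u y * F (x - y))" for y
      by (intro continuous_on_mult_left continuous_on_compose_UNIV[OF far_kernel_continuous[OF F]]
          continuous_intros)
  qed (rule meas[OF F], rule bd[OF F])
  {
    case 0
    then show ?case using cont by (simp add: C_class_0)
  next
    case (Suc k)
    have jN: "j < N" "Suc j < N" using Suc.prems by auto
    have "\<exists>v'. has_pderiv i (\<lambda>x. LINT y|lborel. u y * F (x - y)) v' \<and> C_class k v'" for i
    proof -
      obtain F' where F': "far_kernel \<beta> N (Suc j) F'" "has_pderiv i F F'"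
        using far_kernel_pderiv[OF Suc.prems(1) jN(1)] by blast
      have "has_pderiv i (\<lambda>x. LINT y|lborel. u y * F (x - y)) (\<lambda>x. LINT y|lborel. u y * F' (x - y))"
      proof (rule has_pderiv_integral)
        show "integrable lborel (\<lambda>y. u y * F (x - y))" for x
        proof -
          obtain B where "integrable lborel B" "\<And>y. \<bar>u y * F (x - y)\<bar> \<le> B y"
            using bd[OF Suc.prems(1) jN(1), of "norm x"] by blast
          then show ?thesis
            by (rule integrable_abs_bound[OF _ meas[OF Suc.prems(1) jN(1)]])
        qed
        show "has_pderiv i (\<lambda>x. u y * F (x - y)) (\<lambda>x. u y * F' (x - y))" for y
          unfolding diff_conv_add_uminus by (intro has_pderiv_cmult has_pderiv_translate F')
      qed (rule bd[OF F'(1) jN(2)], rule meas[OF F'(1) jN(2)])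
      moreover have "C_class k (\<lambda>x. LINT y|lborel. u y * F' (x - y))"
        using Suc.prems by (intro Suc.IH[OF F'(1)]) simp
      ultimately show ?thesis by blast
    qed
    then show ?case unfolding C_class_Suc using cont[OF Suc.prems(1) jN(1)] by blast
  }
qed

section \<open>The fractional Laplacian as an absolutely convergent integral\<close>

text \<open>For s = n + \<alpha> this is the fractional Laplacian up to the factor
  \<open>frac_laplace_const\<close> / 2, the half coming from the symmetrization in h.\<close>

definition frac_integral :: "real \<Rightarrow> ('a::euclidean_space \<Rightarrow> real) \<Rightarrow> 'a \<Rightarrow> real" where
  "frac_integral s u x = (LINT h|lborel. second_diff u x h * norm h powr (- s))"

lemma second_diff_weight:
  fixes u :: "'a::euclidean_space \<Rightarrow> real"
  assumes c: "continuous_on UNIV u" and u: "integrable lborel (\<lambda>y. \<bar>u y\<bar> * weight s y)"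
    and s: "s > DIM('a)"
  shows "integrable lborel (\<lambda>h. \<bar>second_diff u x h\<bar> * weight s h)"
    and "\<exists>B. \<forall>x. norm x \<le> R \<longrightarrow> (LINT h|lborel. \<bar>second_diff u x h\<bar> * weight s h) \<le> B"
proof -
  have s0: "s > 0" using s by simp
  have [measurable]: "u \<in> borel_measurable borel" using c by (rule borel_measurable_continuous_onI)
  have wi: "integrable lborel (weight s :: 'a \<Rightarrow> real)" using s by (rule weight_integrable)
  have main: "\<exists>D. \<forall>x. norm x \<le> \<bar>R\<bar> \<longrightarrow> integrable lborel (\<lambda>h. \<bar>second_diff u x h\<bar> * weight s h) \<and>
      (LINT h|lborel. \<bar>second_diff u x h\<bar> * weight s h) \<le>
        2 * \<bar>u x\<bar> * (LINT h|lborel. weight s (h::'a)) + D" for R :: real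
  proof -
    obtain D where D: "\<And>x y::'a. norm x \<le> \<bar>R\<bar> \<Longrightarrow> weight s (y - x) \<le> D * weight s y"
      using weight_translate[OF s0, of "\<bar>R\<bar>"] by auto
    define I where "I = (LINT y|lborel. D * (\<bar>u y\<bar> * weight s y))"
    \<comment> \<open>The scalar c is 1 or -1, so that u (x + h) and u (x - h) are treated at
      once.\<close>
    have shift: "integrable lborel (\<lambda>h. \<bar>u (x + c *\<^sub>R h)\<bar> * weight s h)"
        "(LINT h|lborel. \<bar>u (x + c *\<^sub>R h)\<bar> * weight s h) \<le> I"
      if x: "norm x \<le> \<bar>R\<bar>" and c: "\<bar>c\<bar> = 1" for x c
    proof -
      have eq: "\<bar>u (x + c *\<^sub>R h)\<bar> * weight s h = \<bar>u (x + c *\<^sub>R h)\<bar> * weight s ((x + c *\<^sub>R h) - x)" for h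
        using c by (simp add: weight_def)
      have le: "\<bar>u y\<bar> * weight s (y - x) \<le> D * (\<bar>u y\<bar> * weight s y)" for y
        using mult_left_mono[OF D[OF x, of y], of "\<bar>u y\<bar>"] by (simp add: mult_ac)
      have i: "integrable lborel (\<lambda>y. \<bar>u y\<bar> * weight s (y - x))"
      proof (rule integrable_abs_bound[OF integrable_mult_right[OF u, of D]])
        show "\<bar>\<bar>u y\<bar> * weight s (y - x)\<bar> \<le> D * (\<bar>u y\<bar> * weight s y)" for y
          using le[of y] weight_pos[of s "y - x"] by (simp add: abs_mult)
      qed measurable
      show "integrable lborel (\<lambda>h. \<bar>u (x + c *\<^sub>R h)\<bar> * weight s h)"
        unfolding eq using integrable_isometry[OF c i, of x] .
      have "(LINT h|lborel. \<bar>u (x + c *\<^sub>R h)\<bar> * weight s h) = (LINT y|lborel. \<bar>u y\<bar> * weight s (y - x))"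
        unfolding eq by (rule integral_isometry[OF c, where f = "\<lambda>y. \<bar>u y\<bar> * weight s (y - x)"]) measurable
      also have "\<dots> \<le> I" unfolding I_def
        by (intro integral_mono i integrable_mult_right[OF u] le)
      finally show "(LINT h|lborel. \<bar>u (x + c *\<^sub>R h)\<bar> * weight s h) \<le> I" .
    qed
    have "integrable lborel (\<lambda>h. \<bar>second_diff u x h\<bar> * weight s h) \<and>
      (LINT h|lborel. \<bar>second_diff u x h\<bar> * weight s h) \<le> 2 * \<bar>u x\<bar> * (LINT h|lborel. weight s (h::'a)) + 2 * I"
      if x: "norm x \<le> \<bar>R\<bar>" for x
    proof -
      have p: "integrable lborel (\<lambda>h. \<bar>u (x + h)\<bar> * weight s h)" "(LINT h|lborel. \<bar>u (x + h)\<bar> * weight s h) \<le> I"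
        and m: "integrable lborel (\<lambda>h. \<bar>u (x - h)\<bar> * weight s h)" "(LINT h|lborel. \<bar>u (x - h)\<bar> * weight s h) \<le> I"
        using shift[OF x, of 1] shift[OF x, of "- 1"] by simp_all
      define G where "G h = 2 * \<bar>u x\<bar> * weight s h + \<bar>u (x + h)\<bar> * weight s h + \<bar>u (x - h)\<bar> * weight s h" for h
      have G: "integrable lborel G" unfolding G_def using p m wi by simp
      have le: "\<bar>second_diff u x h\<bar> * weight s h \<le> G h" for h
        unfolding G_def distrib_right[symmetric] using weight_pos[of s h]
        by (intro mult_right_mono) (auto simp: second_diff_def)
      have int: "integrable lborel (\<lambda>h. \<bar>second_diff u x h\<bar> * weight s h)"
      proof (rule integrable_abs_bound[OF G])
        show "\<bar>\<bar>second_diff u x h\<bar> * weight s h\<bar> \<le> G h" for h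
          using le[of h] weight_pos[of s h] by (simp add: abs_mult)
      qed (use second_diff_measurable[OF c, of x] in simp)
      have "(LINT h|lborel. \<bar>second_diff u x h\<bar> * weight s h) \<le> (LINT h|lborel. G h)"
        by (intro integral_mono int G le)
      also have "\<dots> \<le> 2 * \<bar>u x\<bar> * (LINT h|lborel. weight s (h::'a)) + 2 * I"
        unfolding G_def using p m wi by simp
      finally show ?thesis using int by simp
    qed
    then show ?thesis by blast
  qed
  show "integrable lborel (\<lambda>h. \<bar>second_diff u x h\<bar> * weight s h)"
    using main[of "norm x"] by auto
  obtain b where b: "b \<ge> 0" "\<And>x. norm x \<le> R \<Longrightarrow> \<bar>u x\<bar> \<le> b"
    using continuous_bounded_cball[OF c, of R] by metis
  obtain D where D: "\<And>x. norm x \<le> \<bar>R\<bar> \<Longrightarrow> (LINT h|lborel. \<bar>second_diff u x h\<bar> * weight s h) \<le>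
        2 * \<bar>u x\<bar> * (LINT h|lborel. weight s (h::'a)) + D" using main[of R] by blast
  have "(LINT h|lborel. \<bar>second_diff u x h\<bar> * weight s h) \<le> 2 * b * (LINT h|lborel. weight s (h::'a)) + D"
    if x: "norm x \<le> R" for x
  proof -
    have "0 \<le> (LINT h|lborel. weight s (h::'a))"
      by (intro integral_nonneg_AE) (simp add: less_imp_le[OF weight_pos])
    then have "2 * \<bar>u x\<bar> * (LINT h|lborel. weight s (h::'a)) \<le> 2 * b * (LINT h|lborel. weight s (h::'a))"
      using b(2)[OF x] by (intro mult_right_mono) auto
    then show ?thesis using D[OF order_trans[OF x abs_ge_self]] by linarith
  qed
  then show "\<exists>B. \<forall>x. norm x \<le> R \<longrightarrow> (LINT h|lborel. \<bar>second_diff u x h\<bar> * weight s h) \<le> B" by blast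
qed

text \<open>Near the origin the modulus of order \<sigma> tames the kernel, and away from it the
  kernel is at most twice the weight. The bound that is uniform for x in a ball is what later
  justifies Fubini against a compactly supported test function.\<close>

lemma second_diff_kernel:
  fixes u :: "'a::euclidean_space \<Rightarrow> real"
  assumes c: "continuous_on UNIV u" and u: "integrable lborel (\<lambda>y. \<bar>u y\<bar> * weight s y)"
    and sd: "sd_bounded \<sigma> u" and s: "s > DIM('a)" "s < \<sigma> + DIM('a)"
  shows "integrable lborel (\<lambda>h. second_diff u x h * norm h powr (- s))"
    and "\<exists>B. \<forall>x. norm x \<le> R \<longrightarrow> (LINT h|lborel. \<bar>second_diff u x h * norm h powr (- s)\<bar>) \<le> B"
proof -
  define K where "K h = indicator (cball 0 1) h * norm h powr (- s)" for h :: 'a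
  have s0: "s > 0" using s by simp
  have K: "\<bar>K h\<bar> \<le> 1 * norm h powr (- s)" for h unfolding K_def by (auto simp: indicator_def)
  have K0: "K h = 0" if "norm h > 1" for h using that by (simp add: K_def)
  have meas: "(\<lambda>h. second_diff u x h * norm h powr (- s)) \<in> borel_measurable lborel" for x
    using second_diff_measurable[OF c, of x] by simp
  have main: "\<exists>B. integrable lborel B \<and> (\<forall>x. norm x \<le> R \<longrightarrow> (\<forall>h. \<bar>second_diff u x h * norm h powr (- s)\<bar> \<le>
      B h + 2 * (\<bar>second_diff u x h\<bar> * weight s h)))" for R
  proof -
    obtain B where B: "integrable lborel B" "\<And>x h. norm x \<le> R \<Longrightarrow> \<bar>second_diff u x h * K h\<bar> \<le> B h"
      using singular_bound[OF sd K K0 s(2)] by blast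
    have "\<bar>second_diff u x h * norm h powr (- s)\<bar> \<le> B h + 2 * (\<bar>second_diff u x h\<bar> * weight s h)"
      if x: "norm x \<le> R" for x h
    proof (cases "norm h \<le> 1")
      case True
      then have "\<bar>second_diff u x h * norm h powr (- s)\<bar> \<le> B h" using B(2)[OF x, of h] by (simp add: K_def)
      moreover have "0 \<le> \<bar>second_diff u x h\<bar> * weight s h" using weight_pos[of s h] by simp
      ultimately show ?thesis by linarith
    next
      case False
      then have "\<bar>second_diff u x h\<bar> * norm h powr (- s) \<le> \<bar>second_diff u x h\<bar> * (2 * weight s h)"
        using s0 by (intro mult_left_mono powr_le_weight) auto
      moreover have "0 \<le> B h" using B(2)[OF x, of h] by linarith
      ultimately show ?thesis by (simp add: abs_mult)
    qed
    then show ?thesis using B(1) by blast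
  qed
  have int: "integrable lborel (\<lambda>h. second_diff u x h * norm h powr (- s))" for x
  proof -
    obtain B where B: "integrable lborel B" "\<And>h. \<bar>second_diff u x h * norm h powr (- s)\<bar> \<le>
      B h + 2 * (\<bar>second_diff u x h\<bar> * weight s h)" using main[of "norm x"] by blast
    then show ?thesis
      by (intro integrable_abs_bound[OF _ meas B(2)] Bochner_Integration.integrable_add integrable_mult_right
          second_diff_weight(1)[OF c u s(1)])
  qed
  then show "integrable lborel (\<lambda>h. second_diff u x h * norm h powr (- s))" .
  obtain B where B: "integrable lborel B" "\<And>x h. norm x \<le> R \<Longrightarrow> \<bar>second_diff u x h * norm h powr (- s)\<bar> \<le>
      B h + 2 * (\<bar>second_diff u x h\<bar> * weight s h)" using main[of R] by blast
  obtain D where D: "\<And>x. norm x \<le> R \<Longrightarrow> (LINT h|lborel. \<bar>second_diff u x h\<bar> * weight s h) \<le> D"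
    using second_diff_weight(2)[OF c u s(1), of R] by blast
  have "(LINT h|lborel. \<bar>second_diff u x h * norm h powr (- s)\<bar>) \<le> (LINT h|lborel. B h) + 2 * D"
    if x: "norm x \<le> R" for x
  proof -
    have "(LINT h|lborel. \<bar>second_diff u x h * norm h powr (- s)\<bar>) \<le>
        (LINT h|lborel. B h + 2 * (\<bar>second_diff u x h\<bar> * weight s h))"
      by (intro integral_mono integrable_abs int Bochner_Integration.integrable_add integrable_mult_right
          second_diff_weight(1)[OF c u s(1)] B x)
    also have "\<dots> \<le> (LINT h|lborel. B h) + 2 * D"
      using D[OF x] B(1) second_diff_weight(1)[OF c u s(1), of x] by simp
    finally show ?thesis .
  qed
  then show "\<exists>B. \<forall>x. norm x \<le> R \<longrightarrow> (LINT h|lborel. \<bar>second_diff u x h * norm h powr (- s)\<bar>) \<le> B" by blast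
qed

text \<open>Averaging the two substitutions \<open>y = x + h\<close> and \<open>y = x - h\<close> replaces the principal value by
  an absolutely convergent integral of second differences.\<close>

lemma truncated_integral_eq:
  fixes u :: "'a::euclidean_space \<Rightarrow> real"
  assumes c: "continuous_on UNIV u" and u: "integrable lborel (\<lambda>y. \<bar>u y\<bar> * weight s y)"
    and s: "s > DIM('a)" and e: "e > 0"
  shows "(LINT y:{y. e \<le> dist y x}|lebesgue. (u x - u y) / dist y x powr s) =
    (1 / 2) * (LINT h|lborel. indicator {h. e \<le> norm h} h * (second_diff u x h * norm h powr (- s)))"
proof -
  have s0: "s > 0" using s by simp
  have [measurable]: "u \<in> borel_measurable borel" using c by (rule borel_measurable_continuous_onI)
  define G where "G y = indicator {h. e \<le> norm h} (y - x) * ((u x - u y) * norm (y - x) powr (- s))" for y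
  have Gm [measurable]: "G \<in> borel_measurable borel" unfolding G_def by measurable
  have Gi: "integrable lborel G"
  proof -
    obtain D where D: "\<And>x' y::'a. norm x' \<le> norm x \<Longrightarrow> weight s (y - x') \<le> D * weight s y"
      using weight_translate[OF s0, of "norm x"] by auto
    \<comment> \<open>Outside radius e the quotient of the kernel and the weight is 1 + |h|^-s,
      hence at most this constant.\<close>
    define C where "C = 1 + e powr (- s)"
    have C: "C \<ge> 0" unfolding C_def by (simp add: add_nonneg_nonneg)
    have k: "indicator {h. e \<le> norm h} h * norm h powr (- s) \<le> C * weight s h" for h :: 'a
    proof (cases "e \<le> norm h")
      case True
      then have h: "0 < norm h powr s" using e by auto
      have "norm h powr (- s) \<le> e powr (- s)" using True e s0 by (intro powr_mono2') auto
      then have "1 / norm h powr s \<le> e powr (- s)" by (simp add: powr_minus_divide)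
      then have "(1 + norm h powr s) / norm h powr s \<le> C"
        using h by (simp add: C_def add_divide_distrib)
      then show ?thesis using True h by (simp add: weight_def powr_minus_divide field_simps add_pos_pos)
    next
      case False
      then show ?thesis using C weight_pos[of s h] by simp
    qed
    have "integrable lborel (\<lambda>y. (C * D) * (\<bar>u x\<bar> * weight s y + \<bar>u y\<bar> * weight s y))"
      using u weight_integrable[OF s] by (intro integrable_mult_right Bochner_Integration.integrable_add)
    then show ?thesis
    proof (rule integrable_abs_bound)
      fix y
      have "\<bar>G y\<bar> = \<bar>u x - u y\<bar> * (indicator {h. e \<le> norm h} (y - x) * norm (y - x) powr (- s))"
        unfolding G_def by (simp add: abs_mult)
      also have "\<dots> \<le> (\<bar>u x\<bar> + \<bar>u y\<bar>) * (C * (D * weight s y))"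
      proof (rule mult_mono)
        show "indicator {h. e \<le> norm h} (y - x) * norm (y - x) powr (- s) \<le> C * (D * weight s y)"
          by (rule order_trans[OF k mult_left_mono[OF D C]]) simp
      qed (auto simp: abs_triangle_ineq4)
      finally show "\<bar>G y\<bar> \<le> (C * D) * (\<bar>u x\<bar> * weight s y + \<bar>u y\<bar> * weight s y)"
        by (simp add: algebra_simps)
    qed measurable
  qed
  have "(LINT y:{y. e \<le> dist y x}|lebesgue. (u x - u y) / dist y x powr s) = (LINT y|lebesgue. G y)"
    unfolding set_lebesgue_integral_def G_def
    by (intro Bochner_Integration.integral_cong) (auto simp: dist_norm powr_minus_divide indicator_def)
  also have "\<dots> = (LINT y|lborel. G y)" by (rule integral_completion) measurable
  finally have 1: "(LINT y:{y. e \<le> dist y x}|lebesgue. (u x - u y) / dist y x powr s) = (LINT y|lborel. G y)" .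
  have shift: "(LINT y|lborel. G y) = (LINT h|lborel. G (x + c *\<^sub>R h))" "integrable lborel (\<lambda>h. G (x + c *\<^sub>R h))"
    if "\<bar>c\<bar> = 1" for c
    using integral_isometry[OF that Gm, of x] integrable_isometry[OF that Gi, of x] by auto
  have "2 * (LINT y|lborel. G y) = (LINT h|lborel. G (x + 1 *\<^sub>R h)) + (LINT h|lborel. G (x + (- 1) *\<^sub>R h))"
    using shift(1)[of 1] shift(1)[of "- 1"] by simp
  also have "\<dots> = (LINT h|lborel. G (x + 1 *\<^sub>R h) + G (x + (- 1) *\<^sub>R h))"
    by (intro Bochner_Integration.integral_add[symmetric] shift(2)) auto
  also have "\<dots> = (LINT h|lborel. indicator {h. e \<le> norm h} h * (second_diff u x h * norm h powr (- s)))"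
    by (intro Bochner_Integration.integral_cong) (auto simp: G_def second_diff_def indicator_def algebra_simps)
  finally show ?thesis using 1 by simp
qed

lemma frac_laplace_eq:
  fixes u :: "real^'n::finite \<Rightarrow> real"
  assumes c: "continuous_on UNIV u" and u: "integrable lborel (\<lambda>y. \<bar>u y\<bar> * weight (real CARD('n) + \<alpha>) y)"
    and sd: "sd_bounded \<sigma> u" and \<alpha>: "0 < \<alpha>" "\<alpha> < \<sigma>"
  shows "frac_laplace \<alpha> u x =
    (frac_laplace_const CARD('n) \<alpha> / 2) * frac_integral (real CARD('n) + \<alpha>) u x"
proof -
  define s where "s = real CARD('n) + \<alpha>"
  have s: "s > DIM(real^'n)" "s < \<sigma> + DIM(real^'n)" using \<alpha> by (simp_all add: s_def)
  have u': "integrable lborel (\<lambda>y. \<bar>u y\<bar> * weight s y)" using u by (simp add: s_def)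
  define T where "T e h = indicator {h. e \<le> norm h} h * (second_diff u x h * norm h powr (- s))"
    for e :: real and h :: "real^'n"
  define F where "F h = second_diff u x h * norm h powr (- s)" for h
  have Fi: "integrable lborel F" unfolding F_def by (rule second_diff_kernel(1)[OF c u' sd s])
  have Fm [measurable]: "F \<in> borel_measurable borel" using Fi borel_measurable_integrable by auto
  have "((\<lambda>e. LINT h|lborel. T e h) \<longlongrightarrow> (LINT h|lborel. F h)) (at_right 0)"
    unfolding tendsto_at_iff_sequentially o_def
  proof (intro allI impI)
    fix X :: "nat \<Rightarrow> real" assume X0: "\<forall>i. X i \<in> {0<..} - {0}" and X: "X \<longlonglongrightarrow> 0"
    show "(\<lambda>i. LINT h|lborel. T (X i) h) \<longlonglongrightarrow> (LINT h|lborel. F h)"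
    proof (rule integral_dominated_convergence[where w = "\<lambda>h. \<bar>F h\<bar>"])
      show "T (X i) \<in> borel_measurable lborel" for i
        unfolding T_def F_def[symmetric] by measurable
      have "(\<lambda>i. T (X i) h) \<longlonglongrightarrow> F h" for h
      \<comment> \<open>At the origin the indicator never becomes 1, but there the second difference
        is 0 anyway.\<close>
      proof (cases "h = 0")
        case True
        then show ?thesis by (simp add: T_def F_def second_diff_def)
      next
        case False
        then have "\<forall>\<^sub>F i in sequentially. X i < norm h"
          using X by (intro order_tendstoD(2)) auto
        then have "\<forall>\<^sub>F i in sequentially. F h = T (X i) h"
          by eventually_elim (simp add: T_def F_def)
        then show ?thesis by (intro Lim_transform_eventually[OF tendsto_const])
      qed
      then show "AE h in lborel. (\<lambda>i. T (X i) h) \<longlonglongrightarrow> F h" by simp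
      show "AE h in lborel. norm (T (X i) h) \<le> \<bar>F h\<bar>" for i
        by (auto simp: T_def F_def indicator_def)
    qed (use Fi in auto)
  qed
  then have "((\<lambda>e. (1 / 2) * (LINT h|lborel. T e h)) \<longlongrightarrow> (1 / 2) * (LINT h|lborel. F h)) (at_right 0)"
    by (rule tendsto_mult_left)
  moreover have "\<forall>\<^sub>F e in at_right 0. (1 / 2) * (LINT h|lborel. T e h) =
      (LINT y:{y. e \<le> dist y x}|lebesgue. (u x - u y) / dist x y powr s)"
    unfolding T_def by (auto simp: eventually_at_filter dist_commute truncated_integral_eq[OF c u' s(1)]
        intro!: always_eventually)
  ultimately have "((\<lambda>e. LINT y:{y. e \<le> dist y x}|lebesgue. (u x - u y) / dist x y powr s) \<longlongrightarrow>
      (1 / 2) * (LINT h|lborel. F h)) (at_right 0)"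
    by (rule Lim_transform_eventually)
  then have "Lim (at_right 0) (\<lambda>e. LINT y:{y. e \<le> dist y x}|lebesgue. (u x - u y) / dist x y powr s) =
      (1 / 2) * (LINT h|lborel. F h)"
    by (intro tendsto_Lim) auto
  then show ?thesis
    unfolding frac_laplace_def frac_integral_def F_def s_def by simp
qed

lemma C_class_frac_integral:
  fixes u :: "real^'n::finite \<Rightarrow> real"
  assumes C: "C_class j u" and sd: "\<And>is. length is \<le> j \<Longrightarrow> sd_bounded \<sigma> (partial_derivs is u)"
    and u: "integrable lborel (\<lambda>y. \<bar>u y\<bar> * weight s y)"
    and s: "s > CARD('n)" "s < \<sigma> + CARD('n)"
  shows "C_class j (frac_integral s u)"
proof -
  \<comment> \<open>Half of s, because the cut power is applied to the squared norm; the choice of N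
    leaves room for exactly j derivatives.\<close>
  define \<beta> where "\<beta> = s / 2"
  define N where "N = Suc j"
  have s0: "s > 0" using s by linarith
  have \<beta>: "\<beta> > 0" "2 * \<beta> = s" using s0 by (auto simp: \<beta>_def)
  have c: "continuous_on UNIV u" using C by (rule C_class_continuous)
  have um [measurable]: "u \<in> borel_measurable borel" using c by (rule borel_measurable_continuous_onI)
  \<comment> \<open>This far part coincides with the full kernel outside the unit ball, so the
    remainder \<open>K1\<close> is supported in the ball while keeping the singularity.\<close>
  define K2 where "K2 h = cut_powr \<beta> N 0 ((norm h)\<^sup>2)" for h :: "real^'n"
  define K1 where "K1 h = norm h powr (- s) - K2 h" for h :: "real^'n"
  have "far_kernel \<beta> N 0 (\<lambda>h. 1 * cut_powr \<beta> N 0 ((norm h)\<^sup>2) :: real)"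
    by (rule far_kernel.single[where l = 0, OF poly_deg.const]) simp
  then have far: "far_kernel \<beta> N 0 K2" by (simp add: K2_def [abs_def])
  have K2c: "continuous_on UNIV K2" using far by (rule far_kernel_continuous) (simp add: N_def)
  then have [measurable]: "K2 \<in> borel_measurable borel" by (rule borel_measurable_continuous_onI)
  have K1m [measurable]: "K1 \<in> borel_measurable borel" unfolding K1_def by measurable
  obtain A where A: "\<And>h. \<bar>K2 h\<bar> \<le> A * weight s h"
    using far_kernel_bound[OF far _ \<beta>(1)] \<beta>(2) by (auto simp: N_def)
  have K1_far: "K1 h = 0" if "norm h > 1" for h
  proof -
    have "(norm h)\<^sup>2 = norm h powr 2" using that by simp
    moreover have "1 \<le> (norm h)\<^sup>2" using that by (simp add: one_le_power)
    ultimately show ?thesis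
      using \<beta>(2) by (simp add: K1_def K2_def cut_powr_def powr_powr del: powr_numeral)
  qed
  have K1_near: "\<bar>K1 h\<bar> \<le> (1 + \<bar>A\<bar>) * norm h powr (- s)" if "h \<noteq> 0" for h
  proof (cases "norm h \<le> 1")
    case True
    have "norm h powr s \<le> 1" using True s0 powr_mono2[of s "norm h" 1] by simp
    then have one: "1 \<le> norm h powr (- s)" using that by (simp add: powr_minus_divide)
    have "\<bar>K2 h\<bar> \<le> \<bar>A\<bar> * 1"
      by (rule order_trans[OF A]) (intro mult_mono weight_le_1 less_imp_le[OF weight_pos], auto)
    also have "\<dots> \<le> \<bar>A\<bar> * norm h powr (- s)" using one by (intro mult_left_mono) auto
    finally show ?thesis unfolding K1_def distrib_right
      using abs_triangle_ineq4[of "norm h powr (- s)" "K2 h"] by simp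
  qed (simp add: K1_far)
  define D where "D x = (LINT y|lborel. u y * K2 (x - y))" for x
  have near: "C_class j (\<lambda>x. LINT h|lborel. second_diff u x h * K1 h)"
    using C sd K1_near K1_far s(2) K1m by (rule C_class_singular)
  have conv: "C_class j D" unfolding D_def
  proof (rule C_class_far_convolution[OF _ \<beta>(1) um far])
    show "integrable lborel (\<lambda>y. \<bar>u y\<bar> * weight (2 * \<beta>) y)" using u unfolding \<beta>(2) .
  qed (simp add: N_def)
  define \<kappa> where "\<kappa> = (LINT h|lborel. K2 h)"
  have K2i: "integrable lborel K2"
  proof (rule integrable_abs_bound[OF integrable_mult_right _ A])
    show "integrable lborel (weight s :: real^'n \<Rightarrow> real)" using s by (intro weight_integrable) simp
  qed simp
  \<comment> \<open>The far part is integrable and even, so its integral against the second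
    difference splits into a multiple of u and twice a convolution. Three terms of class j
    remain.\<close>
  have "frac_integral s u x = (LINT h|lborel. second_diff u x h * K1 h) + (2 * \<kappa>) * u x + (- 2) * D x" for x
  proof -
    have Gi: "integrable lborel (\<lambda>y. u y * K2 (x - y))"
    proof -
      obtain B where B: "integrable lborel B" "\<And>y. \<bar>u y * K2 (x - y)\<bar> \<le> B y"
        using far_convolution_bound[OF u s0 A, of "norm x"] by blast
      show ?thesis by (rule integrable_abs_bound[OF B(1) _ B(2)]) measurable
    qed
    have even: "K2 (- h) = K2 h" for h by (simp add: K2_def)
    have sh: "(LINT h|lborel. u (x + c *\<^sub>R h) * K2 h) = D x" "integrable lborel (\<lambda>h. u (x + c *\<^sub>R h) * K2 h)"
      if "\<bar>c\<bar> = 1" for c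
    proof -
      have eq: "u (x + c *\<^sub>R h) * K2 h = u (x + c *\<^sub>R h) * K2 (x - (x + c *\<^sub>R h))" for h
        using that even[of h] by (auto simp: abs_if split: if_splits)
      show "(LINT h|lborel. u (x + c *\<^sub>R h) * K2 h) = D x"
        unfolding eq D_def by (rule integral_isometry[OF that, where f = "\<lambda>y. u y * K2 (x - y)"]) measurable
      show "integrable lborel (\<lambda>h. u (x + c *\<^sub>R h) * K2 h)"
        unfolding eq using integrable_isometry[OF that Gi, of x] .
    qed
    have far_i: "integrable lborel (\<lambda>h. second_diff u x h * K2 h)"
      and far_eq: "(LINT h|lborel. second_diff u x h * K2 h) = 2 * \<kappa> * u x - 2 * D x"
    proof -
      have eq: "second_diff u x h * K2 h = 2 * u x * K2 h - u (x + h) * K2 h - u (x - h) * K2 h" for h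
        by (simp add: second_diff_def algebra_simps)
      show "integrable lborel (\<lambda>h. second_diff u x h * K2 h)"
        unfolding eq using sh(2)[of 1] sh(2)[of "- 1"] K2i by simp
      show "(LINT h|lborel. second_diff u x h * K2 h) = 2 * \<kappa> * u x - 2 * D x"
        unfolding eq using sh[of 1] sh[of "- 1"] K2i by (simp add: \<kappa>_def)
    qed
    have "integrable lborel (\<lambda>h. second_diff u x h * norm h powr (- s))"
      using sd[of "[]"] s by (intro second_diff_kernel(1)[OF c u]) auto
    then have near_i: "integrable lborel (\<lambda>h. second_diff u x h * K1 h)"
      unfolding K1_def right_diff_distrib using far_i by (rule Bochner_Integration.integrable_diff)
    have "frac_integral s u x = (LINT h|lborel. second_diff u x h * K1 h + second_diff u x h * K2 h)"
      unfolding frac_integral_def K1_def by (simp add: algebra_simps)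
    then show ?thesis using near_i far_i far_eq by simp
  qed
  then have "frac_integral s u = (\<lambda>x. (LINT h|lborel. second_diff u x h * K1 h) + (2 * \<kappa>) * u x + (- 2) * D x)"
    by blast
  then show ?thesis
    by (simp only: C_class_add[OF C_class_add[OF near C_class_cmult[OF C]] C_class_cmult[OF conv]])
qed

section \<open>Averages of the fractional Laplacian\<close>

lemma integrable_compact_support:
  fixes f :: "'a::euclidean_space \<Rightarrow> real"
  assumes "continuous_on UNIV f" and supp: "\<And>x. norm x > R \<Longrightarrow> f x = 0"
  shows "integrable lborel f"
proof -
  have "integrable lborel (\<lambda>x. indicator (cball 0 R) x *\<^sub>R f x)"
    by (intro borel_integrable_compact continuous_on_subset[OF assms(1)]) auto
  also have "(\<lambda>x. indicator (cball 0 R) x *\<^sub>R f x) = f"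
    using supp by (auto simp: indicator_def fun_eq_iff)
  finally show ?thesis .
qed

text \<open>The integral of a non-integrable function is 0 by convention, so the bound is available
  before integrability is known.\<close>

lemma abs_integral_le_nn_integral:
  fixes f :: "'a \<Rightarrow> real"
  shows "ennreal \<bar>LINT x|M. f x\<bar> \<le> (\<integral>\<^sup>+x. ennreal \<bar>f x\<bar> \<partial>M)"
proof (cases "integrable M f")
  case True
  then show ?thesis using integral_norm_bound_ennreal[OF True] by simp
qed (simp add: not_integrable_integral_eq)

text \<open>Translation by h is adjoint to translation by -h, and the second difference is symmetric
  under exchanging the two. The compact support of p makes each of the three integrals converge on
  its own.\<close>

lemma second_diff_adjoint:
  fixes u p :: "'a::euclidean_space \<Rightarrow> real"
  assumes u: "continuous_on UNIV u" and p: "continuous_on UNIV p" and supp: "\<And>x. norm x > R \<Longrightarrow> p x = 0"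
  shows "(LINT x|lborel. second_diff u x h * p x) = (LINT x|lborel. u x * second_diff p x h)"
proof -
  have [measurable]: "u \<in> borel_measurable borel" "p \<in> borel_measurable borel"
    using u p by (auto intro: borel_measurable_continuous_onI)
  have i: "integrable lborel (\<lambda>x. u (x + k) * p x)" for k
    by (rule integrable_compact_support[where R = R])
      (auto intro!: continuous_on_mult p continuous_on_compose_UNIV[OF u] continuous_intros simp: supp)
  have eq: "u x * p (x + k) = u ((x + k) + - k) * p (x + k)" for x k by simp
  have j: "integrable lborel (\<lambda>x. u x * p (x + k))"
    and k: "(LINT x|lborel. u x * p (x + k)) = (LINT x|lborel. u (x + - k) * p x)" for k
  proof -
    show "integrable lborel (\<lambda>x. u x * p (x + k))"
      using integrable_isometry[OF _ i[of "- k"], of 1 k] by (simp add: add.commute)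
    show "(LINT x|lborel. u x * p (x + k)) = (LINT x|lborel. u (x + - k) * p x)"
      using integral_isometry[of 1 "\<lambda>x. u (x + - k) * p x" k] by (simp add: add.commute)
  qed
  have "(LINT x|lborel. second_diff u x h * p x) =
      (LINT x|lborel. 2 * (u (x + 0) * p x) - u (x + h) * p x - u (x + - h) * p x)"
    by (simp add: second_diff_def algebra_simps)
  also have "\<dots> = (LINT x|lborel. 2 * (u (x + 0) * p x)) - (LINT x|lborel. u (x + h) * p x)
      - (LINT x|lborel. u (x + - h) * p x)"
    by (simp only: Bochner_Integration.integral_diff Bochner_Integration.integrable_diff
        integrable_mult_right i)
  also have "\<dots> = (LINT x|lborel. 2 * (u x * p (x + 0))) - (LINT x|lborel. u x * p (x + - h))
      - (LINT x|lborel. u x * p (x + h))"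
    using k[of h] k[of "- h"] by simp
  also have "\<dots> = (LINT x|lborel. 2 * (u x * p (x + 0)) - u x * p (x + - h) - u x * p (x + h))"
    by (simp only: Bochner_Integration.integral_diff Bochner_Integration.integrable_diff
        integrable_mult_right j)
  also have "\<dots> = (LINT x|lborel. u x * second_diff p x h)"
    by (simp add: second_diff_def algebra_simps)
  finally show ?thesis .
qed

text \<open>Fubini for signed integrands is used once, on the side of u, where the compact support
  of p gives absolute convergence. Afterwards absolute values are taken and the order is swapped
  back for nonnegative integrands, so no finiteness on the side of p has to be known here.\<close>

lemma frac_integral_test_bound:
  fixes u p :: "'a::euclidean_space \<Rightarrow> real"
  assumes c: "continuous_on UNIV u" and u: "integrable lborel (\<lambda>y. \<bar>u y\<bar> * weight s y)"
    and sd: "sd_bounded \<sigma> u" and s: "s > DIM('a)" "s < \<sigma> + DIM('a)"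
    and p: "continuous_on UNIV p" and supp: "\<And>x. norm x > R \<Longrightarrow> p x = 0"
  shows "ennreal \<bar>LINT x|lborel. frac_integral s u x * p x\<bar> \<le>
    (\<integral>\<^sup>+x. ennreal \<bar>u x\<bar> * (\<integral>\<^sup>+h. ennreal (\<bar>second_diff p x h\<bar> * norm h powr (- s)) \<partial>lborel) \<partial>lborel)"
proof -
  have um [measurable]: "u \<in> borel_measurable borel" and pm [measurable]: "p \<in> borel_measurable borel"
    using c p by (auto intro: borel_measurable_continuous_onI)
  define F where "F x h = second_diff u x h * norm h powr (- s) * p x" for x h
  have Fm [measurable]: "case_prod F \<in> borel_measurable (lborel \<Otimes>\<^sub>M lborel)"
    unfolding F_def second_diff_def by measurable
  have Fi: "integrable lborel (F x)" for x
    unfolding F_def using second_diff_kernel(1)[OF c u sd s, of x] by simp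
  obtain B where B: "\<And>x. norm x \<le> R \<Longrightarrow> (LINT h|lborel. \<bar>second_diff u x h * norm h powr (- s)\<bar>) \<le> B"
    using second_diff_kernel(2)[OF c u sd s, of R] by blast
  have "integrable (lborel \<Otimes>\<^sub>M lborel) (case_prod F)"
  proof (rule lborel_pair.Fubini_integrable[OF Fm])
    have "integrable lborel (\<lambda>x. B * \<bar>p x\<bar>)"
      using integrable_compact_support[OF p supp] by simp
    then have "integrable lborel (\<lambda>x. LINT h|lborel. \<bar>F x h\<bar>)"
    proof (rule integrable_abs_bound)
      show "(\<lambda>x. LINT h|lborel. \<bar>F x h\<bar>) \<in> borel_measurable lborel"
        using Fm by (intro lborel.borel_measurable_lebesgue_integral) measurable
      fix x
      have eq: "(LINT h|lborel. \<bar>F x h\<bar>) = (LINT h|lborel. \<bar>second_diff u x h * norm h powr (- s)\<bar>) * \<bar>p x\<bar>"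
        unfolding F_def abs_mult[of _ "p x"] by simp
      show "\<bar>LINT h|lborel. \<bar>F x h\<bar>\<bar> \<le> B * \<bar>p x\<bar>"
      proof (cases "norm x \<le> R")
        case True
        then show ?thesis unfolding eq using B[OF True] by (simp add: abs_mult mult_right_mono)
      qed (simp add: F_def supp)
    qed
    then show "integrable lborel (\<lambda>x. LINT h|lborel. norm (case_prod F (x, h)))" by simp
    show "AE x in lborel. integrable lborel (\<lambda>h. case_prod F (x, h))" using Fi by simp
  qed
  then have "(LINT h|lborel. LINT x|lborel. F x h) = (LINT x|lborel. LINT h|lborel. F x h)"
    by (rule lborel_pair.Fubini_integral)
  moreover have "(LINT h|lborel. F x h) = frac_integral s u x * p x" for x
    unfolding F_def frac_integral_def by simp
  moreover have "(LINT x|lborel. F x h) = (LINT x|lborel. u x * second_diff p x h) * norm h powr (- s)" for h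
  proof -
    have "(LINT x|lborel. F x h) = (LINT x|lborel. (second_diff u x h * p x) * norm h powr (- s))"
      unfolding F_def by (simp add: mult_ac)
    also have "\<dots> = (LINT x|lborel. second_diff u x h * p x) * norm h powr (- s)" by simp
    finally show ?thesis using second_diff_adjoint[OF c p supp, where h = h] by simp
  qed
  ultimately have "\<bar>LINT x|lborel. frac_integral s u x * p x\<bar> =
      \<bar>LINT h|lborel. (LINT x|lborel. u x * second_diff p x h) * norm h powr (- s)\<bar>" by simp
  also have "ennreal \<dots> \<le> (\<integral>\<^sup>+h. ennreal \<bar>(LINT x|lborel. u x * second_diff p x h) * norm h powr (- s)\<bar> \<partial>lborel)"
    by (rule abs_integral_le_nn_integral)
  also have "\<dots> \<le> (\<integral>\<^sup>+h. (\<integral>\<^sup>+x. ennreal \<bar>u x\<bar> * ennreal (\<bar>second_diff p x h\<bar> * norm h powr (- s)) \<partial>lborel) \<partial>lborel)"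
  proof (rule nn_integral_mono)
    fix h :: 'a
    have "ennreal \<bar>LINT x|lborel. u x * second_diff p x h\<bar> \<le> (\<integral>\<^sup>+x. ennreal \<bar>u x * second_diff p x h\<bar> \<partial>lborel)"
      by (rule abs_integral_le_nn_integral)
    then have "ennreal \<bar>(LINT x|lborel. u x * second_diff p x h) * norm h powr (- s)\<bar> \<le>
        (\<integral>\<^sup>+x. ennreal \<bar>u x * second_diff p x h\<bar> \<partial>lborel) * ennreal (norm h powr (- s))"
      by (simp add: abs_mult ennreal_mult mult_right_mono)
    also have "\<dots> = (\<integral>\<^sup>+x. ennreal \<bar>u x * second_diff p x h\<bar> * ennreal (norm h powr (- s)) \<partial>lborel)"
      unfolding second_diff_def by (rule nn_integral_multc[symmetric]) measurable
    also have "\<dots> = (\<integral>\<^sup>+x. ennreal \<bar>u x\<bar> * ennreal (\<bar>second_diff p x h\<bar> * norm h powr (- s)) \<partial>lborel)"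
      by (simp add: abs_mult ennreal_mult mult.assoc)
    finally show "ennreal \<bar>(LINT x|lborel. u x * second_diff p x h) * norm h powr (- s)\<bar> \<le> \<dots>" .
  qed
  also have "\<dots> = (\<integral>\<^sup>+x. (\<integral>\<^sup>+h. ennreal \<bar>u x\<bar> * ennreal (\<bar>second_diff p x h\<bar> * norm h powr (- s)) \<partial>lborel) \<partial>lborel)"
    unfolding second_diff_def by (rule lborel_pair.Fubini') measurable
  also have "\<dots> = (\<integral>\<^sup>+x. ennreal \<bar>u x\<bar> * (\<integral>\<^sup>+h. ennreal (\<bar>second_diff p x h\<bar> * norm h powr (- s)) \<partial>lborel) \<partial>lborel)"
    unfolding second_diff_def by (intro nn_integral_cong nn_integral_cmult) measurable
  finally show ?thesis .
qed

section \<open>Truncated power bumps: derivatives, decay and scaling\<close>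

definition bump :: "nat \<Rightarrow> 'a::real_normed_vector \<Rightarrow> real \<Rightarrow> 'a \<Rightarrow> real" where
  "bump M a R x = max 0 (R\<^sup>2 - (norm (x - a))\<^sup>2) ^ M"

lemma bump_nonneg: "0 \<le> bump M a R x"
  by (simp add: bump_def)

lemma bump_eq_0: "0 < M \<Longrightarrow> 0 \<le> R \<Longrightarrow> R \<le> norm (x - a) \<Longrightarrow> bump M a R x = 0"
  unfolding bump_def using power_mono[of R "norm (x - a)" 2] by simp

lemma bump_support: "0 < M \<Longrightarrow> 0 \<le> R \<Longrightarrow> norm x > norm a + R \<Longrightarrow> bump M a R x = 0"
  using norm_triangle_ineq2[of x a] by (intro bump_eq_0) auto

lemma bump_continuous: "continuous_on UNIV (bump M a R)"
  unfolding bump_def [abs_def] by (intro continuous_intros)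

lemma bump_Suc: "bump (Suc M) a R x = (R\<^sup>2 - (norm (x - a))\<^sup>2) * bump M a R x" if "0 < M"
  using that by (cases "R\<^sup>2 - (norm (x - a))\<^sup>2 \<le> 0") (auto simp: bump_def max_def)

lemma DERIV_pos_part_power:
  assumes "2 \<le> M"
  shows "((\<lambda>t. max 0 t ^ M) has_real_derivative real M * max 0 t ^ (M - 1)) (at (t::real))"
proof -
  have "((\<lambda>t. if 0 \<le> t then t ^ M else 0) has_real_derivative
      (if 0 \<le> t then real M * t ^ (M - 1) else 0)) (at t)"
    using assms by (intro DERIV_glue) (auto intro!: derivative_eq_intros)
  moreover have "(\<lambda>t. if 0 \<le> t then t ^ M else 0) = (\<lambda>t::real. max 0 t ^ M)"
    using assms by (auto simp: max_def)
  moreover have "(if 0 \<le> t then real M * t ^ (M - 1) else 0) = real M * max 0 t ^ (M - 1)"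
    using assms by (auto simp: max_def)
  ultimately show ?thesis by simp
qed

lemma bump_pderiv:
  fixes a :: "real^'n::finite"
  assumes "2 \<le> M"
  shows "has_pderiv i (bump M a R) (\<lambda>x. - 2 * real M * ((x - a) $ i) * bump (M - 1) a R x)"
proof -
  have "((\<lambda>t. max 0 (R\<^sup>2 - t) ^ M) has_real_derivative - (real M * max 0 (R\<^sup>2 - t) ^ (M - 1))) (at t)" for t
  proof -
    have "((\<lambda>t. R\<^sup>2 - t) has_real_derivative - 1) (at t)" by (auto intro!: derivative_eq_intros)
    from DERIV_chain2[OF DERIV_pos_part_power[OF assms] this] show ?thesis by simp
  qed
  then have "has_pderiv i (\<lambda>x::real^'n. max 0 (R\<^sup>2 - (norm x)\<^sup>2) ^ M)
      (\<lambda>x. 2 * x $ i * - (real M * max 0 (R\<^sup>2 - (norm x)\<^sup>2) ^ (M - 1)))"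
    by (rule has_pderiv_radial)
  from has_pderiv_translate[OF this, of "- a"] show ?thesis
    unfolding bump_def [abs_def] by (simp add: mult_ac)
qed

lemma bump_pderiv2:
  fixes a :: "real^'n::finite"
  assumes "3 \<le> M"
  shows "has_pderiv i (\<lambda>x. - 2 * real M * ((x - a) $ i) * bump (M - 1) a R x)
    (\<lambda>x. - 2 * real M * bump (M - 1) a R x + 4 * real M * real (M - 1) * ((x - a) $ i)\<^sup>2 * bump (M - 2) a R x)"
proof -
  have M: "M - 1 - 1 = M - 2" by simp
  have comp: "has_pderiv i (\<lambda>x::real^'n. (x - a) $ i) (\<lambda>x. 1)"
    using has_pderiv_diff[OF has_pderiv_component has_pderiv_const, of i i "a $ i"] by simp
  have "has_pderiv i (bump (M - 1) a R) (\<lambda>x. - 2 * real (M - 1) * ((x - a) $ i) * bump (M - 2) a R x)"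
    using bump_pderiv[of "M - 1" i a R] assms unfolding M by simp
  from has_pderiv_cmult[OF has_pderiv_mult[OF comp this], of "- 2 * real M"] show ?thesis
    by (simp add: power2_eq_square algebra_simps)
qed

text \<open>For M \<ge> 3 the gradient of the bump is Lipschitz, so its second differences are
  O(|h|^2), enough for the kernel as s < n + 2. This gives a uniform bound for |z| \<le> 3. For
  larger z only u-free terms \<open>?P (z + h)\<close> and \<open>?P (z - h)\<close> remain, and
  they force |h| \<ge> |z| / 2, whence the decay |z|^-s.\<close>

lemma bump_second_diff_bound:
  fixes s :: real
  assumes M: "3 \<le> M" and s: "CARD('n::finite) < s" "s < CARD('n) + 2"
  shows "\<exists>C\<ge>0. \<forall>z::real^'n. (\<integral>\<^sup>+h. ennreal (\<bar>second_diff (bump M 0 1) z h\<bar> * norm h powr (- s)) \<partial>lborel)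
    \<le> ennreal (C * weight s z)"
proof -
  let ?P = "bump M 0 1 :: real^'n \<Rightarrow> real"
  have s0: "s > 0" using s by linarith
  have s': "s > DIM(real^'n)" "s < 2 + real DIM(real^'n)" using s by simp_all
  have c: "continuous_on UNIV ?P" by (rule bump_continuous)
  have [measurable]: "?P \<in> borel_measurable borel" using c by (rule borel_measurable_continuous_onI)
  have supp: "?P x = 0" if "norm x > 1" for x using that M by (intro bump_support) auto
  have le1: "?P x \<le> 1" for x
    unfolding bump_def by (intro power_le_one) auto
  have "sd_bounded (1 + 1) ?P"
  proof (rule sd_bounded_C1[OF bump_pderiv])
    show "loc_Holder 1 (\<lambda>x::real^'n. - 2 * real M * ((x - 0) $ i) * bump (M - 1) 0 1 x)" for i
    proof (rule loc_Lipschitz_C1)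
      fix j
      have m: "M - 1 \<ge> 2" using M by simp
      have comp: "has_pderiv j (\<lambda>x::real^'n. (x - 0) $ i) (\<lambda>x. if j = i then 1 else 0)"
        using has_pderiv_component[of j i] by simp
      show "has_pderiv j (\<lambda>x::real^'n. - 2 * real M * ((x - 0) $ i) * bump (M - 1) 0 1 x)
          (\<lambda>x. (- 2 * real M) * ((if j = i then 1 else 0) * bump (M - 1) 0 1 x +
             (x - 0) $ i * (- 2 * real (M - 1) * ((x - 0) $ j) * bump (M - 1 - 1) 0 1 x)))"
        unfolding mult.assoc[of "- 2 * real M"]
        by (intro has_pderiv_cmult has_pderiv_mult comp bump_pderiv m)
      show "continuous_on UNIV (\<lambda>x::real^'n. (- 2 * real M) * ((if j = i then 1 else 0) * bump (M - 1) 0 1 x +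
             (x - 0) $ i * (- 2 * real (M - 1) * ((x - 0) $ j) * bump (M - 1 - 1) 0 1 x)))"
        by (intro continuous_intros bump_continuous)
    qed
  qed (use M in auto)
  then have sd: "sd_bounded 2 ?P" by simp
  have Pi: "integrable lborel ?P" using c supp by (rule integrable_compact_support)
  have wi: "integrable lborel (\<lambda>y. \<bar>?P y\<bar> * weight s y)"
  proof (rule integrable_abs_bound[OF Pi])
    show "\<bar>\<bar>?P y\<bar> * weight s y\<bar> \<le> ?P y" for y
      using bump_nonneg[of M "0::real^'n" 1 y] weight_pos[of s y] weight_le_1[of s y]
      by (simp add: abs_mult mult_left_le)
  qed measurable
  obtain B where B: "\<And>z. norm z \<le> 3 \<Longrightarrow> (LINT h|lborel. \<bar>second_diff ?P z h * norm h powr (- s)\<bar>) \<le> B"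
    using second_diff_kernel(2)[OF c wi sd s', of 3] by blast
  \<comment> \<open>Least value of the weight on the ball of radius 3; dividing by it turns the
    uniform bound B into a multiple of the weight.\<close>
  define w where "w = 1 / (1 + (3::real) powr s)"
  define V where "V = (LINT h|lborel. ?P h)"
  have V: "V \<ge> 0" unfolding V_def by (intro integral_nonneg_AE) (simp add: bump_nonneg)
  have w: "w > 0" unfolding w_def by (simp add: add_pos_nonneg)
  define C where "C = \<bar>B\<bar> / w + 4 * 2 powr s * V"
  have C: "C \<ge> 0" unfolding C_def using w V by simp
  have "(\<integral>\<^sup>+h. ennreal (\<bar>second_diff ?P z h\<bar> * norm h powr (- s)) \<partial>lborel) \<le> ennreal (C * weight s z)" for z
  proof (cases "norm z \<le> 3")
    case True
    have "w \<le> weight s z"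
      unfolding w_def weight_def using True s0
      by (intro divide_left_mono) (auto intro!: powr_mono2 mult_pos_pos add_pos_nonneg)
    then have "\<bar>B\<bar> \<le> \<bar>B\<bar> / w * weight s z"
      using w mult_left_mono[of w "weight s z" "\<bar>B\<bar>"] by (simp add: field_simps)
    also have "\<dots> \<le> C * weight s z" using V less_imp_le[OF weight_pos, of s z]
      by (intro mult_right_mono) (auto simp: C_def)
    finally have le: "B \<le> C * weight s z" by simp
    have "integrable lborel (\<lambda>h. \<bar>second_diff ?P z h * norm h powr (- s)\<bar>)"
      by (intro integrable_abs second_diff_kernel(1)[OF c wi sd s'])
    then have "(\<integral>\<^sup>+h. ennreal \<bar>second_diff ?P z h * norm h powr (- s)\<bar> \<partial>lborel) =
        ennreal (LINT h|lborel. \<bar>second_diff ?P z h * norm h powr (- s)\<bar>)"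
      by (rule nn_integral_eq_integral) simp
    also have "\<dots> \<le> ennreal (C * weight s z)" using B[OF True] le by (intro ennreal_leI) simp
    finally show ?thesis by (simp add: abs_mult)
  next
    case False
    have z: "?P z = 0" using False by (intro supp) simp
    have pt: "?P (z + h) * norm h powr (- s) \<le> ?P (z + h) * (2 * 2 powr s * weight s z)" for h
    proof (cases "?P (z + h) = 0")
      case False': False
      then have "norm (z + h) \<le> 1" using supp by force
      then have h: "norm z / 2 \<le> norm h"
        \<comment> \<open>Here |h| \<ge> |z| - 1, and |z| > 3 makes this at least |z| / 2.\<close>
        using False norm_triangle_ineq2[of z "- h"] by simp
      have "norm h powr (- s) \<le> (norm z / 2) powr (- s)"
        using h False s0 by (intro powr_mono2') auto
      also have "\<dots> = 2 powr s * norm z powr (- s)"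
        using False by (simp add: powr_divide powr_minus_divide)
      also have "\<dots> \<le> 2 powr s * (2 * weight s z)"
        using False s0 by (intro mult_left_mono powr_le_weight) auto
      finally show ?thesis using bump_nonneg[of M "0::real^'n" 1 "z + h"] by (intro mult_left_mono) (auto simp: mult_ac)
    qed simp
    have Ii: "integrable lborel (\<lambda>h. ?P (z + c *\<^sub>R h))" "(LINT h|lborel. ?P (z + c *\<^sub>R h)) = V"
      if "\<bar>c\<bar> = 1" for c
      using integrable_isometry[OF that Pi, of z] integral_isometry[OF that, of ?P z] by (auto simp: V_def)
    define G where "G h = (?P (z + h) + ?P (z - h)) * (2 * 2 powr s * weight s z)" for h
    have "(\<integral>\<^sup>+h. ennreal (\<bar>second_diff ?P z h\<bar> * norm h powr (- s)) \<partial>lborel) \<le> (\<integral>\<^sup>+h. ennreal (G h) \<partial>lborel)"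
    proof (intro nn_integral_mono ennreal_leI)
      fix h
      have "\<bar>second_diff ?P z h\<bar> = ?P (z + h) + ?P (z + - h)"
        using z bump_nonneg[of M "0::real^'n" 1 "z + h"] bump_nonneg[of M "0::real^'n" 1 "z - h"]
        by (simp add: second_diff_def)
      then have "\<bar>second_diff ?P z h\<bar> * norm h powr (- s) =
          ?P (z + h) * norm h powr (- s) + ?P (z + - h) * norm (- h) powr (- s)"
        by (simp add: distrib_right)
      also have "\<dots> \<le> ?P (z + h) * (2 * 2 powr s * weight s z) + ?P (z + - h) * (2 * 2 powr s * weight s z)"
        by (rule add_mono[OF pt pt])
      also have "\<dots> = G h" by (simp add: G_def distrib_right)
      finally show "\<bar>second_diff ?P z h\<bar> * norm h powr (- s) \<le> G h" .
    qed
    also have "\<dots> = ennreal (LINT h|lborel. G h)"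
    proof (rule nn_integral_eq_integral)
      show "integrable lborel G" unfolding G_def using Ii[of 1] Ii[of "- 1"] by simp
      show "AE h in lborel. 0 \<le> G h"
        unfolding G_def using weight_pos[of s z] by (simp add: bump_nonneg)
    qed
    also have "(LINT h|lborel. G h) = (V + V) * (2 * 2 powr s * weight s z)"
      unfolding G_def using Ii[of 1] Ii[of "- 1"] by simp
    also have "\<dots> = (4 * 2 powr s * V) * weight s z" by simp
    also have "\<dots> \<le> C * weight s z"
      using w less_imp_le[OF weight_pos, of s z] by (intro mult_right_mono) (auto simp: C_def)
    finally show ?thesis by (simp add: ennreal_leI)
  qed
  then show ?thesis using C by blast
qed

lemma bump_scale:
  assumes "R > 0"
  shows "bump M a R x = R ^ (2 * M) * bump M 0 1 ((1 / R) *\<^sub>R (x - a))"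
proof -
  have max: "R\<^sup>2 * max 0 t = max 0 (R\<^sup>2 * t)" for t
    by (cases "t \<le> 0") (simp_all add: max_absorb1 max_absorb2 mult_nonneg_nonpos)
  have "R\<^sup>2 * (1 - (norm ((1 / R) *\<^sub>R (x - a)))\<^sup>2) = R\<^sup>2 - (norm (x - a))\<^sup>2"
    using assms by (simp add: power_divide right_diff_distrib)
  then have "R\<^sup>2 * max 0 (1 - (norm ((1 / R) *\<^sub>R (x - a)))\<^sup>2) = max 0 (R\<^sup>2 - (norm (x - a))\<^sup>2)"
    by (simp only: max)
  then show ?thesis
    unfolding bump_def by (simp add: power_mult power_mult_distrib[symmetric])
qed

lemma second_diff_bump_scale:
  fixes a :: "'a::euclidean_space" and s :: real
  assumes R: "R > 0" and M: "0 < M"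
  shows "(\<integral>\<^sup>+h. ennreal (\<bar>second_diff (bump M a R) x h\<bar> * norm h powr (- s)) \<partial>lborel) =
    ennreal (R ^ (DIM('a) + 2 * M) * R powr (- s)) *
    (\<integral>\<^sup>+h. ennreal (\<bar>second_diff (bump M 0 1) ((1 / R) *\<^sub>R (x - a)) h\<bar> * norm h powr (- s)) \<partial>lborel)"
proof -
  let ?P = "bump M 0 1 :: 'a \<Rightarrow> real"
  let ?z = "(1 / R) *\<^sub>R (x - a)"
  have m: "second_diff (bump M b r) y \<in> borel_measurable borel" for b y :: 'a and r
    by (intro second_diff_measurable bump_continuous)
  note [measurable] = m
  have sc: "second_diff (bump M a R) x (R *\<^sub>R h) = R ^ (2 * M) * second_diff ?P ?z h" for h
  proof -
    have "(1 / R) *\<^sub>R (x + R *\<^sub>R h - a) = ?z + h" "(1 / R) *\<^sub>R (x - R *\<^sub>R h - a) = ?z - h"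
      using R by (simp_all add: scaleR_add_right scaleR_diff_right)
    then show ?thesis
      unfolding second_diff_def bump_scale[OF R, of M a] by (simp add: algebra_simps)
  qed
  have "(\<integral>\<^sup>+h. ennreal (\<bar>second_diff (bump M a R) x h\<bar> * norm h powr (- s)) \<partial>lborel) =
    ennreal (R ^ DIM('a)) * (\<integral>\<^sup>+h. ennreal (\<bar>second_diff (bump M a R) x (R *\<^sub>R h)\<bar> * norm (R *\<^sub>R h) powr (- s)) \<partial>lborel)"
    by (rule nn_integral_scaleR[OF R]) measurable
  also have "(\<integral>\<^sup>+h. ennreal (\<bar>second_diff (bump M a R) x (R *\<^sub>R h)\<bar> * norm (R *\<^sub>R h) powr (- s)) \<partial>lborel) =
    (\<integral>\<^sup>+h. ennreal (R ^ (2 * M) * R powr (- s)) * ennreal (\<bar>second_diff ?P ?z h\<bar> * norm h powr (- s)) \<partial>lborel)"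
    using R by (intro nn_integral_cong)
      (simp add: sc abs_mult powr_mult mult_ac flip: ennreal_mult)
  also have "\<dots> = ennreal (R ^ (2 * M) * R powr (- s)) *
      (\<integral>\<^sup>+h. ennreal (\<bar>second_diff ?P ?z h\<bar> * norm h powr (- s)) \<partial>lborel)"
    by (rule nn_integral_cmult) measurable
  also have "ennreal (R ^ DIM('a)) * \<dots> = (ennreal (R ^ DIM('a)) * ennreal (R ^ (2 * M) * R powr (- s))) *
      (\<integral>\<^sup>+h. ennreal (\<bar>second_diff ?P ?z h\<bar> * norm h powr (- s)) \<partial>lborel)"
    by (simp only: mult.assoc)
  also have "ennreal (R ^ DIM('a)) * ennreal (R ^ (2 * M) * R powr (- s)) = ennreal (R ^ (DIM('a) + 2 * M) * R powr (- s))"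
    using R by (simp add: power_add mult_ac flip: ennreal_mult)
  finally show ?thesis .
qed

text \<open>The mass of \<open>bump M a R\<close> is a constant, depending on M and the dimension,
  times the power of R in the denominator. The quotient is thus a true average up to a fixed
  positive factor, which affects neither signs, nor monotonicity, nor the limit 0.\<close>

definition bump_avg :: "nat \<Rightarrow> 'a::euclidean_space \<Rightarrow> ('a \<Rightarrow> real) \<Rightarrow> real \<Rightarrow> real" where
  "bump_avg M a w R = (LINT x|lborel. w x * bump M a R x) / R ^ (DIM('a) + 2 * M)"

lemma bump_avg_frac_integral:
  fixes u :: "real^'n::finite \<Rightarrow> real"
  assumes c: "continuous_on UNIV u" and u: "integrable lborel (\<lambda>y. \<bar>u y\<bar> * weight s y)"
    and sd: "sd_bounded \<sigma> u" and s: "s > real CARD('n)" "s < real CARD('n) + 2" "s < \<sigma> + real CARD('n)"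
    and M: "3 \<le> M"
  shows "(bump_avg M a (frac_integral s u) \<longlongrightarrow> 0) at_top"
proof -
  have s0: "s > 0" using s by linarith
  have [measurable]: "u \<in> borel_measurable borel" using c by (rule borel_measurable_continuous_onI)
  obtain C where C: "C \<ge> 0" "\<And>z::real^'n.
      (\<integral>\<^sup>+h. ennreal (\<bar>second_diff (bump M 0 1) z h\<bar> * norm h powr (- s)) \<partial>lborel) \<le> ennreal (C * weight s z)"
    using bump_second_diff_bound[OF M, where 'n = 'n and s = s] s by auto
  \<comment> \<open>The rescaled weight that the change of variables produces. It tends to 0
    pointwise as R grows and, for R \<ge> 1, stays below a multiple of the weight for which u is
    integrable.\<close>
  define g where "g R x = 1 / (R powr s + norm (x - a) powr s)" for R :: real and x
  have g0: "0 \<le> g R x" for R x by (simp add: g_def)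
  have gw: "R powr (- s) * weight s ((1 / R) *\<^sub>R (x - a)) = g R x" if "R > 0" for R x
  proof -
    have "norm ((1 / R) *\<^sub>R (x - a)) powr s = norm (x - a) powr s / R powr s"
      using that by (simp add: powr_divide)
    then show ?thesis using that by (simp add: weight_def g_def powr_minus_divide field_simps)
  qed
  obtain D where D: "\<And>x y::real^'n. norm x \<le> norm a \<Longrightarrow> weight s (y - x) \<le> D * weight s y"
    using weight_translate[OF s0, of "norm a"] by auto
  have bd: "\<bar>u x\<bar> * g R x \<le> D * (\<bar>u x\<bar> * weight s x)" if "R \<ge> 1" for R x
  proof -
    have "1 \<le> R powr s" using that s0 by (simp add: ge_one_powr_ge_zero)
    then have "g R x \<le> weight s (x - a)"
      unfolding g_def weight_def by (intro divide_left_mono) (auto intro!: mult_pos_pos add_pos_nonneg)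
    also have "\<dots> \<le> D * weight s x" by (rule D) simp
    finally have "\<bar>u x\<bar> * g R x \<le> \<bar>u x\<bar> * (D * weight s x)" by (intro mult_left_mono) auto
    then show ?thesis by (simp add: mult_ac)
  qed
  have gm [measurable]: "g R \<in> borel_measurable borel" for R unfolding g_def by measurable
  have Di: "integrable lborel (\<lambda>x. D * (\<bar>u x\<bar> * weight s x))" using u by simp
  have gi: "integrable lborel (\<lambda>x. \<bar>u x\<bar> * g R x)" if "R \<ge> 1" for R
  proof (rule integrable_abs_bound[OF Di])
    show "\<bar>\<bar>u x\<bar> * g R x\<bar> \<le> D * (\<bar>u x\<bar> * weight s x)" for x
      using bd[OF that, of x] g0[of R x] by (simp add: abs_mult)
  qed measurable
  have est: "\<bar>bump_avg M a (frac_integral s u) R\<bar> \<le> C * (LINT x|lborel. \<bar>u x\<bar> * g R x)" if R1: "R \<ge> 1" for R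
  proof -
    have R: "R > 0" using R1 by simp
    \<comment> \<open>The normalizing power of \<open>bump_avg\<close>; it cancels against the
      scaling of the bump and leaves only \<open>R powr (- s)\<close>, which is absorbed into
      g.\<close>
    define K where "K = R ^ (CARD('n) + 2 * M)"
    have K: "K > 0" using R by (simp add: K_def)
    have "ennreal \<bar>LINT x|lborel. frac_integral s u x * bump M a R x\<bar> \<le>
        (\<integral>\<^sup>+x. ennreal \<bar>u x\<bar> * (\<integral>\<^sup>+h. ennreal (\<bar>second_diff (bump M a R) x h\<bar> * norm h powr (- s)) \<partial>lborel) \<partial>lborel)"
      using s M R by (intro frac_integral_test_bound[OF c u sd _ _ bump_continuous bump_support]) auto
    also have "\<dots> \<le> (\<integral>\<^sup>+x. ennreal (C * K * (\<bar>u x\<bar> * g R x)) \<partial>lborel)"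
    proof (rule nn_integral_mono)
      fix x
      let ?z = "(1 / R) *\<^sub>R (x - a)"
      have "(\<integral>\<^sup>+h. ennreal (\<bar>second_diff (bump M a R) x h\<bar> * norm h powr (- s)) \<partial>lborel) =
          ennreal (K * R powr (- s)) * (\<integral>\<^sup>+h. ennreal (\<bar>second_diff (bump M 0 1) ?z h\<bar> * norm h powr (- s)) \<partial>lborel)"
        using second_diff_bump_scale[OF R, of M a x s] M by (simp add: K_def)
      also have "\<dots> \<le> ennreal (K * R powr (- s)) * ennreal (C * weight s ?z)"
        by (intro mult_left_mono C(2)) simp
      also have "\<dots> = ennreal (C * K * (R powr (- s) * weight s ?z))"
        using K C(1) by (simp add: mult_ac less_imp_le[OF weight_pos] flip: ennreal_mult)
      finally have "ennreal \<bar>u x\<bar> * (\<integral>\<^sup>+h. ennreal (\<bar>second_diff (bump M a R) x h\<bar> * norm h powr (- s)) \<partial>lborel)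
          \<le> ennreal \<bar>u x\<bar> * ennreal (C * K * g R x)"
        unfolding gw[OF R] by (intro mult_left_mono) auto
      also have "\<dots> = ennreal (C * K * (\<bar>u x\<bar> * g R x))"
        using K C(1) g0 by (simp add: mult_ac flip: ennreal_mult)
      finally show "ennreal \<bar>u x\<bar> * (\<integral>\<^sup>+h. ennreal (\<bar>second_diff (bump M a R) x h\<bar> * norm h powr (- s)) \<partial>lborel)
          \<le> ennreal (C * K * (\<bar>u x\<bar> * g R x))" .
    qed
    also have "\<dots> = ennreal (LINT x|lborel. C * K * (\<bar>u x\<bar> * g R x))"
      using gi[OF R1] K C(1) g0 by (intro nn_integral_eq_integral) auto
    finally have "\<bar>LINT x|lborel. frac_integral s u x * bump M a R x\<bar> \<le> C * K * (LINT x|lborel. \<bar>u x\<bar> * g R x)"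
      using K C(1) g0 by (subst (asm) ennreal_le_iff) (auto intro!: mult_nonneg_nonneg integral_nonneg_AE)
    moreover have "bump_avg M a (frac_integral s u) R = (LINT x|lborel. frac_integral s u x * bump M a R x) / K"
      by (simp add: bump_avg_def K_def)
    ultimately show ?thesis using K by (simp add: pos_divide_le_eq mult_ac)
  qed
  have "((\<lambda>R. LINT x|lborel. \<bar>u x\<bar> * g R x) \<longlongrightarrow> (LINT x|(lborel :: (real^'n) measure). 0)) at_top"
  proof (rule integral_dominated_convergence_at_top[where w = "\<lambda>x. D * (\<bar>u x\<bar> * weight s x)"])
    show "\<forall>\<^sub>F R in at_top. AE x in lborel. norm (\<bar>u x\<bar> * g R x) \<le> D * (\<bar>u x\<bar> * weight s x)"
      using eventually_ge_at_top[of 1] by eventually_elim (use bd g0 in \<open>auto simp: abs_mult\<close>)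
    have "((\<lambda>R. \<bar>u x\<bar> * g R x) \<longlongrightarrow> 0) at_top" for x
    proof (rule tendsto_mult_right_zero, rule tendsto_sandwich[OF _ _ tendsto_const])
      show "\<forall>\<^sub>F R in at_top. 0 \<le> g R x" by (simp add: g0)
      show "\<forall>\<^sub>F R in at_top. g R x \<le> R powr (- s)"
        using eventually_gt_at_top[of 0]
        by eventually_elim (auto simp: g_def powr_minus_divide intro!: divide_left_mono mult_pos_pos add_pos_nonneg)
      show "((\<lambda>R. R powr (- s)) \<longlongrightarrow> 0) at_top"
        using s0 by (intro tendsto_neg_powr filterlim_ident) auto
    qed
    then show "AE x in lborel. ((\<lambda>R. \<bar>u x\<bar> * g R x) \<longlongrightarrow> 0) at_top" by simp
  qed (use Di in measurable)
  then have "((\<lambda>R. C * (LINT x|lborel. \<bar>u x\<bar> * g R x)) \<longlongrightarrow> 0) at_top"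
    by (intro tendsto_mult_right_zero) simp
  moreover have "\<forall>\<^sub>F R in at_top. norm (bump_avg M a (frac_integral s u) R) \<le> C * (LINT x|lborel. \<bar>u x\<bar> * g R x)"
    using eventually_ge_at_top[of 1] by eventually_elim (use est in auto)
  ultimately show ?thesis by (rule Lim_null_comparison[rotated])
qed

section \<open>Superharmonic functions with vanishing averages\<close>

text \<open>The integral of a translate of G does not depend on the translation, so its derivative
  with respect to the translation, the integral of G', vanishes. No iterated integrals are
  involved.\<close>

lemma integral_pderiv_eq_0:
  fixes G :: "real^'n::finite \<Rightarrow> real"
  assumes hp: "has_pderiv i G G'" and c: "continuous_on UNIV G" "continuous_on UNIV G'"
    and supp: "\<And>x. norm x > R \<Longrightarrow> G x = 0" "\<And>x. norm x > R \<Longrightarrow> G' x = 0"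
  shows "(LINT x|lborel. G' x) = 0"
proof -
  have [measurable]: "G \<in> borel_measurable borel" "G' \<in> borel_measurable borel"
    using c by (auto intro: borel_measurable_continuous_onI)
  have Gi: "integrable lborel G" using c(1) supp(1) by (rule integrable_compact_support)
  obtain S where S: "S \<ge> 0" "\<And>x. norm x \<le> R \<Longrightarrow> \<bar>G' x\<bar> \<le> S"
    using continuous_bounded_cball[OF c(2), of R] by metis
  have "has_pderiv i (\<lambda>y. LINT x|lborel. G (y + x)) (\<lambda>y. LINT x|lborel. G' (y + x))"
  proof (rule has_pderiv_integral)
    show "integrable lborel (\<lambda>x. G (y + x))" for y
      using integrable_isometry[OF _ Gi, of 1 y] by simp
    show "has_pderiv i (\<lambda>y. G (y + x)) (\<lambda>y. G' (y + x))" for x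
      by (rule has_pderiv_translate[OF hp])
    show "\<exists>B. integrable lborel B \<and> (\<forall>y x. norm y \<le> R0 \<longrightarrow> \<bar>G' (y + x)\<bar> \<le> B x)" for R0
    proof (intro exI conjI allI impI)
      show "integrable lborel (\<lambda>x::real^'n. S * indicator (cball 0 (R + R0)) x)"
        using borel_integrable_compact[of "cball (0::real^'n) (R + R0)" "\<lambda>_. S"] by (simp add: mult.commute)
      fix y x :: "real^'n" assume "norm y \<le> R0"
      then have "norm x \<le> R + R0" if "norm (y + x) \<le> R"
        using that norm_triangle_ineq2[of x "- y"] by (simp add: add.commute)
      then show "\<bar>G' (y + x)\<bar> \<le> S * indicator (cball 0 (R + R0)) x"
        using S supp(2)[of "y + x"] by (cases "norm (y + x) \<le> R") auto
    qed
  qed measurable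
  moreover have "(LINT x|lborel. G (y + x)) = (LINT x|lborel. G x)" for y
    using integral_isometry[of 1 G y] by simp
  ultimately have "has_pderiv i (\<lambda>y. LINT x|lborel. G x) (\<lambda>y. LINT x|lborel. G' (y + x))" by simp
  then have "(\<lambda>y. LINT x|lborel. G' (y + x)) = (\<lambda>y. 0)"
    using has_pderiv_const[of i "LINT x|lborel. G x"] has_pderiv_imp_eq by metis
  from fun_cong[OF this, of 0] show ?thesis by simp
qed

lemma integration_by_parts:
  fixes w p :: "real^'n::finite \<Rightarrow> real"
  assumes hp: "has_pderiv i w w'" "has_pderiv i p p'"
    and c: "continuous_on UNIV w" "continuous_on UNIV w'" "continuous_on UNIV p" "continuous_on UNIV p'"
    and supp: "\<And>x. norm x > R \<Longrightarrow> p x = 0" "\<And>x. norm x > R \<Longrightarrow> p' x = 0"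
  shows "(LINT x|lborel. w' x * p x) = - (LINT x|lborel. w x * p' x)"
proof -
  have i: "integrable lborel (\<lambda>x. w' x * p x)" "integrable lborel (\<lambda>x. w x * p' x)"
    by (rule integrable_compact_support[where R = R], (intro continuous_on_mult c), simp add: supp)+
  have "(LINT x|lborel. w' x * p x + w x * p' x) = 0"
    by (rule integral_pderiv_eq_0[OF has_pderiv_mult[OF hp], where R = R])
      (auto intro!: continuous_intros c simp: supp)
  then show ?thesis using i by simp
qed

text \<open>Writing B_M for the bump and n for the dimension, the Laplacian of B_M is -2Mn B_(M-1) +
  4M(M-1) |x - a|^2 B_(M-2). The relation |x - a|^2 B_(M-2) = R^2 B_(M-2) - B_(M-1) then removes the
  polynomial factor and leaves constants only.\<close>

lemma integral_neg_laplace_bump: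
  fixes w :: "real^'n::finite \<Rightarrow> real"
  assumes w: "C_class 2 w" and M: "3 \<le> M" and R: "0 \<le> R"
  shows "(LINT x|lborel. neg_laplace w x * bump M a R x) =
    2 * real M * (real CARD('n) + 2 * real M - 2) * (LINT x|lborel. w x * bump (M - 1) a R x) -
    4 * real M * real (M - 1) * R\<^sup>2 * (LINT x|lborel. w x * bump (M - 2) a R x)"
proof -
  define r where "r = norm a + R"
  have w2: "C_class (Suc (Suc 0)) w" using w by (simp add: numeral_2_eq_2)
  have c0: "continuous_on UNIV w" using w by (rule C_class_continuous)
  have w': "has_pderiv i w (partial_deriv i w)" "C_class (Suc 0) (partial_deriv i w)" for i
    using w2 by (rule C_class_pderiv, rule C_class_partial_deriv)
  have w'': "has_pderiv i (partial_deriv i w) (partial_deriv i (partial_deriv i w))"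
    "continuous_on UNIV (partial_deriv i w)" "continuous_on UNIV (partial_deriv i (partial_deriv i w))" for i
    using w'(2)[of i] by (auto intro: C_class_pderiv C_class_continuous C_class_partial_deriv)
  define p' where "p' i x = - 2 * real M * ((x - a) $ i) * bump (M - 1) a R x" for i x
  define p'' where "p'' i x = - 2 * real M * bump (M - 1) a R x +
      4 * real M * real (M - 1) * ((x - a) $ i)\<^sup>2 * bump (M - 2) a R x" for i x
  have hp: "has_pderiv i (bump M a R) (p' i)" "has_pderiv i (p' i) (p'' i)" for i
    unfolding p'_def p''_def using M by (intro bump_pderiv bump_pderiv2; simp)+
  have cp: "continuous_on UNIV (p' i)" "continuous_on UNIV (p'' i)" for i
    unfolding p'_def p''_def by (intro continuous_intros bump_continuous)+
  have supp: "bump k a R x = 0" if "0 < k" "norm x > r" for k x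
    using that R unfolding r_def by (intro bump_support)
  have supp': "p' i x = 0" "p'' i x = 0" if "norm x > r" for i x
    using supp[of "M - 1" x] supp[of "M - 2" x] that M by (simp_all add: p'_def p''_def)
  have twice: "(LINT x|lborel. partial_deriv i (partial_deriv i w) x * bump M a R x) =
      (LINT x|lborel. w x * p'' i x)" for i
  proof -
    have "(LINT x|lborel. partial_deriv i (partial_deriv i w) x * bump M a R x) =
        - (LINT x|lborel. partial_deriv i w x * p' i x)"
      using M by (intro integration_by_parts[OF w''(1) hp(1) w''(2,3) bump_continuous cp(1) supp supp'(1)]) auto
    also have "\<dots> = (LINT x|lborel. w x * p'' i x)"
      using integration_by_parts[OF w'(1) hp(2) c0 w''(2) cp supp'] by simp
    finally show ?thesis .
  qed
  have i1: "integrable lborel (\<lambda>x. partial_deriv i (partial_deriv i w) x * bump M a R x)" for i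
    using M by (intro integrable_compact_support[where R = r] continuous_on_mult w'' bump_continuous) (simp add: supp)
  have i2: "integrable lborel (\<lambda>x. w x * p'' i x)" for i
    by (intro integrable_compact_support[where R = r] continuous_on_mult c0 cp) (simp add: supp')
  have i3: "integrable lborel (\<lambda>x. w x * bump k a R x)" if "0 < k" for k
    using that by (intro integrable_compact_support[where R = r] continuous_on_mult c0 bump_continuous) (simp add: supp)
  have "(LINT x|lborel. neg_laplace w x * bump M a R x) =
      (LINT x|lborel. - (\<Sum>i\<in>UNIV. partial_deriv i (partial_deriv i w) x * bump M a R x))"
    by (simp add: neg_laplace_def sum_distrib_right)
  also have "\<dots> = - (\<Sum>i\<in>UNIV. LINT x|lborel. w x * p'' i x)"
    by (simp add: Bochner_Integration.integral_sum i1 twice)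
  also have "\<dots> = (LINT x|lborel. - (\<Sum>i\<in>UNIV. w x * p'' i x))"
    by (simp add: Bochner_Integration.integral_sum i2)
  also have "\<dots> = (LINT x|lborel. 2 * real M * (real CARD('n) + 2 * real M - 2) * (w x * bump (M - 1) a R x) -
      4 * real M * real (M - 1) * R\<^sup>2 * (w x * bump (M - 2) a R x))"
  proof (rule Bochner_Integration.integral_cong[OF refl])
    fix x
    have sq: "(\<Sum>i\<in>UNIV. ((x - a) $ i)\<^sup>2) = (norm (x - a))\<^sup>2"
      unfolding power2_norm_eq_inner inner_vec_def by (simp add: power2_eq_square)
    have "(\<Sum>i\<in>UNIV. p'' i x) = - 2 * real M * real CARD('n) * bump (M - 1) a R x +
        4 * real M * real (M - 1) * (norm (x - a))\<^sup>2 * bump (M - 2) a R x"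
      unfolding p''_def sum.distrib sq[symmetric] by (simp add: sum_distrib_left sum_distrib_right mult_ac)
    moreover have "(norm (x - a))\<^sup>2 * bump (M - 2) a R x = R\<^sup>2 * bump (M - 2) a R x - bump (M - 1) a R x"
    proof -
      have "Suc (M - 2) = M - 1" using M by simp
      with bump_Suc[of "M - 2" a R x] M show ?thesis by (simp add: algebra_simps)
    qed
    ultimately have "(\<Sum>i\<in>UNIV. p'' i x) = - 2 * real M * real CARD('n) * bump (M - 1) a R x +
        4 * real M * real (M - 1) * (R\<^sup>2 * bump (M - 2) a R x - bump (M - 1) a R x)"
      by (simp only: mult.assoc)
    moreover have "real (M - 1) = real M - 1" using M by simp
    ultimately have "- (w x * (\<Sum>i\<in>UNIV. p'' i x)) =
        2 * real M * (real CARD('n) + 2 * real M - 2) * (w x * bump (M - 1) a R x) -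
        4 * real M * real (M - 1) * R\<^sup>2 * (w x * bump (M - 2) a R x)"
      by (simp only:) (simp add: algebra_simps)
    then show "- (\<Sum>i\<in>UNIV. w x * p'' i x) =
        2 * real M * (real CARD('n) + 2 * real M - 2) * (w x * bump (M - 1) a R x) -
        4 * real M * real (M - 1) * R\<^sup>2 * (w x * bump (M - 2) a R x)"
      by (simp only: sum_distrib_left)
  qed
  also have "\<dots> = 2 * real M * (real CARD('n) + 2 * real M - 2) * (LINT x|lborel. w x * bump (M - 1) a R x) -
    4 * real M * real (M - 1) * R\<^sup>2 * (LINT x|lborel. w x * bump (M - 2) a R x)"
    using i3[of "M - 1"] i3[of "M - 2"] M by simp
  finally show ?thesis .
qed

text \<open>In normalized form both terms of the identity for the integral carry a factor R^-2:
  lowering the exponent by one lowers the normalization by R^2, and lowering it by two by R^4, of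
  which the coefficient gives back R^2.\<close>

lemma bump_avg_neg_laplace:
  fixes w :: "real^'n::finite \<Rightarrow> real"
  assumes w: "C_class 2 w" and M: "3 \<le> M"
    and lim: "(bump_avg (M - 1) a w \<longlongrightarrow> 0) at_top" "(bump_avg (M - 2) a w \<longlongrightarrow> 0) at_top"
  shows "(bump_avg M a (neg_laplace w) \<longlongrightarrow> 0) at_top"
proof -
  define A where "A = 2 * real M * (real CARD('n) + 2 * real M - 2)"
  define B where "B = 4 * real M * real (M - 1)"
  have "((\<lambda>R. (A * bump_avg (M - 1) a w R - B * bump_avg (M - 2) a w R) * (1 / R\<^sup>2)) \<longlongrightarrow> (A * 0 - B * 0) * 0) at_top"
  proof (intro tendsto_intros lim)
    show "((\<lambda>R::real. 1 / R\<^sup>2) \<longlongrightarrow> 0) at_top"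
      by (intro tendsto_divide_0[OF tendsto_const] filterlim_at_top_imp_at_infinity
          filterlim_pow_at_top filterlim_ident) simp
  qed
  moreover have "\<forall>\<^sub>F R in at_top. (A * bump_avg (M - 1) a w R - B * bump_avg (M - 2) a w R) * (1 / R\<^sup>2) =
      bump_avg M a (neg_laplace w) R"
    using eventually_gt_at_top[of 0]
  proof eventually_elim
    fix R :: real assume R: "0 < R"
    have e: "DIM(real^'n) + 2 * M = (DIM(real^'n) + 2 * (M - 1)) + 2"
      "DIM(real^'n) + 2 * M = (DIM(real^'n) + 2 * (M - 2)) + 2 + 2" using M by auto
    have "R ^ (DIM(real^'n) + 2 * M) = R ^ (DIM(real^'n) + 2 * (M - 1)) * R\<^sup>2"
      "R ^ (DIM(real^'n) + 2 * M) = R ^ (DIM(real^'n) + 2 * (M - 2)) * R\<^sup>2 * R\<^sup>2"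
      unfolding power_add[symmetric] using e by simp_all
    then have f: "q / R ^ (DIM(real^'n) + 2 * (M - 1)) * (1 / R\<^sup>2) = q / R ^ (DIM(real^'n) + 2 * M)"
      "q / R ^ (DIM(real^'n) + 2 * (M - 2)) * (1 / R\<^sup>2) = R\<^sup>2 * q / R ^ (DIM(real^'n) + 2 * M)" for q
      using R by (simp_all add: field_simps)
    have "(A * bump_avg (M - 1) a w R - B * bump_avg (M - 2) a w R) * (1 / R\<^sup>2) =
        A * (bump_avg (M - 1) a w R * (1 / R\<^sup>2)) - B * (bump_avg (M - 2) a w R * (1 / R\<^sup>2))"
      by (simp add: diff_divide_distrib)
    also have "\<dots> = bump_avg M a (neg_laplace w) R"
      unfolding bump_avg_def f integral_neg_laplace_bump[OF w M less_imp_le[OF R]] A_def[symmetric] B_def[symmetric]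
      by (simp add: diff_divide_distrib mult_ac)
    finally show "(A * bump_avg (M - 1) a w R - B * bump_avg (M - 2) a w R) * (1 / R\<^sup>2) =
      bump_avg M a (neg_laplace w) R" .
  qed
  ultimately show ?thesis by (simp add: Lim_transform_eventually)
qed

section \<open>Dependence of the averages on the radius\<close>

lemma DERIV_integral_bump:
  fixes w :: "'a::euclidean_space \<Rightarrow> real"
  assumes c: "continuous_on UNIV w" and M: "2 \<le> M" and r: "0 < r"
  shows "((\<lambda>r. LINT x|lborel. w x * bump M a r x) has_real_derivative
    2 * real M * r * (LINT x|lborel. w x * bump (M - 1) a r x)) (at r)"
proof -
  have wm [measurable]: "w \<in> borel_measurable borel" using c by (rule borel_measurable_continuous_onI)
  have bm [measurable]: "bump k a t \<in> borel_measurable borel" for k t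
    by (intro borel_measurable_continuous_onI bump_continuous)
  have i: "integrable lborel (\<lambda>x. w x * bump k a t x)" if "0 < k" "0 \<le> t" for k t
    using that by (intro integrable_compact_support[where R = "norm a + t"] continuous_on_mult c bump_continuous)
      (simp add: bump_support)
  have "((\<lambda>r. LINT x|lborel. w x * bump M a r x) has_real_derivative
      (LINT x|lborel. w x * (real M * bump (M - 1) a r x * (2 * r)))) (at r)"
  \<comment> \<open>The radius t ranges over the interval from 0 to 2r, and bumps grow with the
    radius, so the value at 2r dominates.\<close>
  proof (rule has_real_derivative_integral[where d = r
        and B = "\<lambda>x. (4 * real M * r) * \<bar>w x * bump (M - 1) a (2 * r) x\<bar>"
        and F' = "\<lambda>t x. w x * (real M * bump (M - 1) a t x * (2 * t))"])
    fix t assume t: "\<bar>t - r\<bar> < r"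
    then show "integrable lborel (\<lambda>x. w x * bump M a t x)" using M by (intro i) auto
    fix x
    have "((\<lambda>t. t\<^sup>2 - (norm (x - a))\<^sup>2) has_real_derivative 2 * t) (at t)"
      by (auto intro!: derivative_eq_intros)
    from DERIV_cmult[OF DERIV_chain2[OF DERIV_pos_part_power[OF M] this], of "w x"]
    show "((\<lambda>t. w x * bump M a t x) has_real_derivative w x * (real M * bump (M - 1) a t x * (2 * t))) (at t)"
      unfolding bump_def .
    have "bump (M - 1) a t x \<le> bump (M - 1) a (2 * r) x"
      unfolding bump_def using t by (intro power_mono max.mono diff_right_mono) auto
    then have "real M * bump (M - 1) a t x * (2 * t) \<le> real M * bump (M - 1) a (2 * r) x * (2 * (2 * r))"
      using t by (intro mult_mono) (auto intro!: mult_nonneg_nonneg bump_nonneg)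
    moreover have "0 \<le> real M * bump (M - 1) a t x * (2 * t)"
      using t by (intro mult_nonneg_nonneg bump_nonneg) auto
    ultimately have "\<bar>w x\<bar> * \<bar>real M * bump (M - 1) a t x * (2 * t)\<bar> \<le>
        \<bar>w x\<bar> * (real M * bump (M - 1) a (2 * r) x * (2 * (2 * r)))"
      by (intro mult_left_mono) auto
    then show "\<bar>w x * (real M * bump (M - 1) a t x * (2 * t))\<bar> \<le> (4 * real M * r) * \<bar>w x * bump (M - 1) a (2 * r) x\<bar>"
      by (simp add: abs_mult bump_nonneg mult_ac)
  next
    show "integrable lborel (\<lambda>x. (4 * real M * r) * \<bar>w x * bump (M - 1) a (2 * r) x\<bar>)"
      using M r by (intro integrable_mult_right integrable_abs i) auto
  qed (use r in \<open>simp_all, measurable\<close>)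
  also have "(LINT x|lborel. w x * (real M * bump (M - 1) a r x * (2 * r))) =
      (LINT x|lborel. (2 * real M * r) * (w x * bump (M - 1) a r x))"
    by (simp add: mult_ac)
  finally show ?thesis by simp
qed

text \<open>With K = n + 2M and Q_M(t) the integral of w against the bump of radius t, the
  derivative of Q_M(t) / t^K has the sign of 2M t^2 Q_(M-1)(t) - K Q_M(t). The identity for the
  exponent M + 1 says that this is a negative multiple of the integral of
  \<open>neg_laplace w\<close> against the bump of exponent M + 1.\<close>

lemma bump_avg_antimono:
  fixes w :: "real^'n::finite \<Rightarrow> real"
  assumes w: "C_class 2 w" and sup: "\<And>x. 0 \<le> neg_laplace w x" and M: "2 \<le> M" and r: "0 < r" "r \<le> r'"
  shows "bump_avg M a w r' \<le> bump_avg M a w r"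
proof (rule DERIV_nonpos_imp_nonincreasing[OF r(2)], intro exI conjI)
  fix t assume "r \<le> t"
  then have t: "0 < t" using r by simp
  define K where "K = DIM(real^'n) + 2 * M"
  define Q where "Q k s = (LINT x|lborel. w x * bump k a s x)" for k s
  have c: "continuous_on UNIV w" using w by (rule C_class_continuous)
  have "((\<lambda>s. Q M s / s ^ K) has_real_derivative
      (2 * real M * t * Q (M - 1) t * t ^ K - Q M t * (real K * t ^ (K - 1))) / (t ^ K * t ^ K)) (at t)"
    unfolding Q_def using t by (intro DERIV_divide DERIV_integral_bump[OF c M t]) (auto intro!: derivative_eq_intros)
  then show "(bump_avg M a w has_real_derivative
      (2 * real M * t * Q (M - 1) t * t ^ K - Q M t * (real K * t ^ (K - 1))) / (t ^ K * t ^ K)) (at t)"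
    unfolding bump_avg_def [abs_def] Q_def K_def .
  have "0 \<le> (LINT x|lborel. neg_laplace w x * bump (M + 1) a t x)"
    by (intro integral_nonneg_AE) (simp add: sup bump_nonneg)
  also have "\<dots> = 2 * real (M + 1) * (real CARD('n) + 2 * real (M + 1) - 2) * Q M t -
      4 * real (M + 1) * real M * t\<^sup>2 * Q (M - 1) t"
    using integral_neg_laplace_bump[OF w, of "M + 1" t a] M t by (simp add: Q_def)
  also have "\<dots> = (2 * real (M + 1)) * (real K * Q M t - 2 * real M * t\<^sup>2 * Q (M - 1) t)"
    by (simp add: K_def algebra_simps)
  finally have "2 * real M * t\<^sup>2 * Q (M - 1) t - real K * Q M t \<le> 0"
    by (simp add: zero_le_mult_iff)
  then have "(2 * real M * t\<^sup>2 * Q (M - 1) t - real K * Q M t) * t ^ (K - 1) \<le> 0"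
    using t by (simp add: mult_nonpos_nonneg)
  moreover have "t ^ K = t * t ^ (K - 1)" using M by (simp add: K_def power_eq_if)
  ultimately have "2 * real M * t * Q (M - 1) t * t ^ K - Q M t * (real K * t ^ (K - 1)) \<le> 0"
    by (simp add: algebra_simps power2_eq_square)
  then show "(2 * real M * t * Q (M - 1) t * t ^ K - Q M t * (real K * t ^ (K - 1))) / (t ^ K * t ^ K) \<le> 0"
    using t by (simp add: divide_nonpos_pos)
qed

text \<open>Convergence of the averages as the radius shrinks is avoided: if w were negative at a,
  continuity would make it negative on a small ball, and the average over that single ball would
  already be negative.\<close>

lemma superharmonic_nonneg:
  fixes w :: "real^'n::finite \<Rightarrow> real"
  assumes w: "C_class 2 w" and sup: "\<And>x. 0 \<le> neg_laplace w x" and M: "2 \<le> M"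
    and lim: "(bump_avg M a w \<longlongrightarrow> 0) at_top"
  shows "0 \<le> w a"
proof (rule ccontr)
  assume neg: "\<not> 0 \<le> w a"
  have c: "continuous_on UNIV w" using w by (rule C_class_continuous)
  then have "isCont w a" by (simp add: continuous_on_eq_continuous_at)
  then obtain r where r: "r > 0" "\<And>x. dist x a < r \<Longrightarrow> dist (w x) (w a) < - w a / 2"
    using neg unfolding continuous_at_eps_delta by (metis neg_0_less_iff_less half_gt_zero not_le)
  define \<delta> where "\<delta> = - w a / 2"
  have \<delta>: "\<delta> > 0" using neg by (simp add: \<delta>_def)
  have wneg: "w x \<le> - \<delta>" if "norm (x - a) < r" for x
    using r(2)[of x] that by (auto simp: \<delta>_def dist_norm abs_if split: if_splits)
  have avg: "0 \<le> bump_avg M a w r"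
  proof (rule tendsto_upperbound[OF lim])
    show "\<forall>\<^sub>F R in at_top. bump_avg M a w R \<le> bump_avg M a w r"
      using eventually_ge_at_top[of r] by eventually_elim (rule bump_avg_antimono[OF w sup M r(1)])
  qed simp
  \<comment> \<open>On the ball of half the radius w is at most -\<delta> and the bump is at least
    its value at distance r/2; the product of the two bounds gives strict negativity of the
    integral.\<close>
  define e where "e = \<delta> * (r\<^sup>2 - (r / 2)\<^sup>2) ^ M"
  have rr: "0 < r\<^sup>2 - (r / 2)\<^sup>2" using r(1) by (simp add: power_divide)
  have e: "e > 0" unfolding e_def using \<delta> rr by simp
  have pt: "w x * bump M a r x \<le> - e * indicator (cball a (r / 2)) x" for x
  proof (cases "norm (x - a) \<le> r / 2")
    case True
    have "(r\<^sup>2 - (r / 2)\<^sup>2) ^ M \<le> bump M a r x"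
      unfolding bump_def using True rr power_mono[OF True, of 2] by (intro power_mono) auto
    then have "e \<le> \<delta> * bump M a r x" unfolding e_def using \<delta> by (intro mult_left_mono) auto
    moreover have "w x * bump M a r x \<le> - \<delta> * bump M a r x"
      using wneg[of x] True r(1) by (intro mult_right_mono bump_nonneg) auto
    ultimately show ?thesis using True by (simp add: dist_norm norm_minus_commute)
  next
    case False
    show ?thesis
    proof (cases "norm (x - a) < r")
      case True
      then have "w x * bump M a r x \<le> 0"
        using wneg[OF True] \<delta> by (intro mult_nonpos_nonneg bump_nonneg) auto
      then show ?thesis using False by (simp add: dist_norm norm_minus_commute)
    next
      case F: False
      then show ?thesis using False M r(1) bump_eq_0[of M r x a] by (simp add: dist_norm norm_minus_commute)
    qed
  qed
  have "(LINT x|lborel. w x * bump M a r x) \<le> (LINT x|lborel. - e * indicator (cball a (r / 2)) x)"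
  proof (rule integral_mono[OF _ _ pt])
    show "integrable lborel (\<lambda>x. w x * bump M a r x)"
      using M r(1) by (intro integrable_compact_support[where R = "norm a + r"] continuous_on_mult c bump_continuous)
        (simp add: bump_support)
    show "integrable lborel (\<lambda>x. - e * indicator (cball a (r / 2)) x)"
      using borel_integrable_compact[of "cball a (r / 2)" "\<lambda>_. - e"] by (simp add: mult.commute)
  qed
  also have "\<dots> = - e * measure lborel (cball a (r / 2))" by simp
  also have "\<dots> < 0" using e r(1) content_cball_pos[of "r / 2" a] by simp
  finally have "bump_avg M a w r < 0"
    unfolding bump_avg_def using r(1) by (simp add: divide_neg_pos)
  then show False using avg by simp
qed

section \<open>Descent from the highest power of the Laplacian\<close>

theorem theorem1p1:
  fixes u :: "real^'n::finite \<Rightarrow> real"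
    and f :: "real^'n \<Rightarrow> ('n list \<Rightarrow> real) \<Rightarrow> real"
    and m :: nat and \<alpha> \<epsilon> :: real
  defines "k \<equiv> 2 * m + nat \<lfloor>\<alpha>\<rfloor>"
  assumes "CARD('n) \<ge> 2"
    and "m \<ge> 1"
    and "0 < \<alpha>" and "\<alpha> < 2"
    and "\<And>x p. f x p \<ge> 0"
    and "continuous_on UNIV (\<lambda>x. f x (jet k u x))"
    and "\<epsilon> > 0" and "frac \<alpha> + \<epsilon> < 1"
    and "u \<in> C_Holder_loc k (frac \<alpha> + \<epsilon>)"
    and "u \<in> L_space \<alpha>"
    and "\<And>x. u x \<ge> 0"
    and "\<And>x. higher_frac_laplace m \<alpha> u x = f x (jet k u x)"
  shows "\<forall>i\<in>{0..m-1}. \<forall>x. higher_frac_laplace i \<alpha> u x \<ge> 0"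
proof -
  note \<alpha> = \<open>0 < \<alpha>\<close> \<open>\<alpha> < 2\<close> and \<epsilon> = \<open>\<epsilon> > 0\<close> \<open>frac \<alpha> + \<epsilon> < 1\<close>
  define s where "s = real CARD('n) + \<alpha>"
  \<comment> \<open>The second inequality lets the second differences of the bump, of order 2,
    absorb the singularity of the kernel; the third does the same for u and rests on \<epsilon> >
    0.\<close>
  have s: "s > real CARD('n)" "s < real CARD('n) + 2" "s < (\<alpha> + \<epsilon>) + real CARD('n)"
    using \<alpha> \<epsilon> by (simp_all add: s_def)
  have Cu: "C_class (2 * m) u"
    using \<open>u \<in> C_Holder_loc k (frac \<alpha> + \<epsilon>)\<close> by (auto simp: C_Holder_loc_def k_def intro: C_class_mono)
  have c: "continuous_on UNIV u" using Cu by (rule C_class_continuous)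
  have sd: "sd_bounded (\<alpha> + \<epsilon>) (partial_derivs is u)" if "length is \<le> 2 * m" for "is"
    using \<open>u \<in> C_Holder_loc k (frac \<alpha> + \<epsilon>)\<close> \<alpha> \<epsilon> that unfolding k_def
    by (rule C_Holder_loc_imp_sd_bounded)
  have sd0: "sd_bounded (\<alpha> + \<epsilon>) u" using sd[of "[]"] by simp
  have [measurable]: "u \<in> borel_measurable borel" using c by (rule borel_measurable_continuous_onI)
  \<comment> \<open>\<open>L_space\<close> refers to the completed measure; continuity makes u Borel
    measurable, so integrability passes to \<open>lborel\<close>.\<close>
  have w: "integrable lborel (\<lambda>y. \<bar>u y\<bar> * weight s y)"
  proof -
    have "integrable lebesgue (\<lambda>y. \<bar>u y\<bar> * weight s y)"
      using \<open>u \<in> L_space \<alpha>\<close> by (simp add: L_space_def weight_def s_def)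
    moreover have "(\<lambda>y. \<bar>u y\<bar> * weight s y) \<in> borel_measurable lborel" by measurable
    ultimately show ?thesis by (simp only: integrable_completion)
  qed
  define c0 where "c0 = frac_laplace_const CARD('n) \<alpha> / 2"
  define v where "v j = higher_frac_laplace j \<alpha> u" for j
  have v0: "v 0 = (\<lambda>x. c0 * frac_integral s u x)"
    using frac_laplace_eq[OF c w[unfolded s_def] sd0 \<alpha>(1)] \<epsilon>
    by (auto simp: v_def higher_frac_laplace_def c0_def s_def)
  have vSuc: "v (Suc j) = neg_laplace (v j)" for j
    by (simp add: v_def higher_frac_laplace_def)
  have Cv: "C_class (2 * (m - j)) (v j)" if "j \<le> m" for j
    using that
  proof (induction j)
    case 0
    have "C_class (2 * m) (frac_integral s u)"
      using s by (intro C_class_frac_integral[OF Cu sd w]) auto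
    then show ?case unfolding v0 by (simp add: C_class_cmult)
  next
    case (Suc j)
    then have "2 * (m - j) = 2 * (m - Suc j) + 2" by simp
    then have "C_class (2 * (m - Suc j) + 2) (v j)" using Suc by simp
    then show ?case unfolding vSuc by (rule C_class_neg_laplace)
  qed
  have C2: "C_class 2 (v j)" if "j < m" for j
    using that by (intro C_class_mono[OF Cv]) auto
  \<comment> \<open>Each Laplacian draws on the averages with exponents M - 1 and M - 2, so the base
    requirement 3 \<le> M grows by two per step. The induction therefore varies M.\<close>
  have avg: "(bump_avg M a (v j) \<longlongrightarrow> 0) at_top" if "j < m" "2 * j + 3 \<le> M" for j M a
    using that
  proof (induction j arbitrary: M)
    case 0
    have "((\<lambda>R. c0 * bump_avg M a (frac_integral s u) R) \<longlongrightarrow> 0) at_top"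
      using 0 by (intro tendsto_mult_right_zero bump_avg_frac_integral[OF c w sd0 s]) simp
    then show ?case unfolding v0 by (simp add: bump_avg_def [abs_def] mult.assoc)
  next
    case (Suc j)
    then show ?case unfolding vSuc by (intro bump_avg_neg_laplace C2 Suc.IH) auto
  qed
  \<comment> \<open>Descending induction, with d the distance from the top order m, where the sign
    is that of f.\<close>
  have step: "0 \<le> v (m - d) x" if "d \<le> m" for d x
    using that
  proof (induction d arbitrary: x)
    case 0
    then show ?case
      using \<open>\<And>x. higher_frac_laplace m \<alpha> u x = f x (jet k u x)\<close> \<open>\<And>x p. f x p \<ge> 0\<close> by (simp add: v_def)
  next
    case (Suc d)
    then have j: "m - Suc d < m" and e: "m - d = Suc (m - Suc d)" by auto
    show ?case
    proof (rule superharmonic_nonneg[OF C2[OF j]])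
      show "0 \<le> neg_laplace (v (m - Suc d)) y" for y
        using Suc.IH[of y] Suc.prems by (simp add: e vSuc)
      show "(bump_avg (2 * (m - Suc d) + 3) x (v (m - Suc d)) \<longlongrightarrow> 0) at_top"
        by (rule avg[OF j order_refl])
    qed simp
  qed
  show ?thesis
  proof (intro ballI allI)
    fix i x assume "i \<in> {0..m - 1}"
    then have "m - (m - i) = i" using \<open>m \<ge> 1\<close> by auto
    then show "0 \<le> higher_frac_laplace i \<alpha> u x" using step[of "m - i" x] by (simp add: v_def)
  qed
qed

end
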